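(* Let $\phi$ be a Szeg\H{o}-type symbol. For $\ell=1,2$ let $\psi_\ell(z)=q^{(\ell)}_1(z)\phi(z)+q^{(\ell)}_2(z)$, where $$q^{(\ell)}_1(z)=a^{(\ell)}_0+a^{(\ell)}_1z+\frac{b^{(\ell)}_0}{z}+\sum_{j=1}^{m_\ell}\frac{b^{(\ell)}_jz}{z-c^{(\ell)}_j},\qquad q^{(\ell)}_2(z)=\hat a^{(\ell)}_0+\hat a^{(\ell)}_1z+\frac{\hat b^{(\ell)}_0}{z}+\sum_{j=1}^{m_\ell}\frac{\hat b^{(\ell)}_j}{z-c^{(\ell)}_j},$$ all parameters are complex, and the $c^{(\ell)}_j$ are nonzero and do not lie on the unit circle. Then, as $n\to\infty$, $$D^B_n[\phi;\psi_1,\psi_2]=G[\phi]^nE[\phi]\left\{J_1[\phi,\psi_1,\psi_2]+O(\rho^{-n})\right\},$$ where $$J_1[\phi,\psi_1,\psi_2]=\det\begin{bmatrix}F[\phi;\psi_2]&F[\phi;\psi_1]\\H[\phi;\psi_2]&H[\phi;\psi_1]\end{bmatrix},$$ and for $\ell=1,2$ $$F[\phi;\psi_\ell]=a^{(\ell)}_0+b^{(\ell)}_0[\log\phi]_1+\sum_{\substack{1\le j\le m_\ell\\0<|c^{(\ell)}_j|<1}}b^{(\ell)}_j\frac{\alpha(c^{(\ell)}_j)}{\alpha(0)}+\frac1{\alpha(0)}\Bigg(\hat a^{(\ell)}_0-\hat a^{(\ell)}_1[\log\phi]_{-1}-\sum_{\substack{1\le j\le m_\ell\\|c^{(\ell)}_j|>1}}\frac{\hat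 b^{(\ell)}_j}{c^{(\ell)}_j}\alpha(c^{(\ell)}_j)\Bigg),$$ $$H[\phi;\psi_\ell]=a^{(\ell)}_1-\sum_{j=1}^{m_\ell}\frac{b^{(\ell)}_j}{c^{(\ell)}_j}+a^{(\ell)}_0[\log\phi]_1+b^{(\ell)}_0[\log\phi]_2+\frac{b^{(\ell)}_0}{2}[\log\phi]_1^2+\frac1{G[\phi]}\Bigg(\hat a^{(\ell)}_1-\sum_{\substack{1\le j\le m_\ell\\|c^{(\ell)}_j|>1}}\frac{\hat b^{(\ell)}_j}{(c^{(\ell)}_j)^2}\alpha(c^{(\ell)}_j)+\sum_{\substack{1\le j\le m_\ell\\0<|c^{(\ell)}_j|<1}}\frac{b^{(\ell)}_j}{c^{(\ell)}_j}\alpha(c^{(\ell)}_j)\Bigg).$$ Here $\rho>1$ is a number such that $\rho<|c^{(\ell)}_j|$ for all $\ell,j$ with $|c^{(\ell)}_j|>1$, $|c^{(\ell)}_j|<\rho^{-1}$ for all $\ell,j$ with $0<|c^{(\ell)}_j|<1$, and $\phi$ is analytic in the annulus $\{z:\rho^{-1}<|z|<\rho\}$.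
   Context: $\mathbb T$ is the unit circle oriented counterclockwise. For $f\in L^1(\mathbb T)$, $f_j=[f]_j=\int_{\mathbb T}f(\zeta)\zeta^{-j}\frac{d\zeta}{2\pi i\zeta}$ is its $j$-th Fourier coefficient. A symbol $\phi$ is of Szeg\H{o}-type if it is $C^\infty$ and nonzero on $\mathbb T$, has zero winding number, and admits an analytic continuation to some neighborhood of $\mathbb T$. The two-bordered Toeplitz determinant $D^B_n[\phi;\psi_1,\psi_2]$ ($n\ge3$) is the determinant of the $n\times n$ matrix whose row $j$ ($0\le j\le n-1$) has entries $\phi_{k-j}$ in columns $0\le k\le n-3$, the entry $\psi_{1,n-1-j}$ in column $n-2$, and the entry $\psi_{2,n-1-j}$ in column $n-1$, where $\psi_{\ell,i}$ is the $i$-th Fourier coefficient of $\psi_\ell$. $G[\phi]=\exp([\log\phi]_0)$, $E[\phi]=\exp\big(\sum_{k\ge1}k[\log\phi]_k[\log\phi]_{-k}\big)$, and $\alpha(z)=\exp\left[\frac1{2\pi i}\int_{\mathbb T}\frac{\ln\phi(\tau)}{\tau-z}d\tau\right]$ for $z\notin\mathbb T$.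
   Formalization: The condition that φ is analytic in the annulus ρ^{-1}<|z|<ρ is strengthened to: φ has an analytic continuation there without zeros; otherwise the error bound fails for some ρ, e.g. φ=(1-az)(1-b/z), ψ_1=zφ, ψ_2=φ. Existence of such a ρ is also proved. *)

theory Defs
  imports
    "HOL-Complex_Analysis.Complex_Analysis"
    "HOL-Library.Landau_Symbols"
    "Jordan_Normal_Form.Determinant"
begin

abbreviation unit_circle :: "complex set" where
  "unit_circle \<equiv> sphere 0 1"

definition fourier_coeff :: "(complex \<Rightarrow> complex) \<Rightarrow> int \<Rightarrow> complex" where
  "fourier_coeff f j =
     contour_integral (circlepath 0 1) (\<lambda>\<zeta>. f \<zeta> * \<zeta> powi (- j) / (2 * of_real pi * \<i> * \<zeta>))"

text \<open>A symbol is a function on the unit circle. It is represented by a total function on the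
  complex plane whose values off the circle are irrelevant; analytic continuations are separate
  functions that agree with it on the circle.\<close>

definition smooth_on_circle :: "(complex \<Rightarrow> complex) \<Rightarrow> bool" where
  "smooth_on_circle \<phi> \<longleftrightarrow>
     (\<forall>k t. ((\<lambda>f s. vector_derivative f (at s)) ^^ k) (\<lambda>s::real. \<phi> (cis s)) differentiable (at t))"

definition szego_type :: "(complex \<Rightarrow> complex) \<Rightarrow> bool" where
  "szego_type \<phi> \<longleftrightarrow>
     smooth_on_circle \<phi> \<and>
     (\<forall>z\<in>unit_circle. \<phi> z \<noteq> 0) \<and>
     winding_number (\<phi> \<circ> circlepath 0 1) 0 = 0 \<and>
     (\<exists>U \<Phi>. open U \<and> unit_circle \<subseteq> U \<and> \<Phi> holomorphic_on U \<and> (\<forall>z\<in>unit_circle. \<Phi> z = \<phi> z))"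

text \<open>A continuous logarithm of the symbol on the circle. It exists because the winding number is
  zero, and is unique up to an additive constant in \<open>2\<pi>\<i>\<int>\<close>. The quantities below
  do not depend on the choice: the constant only changes \<open>[log \<phi>]\<^sub>0\<close>, which enters through
  \<open>exp\<close>, and it multiplies \<open>\<alpha>\<close> by 1.\<close>

definition log_symbol :: "(complex \<Rightarrow> complex) \<Rightarrow> complex \<Rightarrow> complex" where
  "log_symbol \<phi> =
     (SOME g. continuous_on unit_circle g \<and> (\<forall>z\<in>unit_circle. exp (g z) = \<phi> z))"

abbreviation log_coeff :: "(complex \<Rightarrow> complex) \<Rightarrow> int \<Rightarrow> complex" where
  "log_coeff \<phi> j \<equiv> fourier_coeff (log_symbol \<phi>) j"

definition szego_G :: "(complex \<Rightarrow> complex) \<Rightarrow> complex" where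
  "szego_G \<phi> = exp (log_coeff \<phi> 0)"

text \<open>The term with \<open>k = 0\<close> of the series vanishes.\<close>

definition szego_E :: "(complex \<Rightarrow> complex) \<Rightarrow> complex" where
  "szego_E \<phi> = exp (\<Sum>k::nat. of_nat k * log_coeff \<phi> (int k) * log_coeff \<phi> (- int k))"

definition szego_alpha :: "(complex \<Rightarrow> complex) \<Rightarrow> complex \<Rightarrow> complex" where
  "szego_alpha \<phi> z =
     exp (1 / (2 * of_real pi * \<i>) *
          contour_integral (circlepath 0 1) (\<lambda>\<tau>. log_symbol \<phi> \<tau> / (\<tau> - z)))"

definition bordered_toeplitz_matrix ::
    "(complex \<Rightarrow> complex) \<Rightarrow> (complex \<Rightarrow> complex) \<Rightarrow> (complex \<Rightarrow> complex) \<Rightarrow> nat \<Rightarrow> complex mat" where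
  "bordered_toeplitz_matrix \<phi> \<psi>1 \<psi>2 n =
     Matrix.mat n n (\<lambda>(j, k).
       if k < n - 2 then fourier_coeff \<phi> (int k - int j)
       else if k = n - 2 then fourier_coeff \<psi>1 (int n - 1 - int j)
       else fourier_coeff \<psi>2 (int n - 1 - int j))"

definition bordered_toeplitz_det ::
    "(complex \<Rightarrow> complex) \<Rightarrow> (complex \<Rightarrow> complex) \<Rightarrow> (complex \<Rightarrow> complex) \<Rightarrow> nat \<Rightarrow> complex" where
  "bordered_toeplitz_det \<phi> \<psi>1 \<psi>2 n = Determinant.det (bordered_toeplitz_matrix \<phi> \<psi>1 \<psi>2 n)"

text \<open>The parameters of one border function. The fields with a trailing \<open>h\<close> are the hatted
  parameters. \<open>bord_b\<close> and \<open>bord_bh\<close> are indexed by \<open>0..m\<close>, and \<open>bord_c\<close> by \<open>1..m\<close>.\<close>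

record border =
  bord_m :: nat
  bord_a0 :: complex
  bord_a1 :: complex
  bord_b :: "nat \<Rightarrow> complex"
  bord_a0h :: complex
  bord_a1h :: complex
  bord_bh :: "nat \<Rightarrow> complex"
  bord_c :: "nat \<Rightarrow> complex"

definition border_q1 :: "border \<Rightarrow> complex \<Rightarrow> complex" where
  "border_q1 B z = bord_a0 B + bord_a1 B * z + bord_b B 0 / z
     + (\<Sum>j=1..bord_m B. bord_b B j * z / (z - bord_c B j))"

definition border_q2 :: "border \<Rightarrow> complex \<Rightarrow> complex" where
  "border_q2 B z = bord_a0h B + bord_a1h B * z + bord_bh B 0 / z
     + (\<Sum>j=1..bord_m B. bord_bh B j / (z - bord_c B j))"

definition border_psi :: "(complex \<Rightarrow> complex) \<Rightarrow> border \<Rightarrow> complex \<Rightarrow> complex" where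
  "border_psi \<phi> B z = border_q1 B z * \<phi> z + border_q2 B z"

definition poles_ok :: "border \<Rightarrow> bool" where
  "poles_ok B \<longleftrightarrow> (\<forall>j\<in>{1..bord_m B}. bord_c B j \<noteq> 0 \<and> bord_c B j \<notin> unit_circle)"

abbreviation inner_poles :: "border \<Rightarrow> nat set" where
  "inner_poles B \<equiv> {j\<in>{1..bord_m B}. 0 < cmod (bord_c B j) \<and> cmod (bord_c B j) < 1}"

abbreviation outer_poles :: "border \<Rightarrow> nat set" where
  "outer_poles B \<equiv> {j\<in>{1..bord_m B}. cmod (bord_c B j) > 1}"

definition border_F :: "(complex \<Rightarrow> complex) \<Rightarrow> border \<Rightarrow> complex" where
  "border_F \<phi> B =
     bord_a0 B + bord_b B 0 * log_coeff \<phi> 1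
     + (\<Sum>j\<in>inner_poles B. bord_b B j * (szego_alpha \<phi> (bord_c B j) / szego_alpha \<phi> 0))
     + 1 / szego_alpha \<phi> 0 *
         (bord_a0h B - bord_a1h B * log_coeff \<phi> (- 1)
          - (\<Sum>j\<in>outer_poles B. bord_bh B j / bord_c B j * szego_alpha \<phi> (bord_c B j)))"

definition border_H :: "(complex \<Rightarrow> complex) \<Rightarrow> border \<Rightarrow> complex" where
  "border_H \<phi> B =
     bord_a1 B - (\<Sum>j=1..bord_m B. bord_b B j / bord_c B j)
     + bord_a0 B * log_coeff \<phi> 1 + bord_b B 0 * log_coeff \<phi> 2
     + bord_b B 0 / 2 * (log_coeff \<phi> 1)^2
     + 1 / szego_G \<phi> *
         (bord_a1h B
          - (\<Sum>j\<in>outer_poles B. bord_bh B j / (bord_c B j)^2 * szego_alpha \<phi> (bord_c B j))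
          + (\<Sum>j\<in>inner_poles B. bord_b B j / bord_c B j * szego_alpha \<phi> (bord_c B j)))"

definition border_J1 :: "(complex \<Rightarrow> complex) \<Rightarrow> border \<Rightarrow> border \<Rightarrow> complex" where
  "border_J1 \<phi> B1 B2 = Determinant.det (mat_of_rows_list 2
     [[border_F \<phi> B2, border_F \<phi> B1],
      [border_H \<phi> B2, border_H \<phi> B1]])"

text \<open>The conditions on \<open>\<rho>\<close>. Analyticity in the annulus includes that the continuation has no
  zeros there, i.e. that \<open>log \<phi>\<close> is analytic in the annulus as well. Without this the
  asymptotic formula fails for some admissible \<open>\<rho>\<close>: for \<open>\<phi>(z) = (1 - a z)(1 - b/z)\<close> with
  \<open>0 < |a|, |b| < 1\<close>, \<open>\<psi>\<^sub>1(z) = z \<phi>(z)\<close> and \<open>\<psi>\<^sub>2 = \<phi>\<close> the determinant is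
  \<open>(1 - (a b)^(n+1)) / (1 - a b)\<close>, although \<open>\<phi>\<close> is analytic in the punctured plane.\<close>

definition admissible_radius :: "(complex \<Rightarrow> complex) \<Rightarrow> border \<Rightarrow> border \<Rightarrow> real \<Rightarrow> bool" where
  "admissible_radius \<phi> B1 B2 \<rho> \<longleftrightarrow>
     \<rho> > 1 \<and>
     (\<forall>B\<in>{B1, B2}. \<forall>j\<in>{1..bord_m B}.
        (cmod (bord_c B j) > 1 \<longrightarrow> \<rho> < cmod (bord_c B j)) \<and>
        (0 < cmod (bord_c B j) \<and> cmod (bord_c B j) < 1 \<longrightarrow> cmod (bord_c B j) < inverse \<rho>)) \<and>
     (\<exists>\<Phi>. \<Phi> holomorphic_on {z. inverse \<rho> < cmod z \<and> cmod z < \<rho>} \<and>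
          (\<forall>z\<in>unit_circle. \<Phi> z = \<phi> z) \<and>
          (\<forall>z. inverse \<rho> < cmod z \<and> cmod z < \<rho> \<longrightarrow> \<Phi> z \<noteq> 0))"

end

theory Submission
  imports Defs
begin

text \<open>Factor the symbol as \<open>\<phi> = p m\<close> on the circle, where \<open>p\<close> has only powers \<open>\<ge> 0\<close> and \<open>m\<close> only powers
  \<open>\<le> 0\<close> of \<open>z\<close>. A linear system with the Toeplitz matrix of \<open>\<phi>\<close> says that a polynomial \<open>y\<close> of degree
  below \<open>n\<close> satisfies \<open>\<phi> y = \<psi> + N + M\<close> with \<open>N\<close> of powers \<open>< 0\<close> and \<open>M\<close> of powers \<open>\<ge> n\<close>. Dividing by
  \<open>m\<close> and by \<open>p\<close> and comparing coefficients bounds \<open>N\<close> by \<open>M\<close> and \<open>M\<close> by \<open>N\<close> up to factors \<open>s\<^sup>-\<^sup>n\<close>, so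
  the matrix is invertible for large \<open>n\<close>. The influence of \<open>M\<close> on the lowest coefficients of \<open>y\<close> is a
  product of two such factors, which turns the available rate \<open>s < \<rho>\<close> into \<open>\<rho>\<close> itself once
  \<open>s\<^sup>2 > \<rho>\<close>. By Cramer's rule the bordered determinant is the Toeplitz determinant times a
  \<open>2 \<times> 2\<close> determinant of these lowest coefficients, and their limits are evaluated with Cauchy's formula.
  For the Toeplitz determinant itself, deform \<open>m\<close> to \<open>m\<^sup>t\<close>. At \<open>t = 0\<close> the matrix is triangular, and by
  Jacobi's formula the logarithmic derivative in \<open>t\<close> is a sum of solution coefficients of the same
  kind, which tends to \<open>\<Sum>k. k [log \<phi>]\<^sub>k [log \<phi>]\<^sub>-\<^sub>k\<close>.\<close>

section \<open>The Wiener algebra of the circle\<close>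

abbreviation "fc \<equiv> fourier_coeff"

abbreviation "cint t \<equiv> contour_integral (circlepath 0 t)"

lemma fourier_coeff_cong:
  assumes "\<And>z. norm z = 1 \<Longrightarrow> f z = g z"
  shows "fc f = fc g"
proof
  fix k
  show "fc f k = fc g k"
    unfolding fourier_coeff_def by (rule contour_integral_eq) (auto simp: assms)
qed

lemma fourier_coeff_powi: "fc (\<lambda>z. z powi k) j = (if j = k then 1 else 0)"
proof -
  have eq: "z powi k * z powi (- j) / (2 * of_real pi * \<i> * z) = z powi (k - j - 1) / (2 * of_real pi * \<i>)"
    if "norm z = 1" for z :: complex
  proof -
    have "z \<noteq> 0" using that by auto
    then show ?thesis by (simp add: power_int_diff power_int_minus power_int_add field_simps)
  qed
  have "fc (\<lambda>z. z powi k) j = cint 1 (\<lambda>z. z powi (k - j - 1) / (2 * of_real pi * \<i>))"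
    unfolding fourier_coeff_def by (rule contour_integral_eq) (auto simp: eq)
  also have "\<dots> = (if j = k then 1 else 0)"
  proof (cases "j = k")
    case True
    have "((\<lambda>u. (1 / (2 * of_real pi * \<i>)) / (u - 0)) has_contour_integral
       2 * of_real pi * \<i> * (1 / (2 * of_real pi * \<i>))) (circlepath 0 1)"
      by (rule Cauchy_integral_circlepath) auto
    then have "cint 1 (\<lambda>u. (1 / (2 * of_real pi * \<i>)) / (u - 0)) = 1"
      by (simp add: contour_integral_unique)
    then show ?thesis using True by (simp add: field_simps power_int_minus)
  next
    case False
    have "((\<lambda>z. z powi (k - j - 1) / (2 * of_real pi * \<i>)) has_contour_integral 0) (circlepath 0 1)"
    proof (rule Cauchy_theorem_primitive)
      fix z :: complex assume "z \<in> -{0}"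
      moreover have d: "of_int (k - j) \<noteq> (0::complex)" using False by (simp del: of_int_diff)
      ultimately have "((\<lambda>z. z powi (k - j) / (of_int (k - j) * (2 * of_real pi * \<i>))) has_field_derivative
             of_int (k - j) * z powi (k - j - 1) / (of_int (k - j) * (2 * of_real pi * \<i>))) (at z within -{0})"
        by (intro DERIV_cdivide) (auto intro!: derivative_eq_intros simp del: of_int_diff)
      then show "((\<lambda>z. z powi (k - j) / (of_int (k - j) * (2 * of_real pi * \<i>))) has_field_derivative
             z powi (k - j - 1) / (2 * of_real pi * \<i>)) (at z within -{0})"
        using d by (simp del: of_int_diff)
    qed auto
    then show ?thesis using False by (simp add: contour_integral_unique)
  qed
  finally show ?thesis .
qed

lemma has_sum_contour_integral_circlepath:
  assumes r: "0 < r"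
    and le: "\<And>k \<tau>. norm \<tau> = r \<Longrightarrow> norm (g k \<tau>) \<le> M k" and M: "M summable_on UNIV"
    and sum: "\<And>\<tau>. norm \<tau> = r \<Longrightarrow> ((\<lambda>k. g k \<tau>) has_sum G \<tau>) UNIV"
    and cont: "\<And>k. continuous_on (sphere 0 r) (g k)"
  shows "((\<lambda>k. cint r (g k)) has_sum cint r G) UNIV"
proof -
  have ul: "uniform_limit (sphere 0 r) (\<lambda>F \<tau>. \<Sum>k\<in>F. g k \<tau>) G (finite_subsets_at_top UNIV)"
    by (rule Weierstrass_m_test_general'[OF _ _ M]) (use le sum in auto)
  have int: "(\<lambda>\<tau>. \<Sum>k\<in>F. g k \<tau>) contour_integrable_on circlepath 0 r" for F
    using cont r by (intro contour_integrable_continuous_circlepath continuous_on_sum) auto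
  have "((\<lambda>F. cint r (\<lambda>\<tau>. \<Sum>k\<in>F. g k \<tau>))
     \<longlongrightarrow> cint r G) (finite_subsets_at_top UNIV)"
    by (rule contour_integral_uniform_limit_circlepath(2)[OF _ ul]) (auto simp: int r)
  moreover have "\<forall>\<^sub>F F in finite_subsets_at_top UNIV.
      cint r (\<lambda>\<tau>. \<Sum>k\<in>F. g k \<tau>) = (\<Sum>k\<in>F. cint r (g k))"
    by (rule eventually_finite_subsets_at_top_weakI)
      (use cont r in \<open>auto intro!: contour_integral_sum contour_integrable_continuous_circlepath\<close>)
  ultimately show ?thesis unfolding has_sum_def by (rule Lim_transform_eventually)
qed

definition wiener :: "(complex \<Rightarrow> complex) \<Rightarrow> bool" where
  "wiener f \<longleftrightarrow> (\<lambda>k. norm (fc f k)) summable_on UNIV \<and>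
     (\<forall>z\<in>unit_circle. ((\<lambda>k. fc f k * z powi k) has_sum f z) UNIV)"

lemma norm_powi_unit: "norm z = 1 \<Longrightarrow> norm (z powi k :: complex) = 1"
  by (simp add: norm_power_int)

lemma fourier_coeff_has_sum:
  assumes x: "(\<lambda>k. norm (x k)) summable_on UNIV"
    and f: "\<And>z. norm z = 1 \<Longrightarrow> ((\<lambda>k. x k * z powi k) has_sum f z) UNIV"
  shows "fc f = x"
proof
  fix j
  define c where "c = (\<lambda>z::complex. z powi (- j) / (2 * of_real pi * \<i> * z))"
  have cont: "continuous_on (sphere 0 1) (\<lambda>z. x k * z powi k * c z)" for k
    unfolding c_def by (auto intro!: continuous_intros)
  have single: "cint 1 (\<lambda>z. x k * z powi k * c z) = (if k = j then x j else 0)" for k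
  proof -
    have "cint 1 (\<lambda>z. x k * (z powi k * c z)) = x k * fc (\<lambda>z. z powi k) j"
      unfolding fourier_coeff_def c_def
      by (subst contour_integral_lmul)
        (auto intro!: contour_integrable_continuous_circlepath continuous_intros)
    then show ?thesis by (simp add: fourier_coeff_powi mult.assoc)
  qed
  have "((\<lambda>k. cint 1 (\<lambda>z. x k * z powi k * c z)) has_sum
      cint 1 (\<lambda>z. f z * c z)) UNIV"
  proof (rule has_sum_contour_integral_circlepath[where M = "\<lambda>k. norm (x k)"])
    show "norm (x k * z powi k * c z) \<le> norm (x k)" if "norm z = 1" for k z
    proof -
      have "1 \<le> 2 * pi" using pi_ge_two by linarith
      then show ?thesis using that
        by (auto simp: c_def norm_mult norm_divide norm_power_int divide_simps mult_le_cancel_left1)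
    qed
    show "((\<lambda>k. x k * z powi k * c z) has_sum f z * c z) UNIV" if "norm z = 1" for z
      using f[OF that] by (rule has_sum_cmult_left)
  qed (use x cont in simp_all)
  then have "((\<lambda>k. if k = j then x j else 0) has_sum cint 1 (\<lambda>z. f z * c z)) UNIV"
    by (simp only: single)
  moreover have "((\<lambda>k. if k = j then x j else 0) has_sum x j) UNIV"
    by (rule has_sum_finite_neutralI[of "{j}"]) auto
  ultimately have "cint 1 (\<lambda>z. f z * c z) = x j" by (rule has_sum_unique)
  then show "fc f j = x j" by (simp add: fourier_coeff_def c_def)
qed

lemma wienerI:
  assumes "(\<lambda>k. norm (x k)) summable_on UNIV"
    and "\<And>z. norm z = 1 \<Longrightarrow> ((\<lambda>k. x k * z powi k) has_sum f z) UNIV"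
  shows "wiener f" "fc f = x"
  using fourier_coeff_has_sum[OF assms] assms by (auto simp: wiener_def)

lemma wiener_summable: "wiener f \<Longrightarrow> (\<lambda>k. norm (fc f k)) summable_on A"
  unfolding wiener_def by (auto intro: summable_on_subset_banach)

lemma wiener_has_sum: "wiener f \<Longrightarrow> norm z = 1 \<Longrightarrow> ((\<lambda>k. fc f k * z powi k) has_sum f z) UNIV"
  unfolding wiener_def by auto

lemma wiener_eqI:
  assumes "wiener f" "wiener g" "\<And>k. fc f k = fc g k" "norm z = 1"
  shows "f z = g z"
  using wiener_has_sum[OF assms(1,4)] wiener_has_sum[OF assms(2,4)] assms(3)
  by (auto intro: has_sum_unique)

lemma wiener_powi: "wiener (\<lambda>z. z powi k)"
proof (rule wienerI(1)[where x = "\<lambda>j. if j = k then 1 else 0"])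
  show "(\<lambda>j. norm (if j = k then 1 else 0 :: complex)) summable_on UNIV"
    by (rule finite_nonzero_values_imp_summable_on) (auto intro: finite_subset[of _ "{k}"])
  show "((\<lambda>j. (if j = k then 1 else 0) * z powi j) has_sum z powi k) UNIV" for z :: complex
    by (rule has_sum_finite_neutralI[of "{k}"]) auto
qed

lemma
  assumes "wiener f" "wiener g"
  shows wiener_add: "wiener (\<lambda>z. f z + g z)"
    and fc_add: "fc (\<lambda>z. f z + g z) k = fc f k + fc g k"
proof -
  have 1: "(\<lambda>k. norm (fc f k + fc g k)) summable_on UNIV"
    by (rule Infinite_Sum.abs_summable_on_comparison_test'[OF summable_on_add[OF wiener_summable[OF assms(1)] wiener_summable[OF assms(2)]]])
      (rule norm_triangle_ineq)
  have 2: "((\<lambda>k. (fc f k + fc g k) * z powi k) has_sum (f z + g z)) UNIV" if "norm z = 1" for z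
    using has_sum_add[OF wiener_has_sum[OF assms(1) that] wiener_has_sum[OF assms(2) that]]
    by (simp add: algebra_simps)
  show "wiener (\<lambda>z. f z + g z)" "fc (\<lambda>z. f z + g z) k = fc f k + fc g k"
    using wienerI[OF 1 2] by simp_all
qed

lemma
  assumes "wiener f"
  shows wiener_cmult: "wiener (\<lambda>z. c * f z)"
    and fc_cmult: "fc (\<lambda>z. c * f z) k = c * fc f k"
proof -
  have 1: "(\<lambda>k. norm (c * fc f k)) summable_on UNIV"
    unfolding norm_mult by (intro summable_on_cmult_right wiener_summable assms)
  have 2: "((\<lambda>k. c * fc f k * z powi k) has_sum c * f z) UNIV" if "norm z = 1" for z
    using has_sum_cmult_right[OF wiener_has_sum[OF assms(1) that], of c]
    by (simp add: algebra_simps)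
  show "wiener (\<lambda>z. c * f z)" "fc (\<lambda>z. c * f z) k = c * fc f k"
    using wienerI[OF 1 2] by simp_all
qed

lemma
  assumes "wiener f" "wiener g"
  shows wiener_diff: "wiener (\<lambda>z. f z - g z)"
    and fc_diff: "fc (\<lambda>z. f z - g z) k = fc f k - fc g k"
  using wiener_add[OF assms(1) wiener_cmult[OF assms(2), of "-1"]]
    fc_add[OF assms(1) wiener_cmult[OF assms(2), of "-1"], of k] fc_cmult[OF assms(2), of "-1" k]
  by simp_all

lemma
  shows wiener_0 [simp]: "wiener (\<lambda>z. 0)" and fc_0 [simp]: "fc (\<lambda>z. 0) k = 0"
  using wiener_cmult[OF wiener_powi, of 0 0] fc_cmult[OF wiener_powi, of 0 0 k] by simp_all

lemma
  assumes "finite A" "\<And>i. i \<in> A \<Longrightarrow> wiener (f i)"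
  shows wiener_sum: "wiener (\<lambda>z. \<Sum>i\<in>A. f i z)"
    and fc_sum: "fc (\<lambda>z. \<Sum>i\<in>A. f i z) k = (\<Sum>i\<in>A. fc (f i) k)"
proof -
  have "wiener (\<lambda>z. \<Sum>i\<in>A. f i z) \<and> fc (\<lambda>z. \<Sum>i\<in>A. f i z) k = (\<Sum>i\<in>A. fc (f i) k)"
    using assms by (induction A) (auto simp: wiener_add fc_add)
  then show "wiener (\<lambda>z. \<Sum>i\<in>A. f i z)" "fc (\<lambda>z. \<Sum>i\<in>A. f i z) k = (\<Sum>i\<in>A. fc (f i) k)"
    by auto
qed

definition wnorm :: "(complex \<Rightarrow> complex) \<Rightarrow> real" where
  "wnorm f = (\<Sum>\<^sub>\<infinity>k. norm (fc f k))"

lemma wnorm_nonneg: "0 \<le> wnorm f"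
  unfolding wnorm_def by (rule infsum_nonneg) auto

lemma norm_fc_le_wnorm: "wiener f \<Longrightarrow> norm (fc f k) \<le> wnorm f"
  unfolding wnorm_def using finite_sum_le_infsum[OF wiener_summable, of f "{k}"] by simp

lemma wnorm_triangle:
  assumes "wiener f" "wiener g"
  shows "wnorm (\<lambda>z. f z + g z) \<le> wnorm f + wnorm g"
proof -
  have "wnorm (\<lambda>z. f z + g z) \<le> (\<Sum>\<^sub>\<infinity>k. norm (fc f k) + norm (fc g k))"
    unfolding wnorm_def
    using assms by (intro infsum_mono wiener_summable wiener_add summable_on_add)
      (auto simp: fc_add norm_triangle_ineq)
  also have "\<dots> = wnorm f + wnorm g"
    unfolding wnorm_def using assms by (intro infsum_add wiener_summable)
  finally show ?thesis .
qed

lemma wnorm_powi: "wnorm (\<lambda>z. z powi k) = 1"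
proof -
  have "((\<lambda>j. norm (if j = k then 1 else 0 :: complex)) has_sum 1) UNIV"
    by (rule has_sum_finite_neutralI[of "{k}"]) auto
  then show ?thesis by (simp add: wnorm_def fourier_coeff_powi infsumI)
qed

lemma wnorm_le:
  assumes "wiener f" "\<And>k. norm (fc f k) \<le> b k" "(b has_sum B) UNIV"
  shows "wnorm f \<le> B"
  unfolding wnorm_def
  by (rule has_sum_mono[OF has_sum_infsum[OF wiener_summable[OF assms(1)]] assms(3) assms(2)])

lemma
  assumes f: "wiener f" and g: "wiener g"
  shows wiener_mult: "wiener (\<lambda>z. f z * g z)"
    and fc_mult: "((\<lambda>j. fc f j * fc g (k - j)) has_sum fc (\<lambda>z. f z * g z) k) UNIV"
    and wnorm_mult: "wnorm (\<lambda>z. f z * g z) \<le> wnorm f * wnorm g"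
proof -
  define x where "x = fc f"
  define y where "y = fc g"
  have sx: "(\<lambda>k. norm (x k)) summable_on UNIV" and sy: "(\<lambda>k. norm (y k)) summable_on UNIV"
    unfolding x_def y_def using f g by (auto intro: wiener_summable)
  have hx: "((\<lambda>k. norm (x k)) has_sum wnorm f) UNIV" and hy: "((\<lambda>k. norm (y k)) has_sum wnorm g) UNIV"
    unfolding x_def y_def wnorm_def using f g by (auto intro!: has_sum_infsum wiener_summable)
  have hys: "((\<lambda>k. norm (y (k - j))) has_sum wnorm g) UNIV" for j
    using hy by (subst has_sum_reindex_bij_witness[where i = "\<lambda>k. k + j" and j = "\<lambda>k. k - j"]) auto
  have P0: "((\<lambda>(j, k). norm (x j) * norm (y (k - j))) has_sum wnorm f * wnorm g) (UNIV \<times> UNIV)"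
  proof (rule has_sum_SigmaI)
    show "((\<lambda>k. case (j, k) of (j, k) \<Rightarrow> norm (x j) * norm (y (k - j))) has_sum norm (x j) * wnorm g) UNIV" for j
      using has_sum_cmult_right[OF hys] by simp
    show "((\<lambda>j. norm (x j) * wnorm g) has_sum wnorm f * wnorm g) UNIV"
      by (rule has_sum_cmult_left[OF hx])
    show "(\<lambda>(j, k). norm (x j) * norm (y (k - j))) summable_on (UNIV \<times> UNIV)"
    proof (rule summable_on_SigmaI)
      show "((\<lambda>k. case (j, k) of (j, k) \<Rightarrow> norm (x j) * norm (y (k - j))) has_sum norm (x j) * wnorm g) UNIV" for j
        using has_sum_cmult_right[OF hys] by simp
      show "(\<lambda>j. norm (x j) * wnorm g) summable_on UNIV"
        using has_sum_cmult_left[OF hx] by (rule has_sum_imp_summable)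
    qed auto
  qed
  then have P: "((\<lambda>(k, j). norm (x j) * norm (y (k - j))) has_sum wnorm f * wnorm g) (UNIV \<times> UNIV)"
    by (subst has_sum_swap) (simp add: case_prod_unfold)
  have Ps: "(\<lambda>(k, j). norm (x j) * norm (y (k - j))) summable_on (UNIV \<times> UNIV)"
    using P by (rule has_sum_imp_summable)
  have Pk: "(\<lambda>j. norm (x j) * norm (y (k - j))) summable_on UNIV" for k
    using summable_on_SigmaD1[OF Ps, of k] by simp
  define c where "c = (\<lambda>k. \<Sum>\<^sub>\<infinity>j. x j * y (k - j))"
  have ck: "((\<lambda>j. x j * y (k - j)) has_sum c k) UNIV" for k
    unfolding c_def
    by (rule has_sum_infsum, rule abs_summable_summable) (use Pk in \<open>simp add: norm_mult\<close>)
  define d where "d = (\<lambda>k. \<Sum>\<^sub>\<infinity>j. norm (x j) * norm (y (k - j)))"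
  have dk: "((\<lambda>j. norm (x j) * norm (y (k - j))) has_sum d k) UNIV" for k
    unfolding d_def using Pk by (rule has_sum_infsum)
  have d: "(d has_sum wnorm f * wnorm g) UNIV"
    by (rule has_sum_SigmaD[OF P]) (use dk in simp)
  have cd: "norm (c k) \<le> d k" for k
    by (rule norm_infsum_le[OF ck dk]) (simp add: norm_mult)
  have cs: "(\<lambda>k. norm (c k)) summable_on UNIV"
    using has_sum_imp_summable[OF d] cd by (rule Infinite_Sum.abs_summable_on_comparison_test')
  have csum: "((\<lambda>k. c k * z powi k) has_sum (f z * g z)) UNIV" if z: "norm z = 1" for z
  proof -
    have z0: "z \<noteq> 0" using z by auto
    have fz: "((\<lambda>j. x j * z powi j) has_sum f z) UNIV" and gz: "((\<lambda>j. y j * z powi j) has_sum g z) UNIV"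
      unfolding x_def y_def using wiener_has_sum f g z by auto
    have gzs: "((\<lambda>k. y (k - j) * z powi (k - j)) has_sum g z) UNIV" for j
      using gz by (subst has_sum_reindex_bij_witness[where i = "\<lambda>k. k + j" and j = "\<lambda>k. k - j"]) auto
    have Q0: "((\<lambda>(j, k). (x j * z powi j) * (y (k - j) * z powi (k - j))) has_sum (f z * g z)) (UNIV \<times> UNIV)"
    proof (rule has_sum_SigmaI)
      show "((\<lambda>k. case (j, k) of (j, k) \<Rightarrow> (x j * z powi j) * (y (k - j) * z powi (k - j))) has_sum (x j * z powi j) * g z) UNIV" for j
        using has_sum_cmult_right[OF gzs] by simp
      show "((\<lambda>j. x j * z powi j * g z) has_sum f z * g z) UNIV"
        by (rule has_sum_cmult_left[OF fz])
      have eq: "(\<lambda>p. norm (case p of (j, k) \<Rightarrow> (x j * z powi j) * (y (k - j) * z powi (k - j))))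
         = (\<lambda>(j, k). norm (x j) * norm (y (k - j)))"
        using z by (auto simp: fun_eq_iff norm_mult norm_powi_unit)
      show "(\<lambda>(j, k). (x j * z powi j) * (y (k - j) * z powi (k - j))) summable_on (UNIV \<times> UNIV)"
        by (rule abs_summable_summable) (use eq has_sum_imp_summable[OF P0] in simp)
    qed
    then have Q: "((\<lambda>(k, j). (x j * z powi j) * (y (k - j) * z powi (k - j))) has_sum (f z * g z)) (UNIV \<times> UNIV)"
      by (subst has_sum_swap) (simp add: case_prod_unfold)
    show ?thesis
    proof (rule has_sum_SigmaD[OF Q])
      fix k
      have "((\<lambda>j. x j * y (k - j) * z powi k) has_sum c k * z powi k) UNIV"
        by (rule has_sum_cmult_left[OF ck])
      moreover have "x j * y (k - j) * z powi k = (x j * z powi j) * (y (k - j) * z powi (k - j))" for j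
        using z0 by (simp add: power_int_diff field_simps)
      ultimately show "((\<lambda>j. case (k, j) of (k, j) \<Rightarrow> (x j * z powi j) * (y (k - j) * z powi (k - j))) has_sum c k * z powi k) UNIV"
        by simp
    qed
  qed
  show "wiener (\<lambda>z. f z * g z)" and fcm: "((\<lambda>j. fc f j * fc g (k - j)) has_sum fc (\<lambda>z. f z * g z) k) UNIV"
    using wienerI[OF cs csum] ck[of k] by (simp_all add: x_def y_def)
  show "wnorm (\<lambda>z. f z * g z) \<le> wnorm f * wnorm g"
    using wienerI[OF cs csum] cd d by (auto intro: wnorm_le)
qed

definition proj :: "int set \<Rightarrow> (complex \<Rightarrow> complex) \<Rightarrow> complex \<Rightarrow> complex" where
  "proj A f z = (\<Sum>\<^sub>\<infinity>k\<in>A. fc f k * z powi k)"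

lemma
  assumes f: "wiener f"
  shows wiener_proj: "wiener (proj A f)"
    and fc_proj: "fc (proj A f) k = (if k \<in> A then fc f k else 0)"
proof -
  define x where "x = (\<lambda>k. if k \<in> A then fc f k else 0)"
  have 1: "(\<lambda>k. norm (x k)) summable_on UNIV"
    by (rule Infinite_Sum.abs_summable_on_comparison_test'[OF wiener_summable[OF f]]) (auto simp: x_def)
  have 2: "((\<lambda>k. x k * z powi k) has_sum proj A f z) UNIV" if "norm z = 1" for z
  proof -
    have "((\<lambda>k. fc f k * z powi k) has_sum proj A f z) A"
      unfolding proj_def
      by (rule has_sum_infsum, rule summable_on_subset_banach[where A = UNIV])
        (auto intro: has_sum_imp_summable[OF wiener_has_sum[OF f that]])
    also have "?this \<longleftrightarrow> ?thesis"
      by (rule has_sum_cong_neutral) (auto simp: x_def)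
    finally show ?thesis .
  qed
  show "wiener (proj A f)" "fc (proj A f) k = (if k \<in> A then fc f k else 0)"
    using wienerI[OF 1 2] by (simp_all add: x_def)
qed

lemma wnorm_proj_le: "wiener f \<Longrightarrow> wnorm (proj A f) \<le> wnorm f"
  unfolding wnorm_def by (intro infsum_mono wiener_summable wiener_proj) (auto simp: fc_proj)

definition wsupp :: "(complex \<Rightarrow> complex) \<Rightarrow> int set \<Rightarrow> bool" where
  "wsupp f A \<longleftrightarrow> wiener f \<and> (\<forall>k. k \<notin> A \<longrightarrow> fc f k = 0)"

lemma wsuppD: "wsupp f A \<Longrightarrow> wiener f" "wsupp f A \<Longrightarrow> k \<notin> A \<Longrightarrow> fc f k = 0"
  by (auto simp: wsupp_def)

lemma wsupp_mono: "wsupp f A \<Longrightarrow> A \<subseteq> B \<Longrightarrow> wsupp f B"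
  by (auto simp: wsupp_def)

lemma wsupp_proj: "wiener f \<Longrightarrow> wsupp (proj A f) A"
  by (auto simp: wsupp_def wiener_proj fc_proj)

lemma wsupp_mult:
  assumes f: "wsupp f A" and g: "wsupp g B" and C: "\<And>i j. i \<in> A \<Longrightarrow> j \<in> B \<Longrightarrow> i + j \<in> C"
  shows "wsupp (\<lambda>z. f z * g z) C"
proof -
  have "fc (\<lambda>z. f z * g z) k = 0" if "k \<notin> C" for k
  proof -
    have "(\<lambda>j. fc f j * fc g (k - j)) = (\<lambda>j::int. 0)"
      using wsuppD(2)[OF f] wsuppD(2)[OF g] C[of _ "k - _"] that by (force simp: fun_eq_iff)
    then have "((\<lambda>j::int. 0) has_sum fc (\<lambda>z. f z * g z) k) UNIV"
      using fc_mult[OF wsuppD(1)[OF f] wsuppD(1)[OF g], of k] by simp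
    then show ?thesis using has_sum_0_simp has_sum_unique by blast
  qed
  then show ?thesis using f g by (auto simp: wsupp_def wiener_mult)
qed

lemma wnorm_proj_mult_le:
  assumes f: "wiener f" and g: "wsupp g B" and A: "\<And>i j. i \<notin> A' \<Longrightarrow> j \<in> B \<Longrightarrow> i + j \<notin> A"
  shows "wnorm (proj A (\<lambda>z. f z * g z)) \<le> wnorm (proj A' f) * wnorm g"
proof -
  note g' = wsuppD(1)[OF g]
  have 1: "fc (\<lambda>z. f z * g z) k = fc (\<lambda>z. proj A' f z * g z) k" if "k \<in> A" for k
  proof -
    have "(\<lambda>j. fc f j * fc g (k - j)) = (\<lambda>j. fc (proj A' f) j * fc g (k - j))"
    proof
      fix j show "fc f j * fc g (k - j) = fc (proj A' f) j * fc g (k - j)"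
        using A[of j "k - j"] that wsuppD(2)[OF g, of "k - j"] by (auto simp: fc_proj f)
    qed
    then show ?thesis
      using fc_mult[OF f g', of k] fc_mult[OF wiener_proj[OF f, of A'] g', of k] has_sum_unique by simp
  qed
  have "wnorm (proj A (\<lambda>z. f z * g z)) = wnorm (proj A (\<lambda>z. proj A' f z * g z))"
    unfolding wnorm_def by (intro infsum_cong) (auto simp: fc_proj f g' wiener_mult wiener_proj 1)
  also have "\<dots> \<le> wnorm (\<lambda>z. proj A' f z * g z)"
    by (intro wnorm_proj_le wiener_mult wiener_proj f g')
  also have "\<dots> \<le> wnorm (proj A' f) * wnorm g"
    by (intro wnorm_mult wiener_proj f g')
  finally show ?thesis .
qed

lemma wsupp_diff: "wsupp f A \<Longrightarrow> wsupp g A \<Longrightarrow> wsupp (\<lambda>z. f z - g z) A"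
  by (auto simp: wsupp_def wiener_diff fc_diff)

lemma wnorm_cong: "(\<And>z. norm z = 1 \<Longrightarrow> f z = g z) \<Longrightarrow> wnorm f = wnorm g"
  using fourier_coeff_cong[of f g] by (simp add: wnorm_def)

lemma wnorm_part_le:
  assumes eq: "\<And>z. norm z = 1 \<Longrightarrow> u z = f z + v z + w z"
    and w: "wiener f" "wsupp v A" "wiener w" and u: "\<And>k. k \<in> A \<Longrightarrow> fc u k = 0"
  shows "wnorm v \<le> wnorm (proj A f) + wnorm (proj A w)"
proof -
  note v = wsuppD[OF w(2)]
  have u_eq: "fc u k = fc f k + fc v k + fc w k" for k
    using fourier_coeff_cong[OF eq] w v by (simp add: fc_add wiener_add)
  have "wnorm v \<le> wnorm (\<lambda>z. proj A f z + proj A w z)"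
  proof -
    have "norm (fc v k) \<le> norm (fc (\<lambda>z. proj A f z + proj A w z) k)" for k
    proof (cases "k \<in> A")
      case True
      then have "fc f k + fc v k + fc w k = 0" using u_eq[of k] u[of k] by simp
      moreover have "fc v k = (fc f k + fc v k + fc w k) - (fc f k + fc w k)" by simp
      ultimately have "fc v k = - (fc f k + fc w k)" by simp
      then show ?thesis using True w by (simp add: fc_add wiener_proj fc_proj del: minus_add_distrib)
    next
      case False then show ?thesis using v by simp
    qed
    then show ?thesis unfolding wnorm_def
      using w v by (intro infsum_mono wiener_summable wiener_add wiener_proj)
  qed
  also have "\<dots> \<le> wnorm (proj A f) + wnorm (proj A w)"
    using w by (intro wnorm_triangle wiener_proj)
  finally show ?thesis .
qed

section \<open>Toeplitz systems\<close>

text \<open>Here \<open>p\<close> and \<open>m\<close> are the Wiener--Hopf factors of the symbol and \<open>q\<close> and \<open>l\<close> their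
  inverses.\<close>

definition wh_factors ::
  "(complex \<Rightarrow> complex) \<Rightarrow> (complex \<Rightarrow> complex) \<Rightarrow> (complex \<Rightarrow> complex) \<Rightarrow> (complex \<Rightarrow> complex) \<Rightarrow> real \<Rightarrow> bool"
  where "wh_factors p q m l K \<longleftrightarrow>
     wsupp p {0..} \<and> wsupp q {0..} \<and> wsupp m {..0} \<and> wsupp l {..0} \<and>
     (\<forall>z\<in>unit_circle. p z * q z = 1 \<and> m z * l z = 1) \<and>
     wnorm p \<le> K \<and> wnorm q \<le> K \<and> wnorm m \<le> K \<and> wnorm l \<le> K"

lemma finite_section:
  fixes n :: int
  assumes wh: "wh_factors p q m l K"
    and q_tail: "wnorm (proj {n..} q) \<le> e" and l_tail: "wnorm (proj {..-n} l) \<le> e"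
    and e: "0 \<le> e" "K^2 * e^2 \<le> 1 / 2"
    and y: "wsupp y {0..<n}" and N: "wsupp N {..<0}" and M: "wsupp M {n..}" and \<psi>: "wiener \<psi>"
    and eq: "\<And>z. norm z = 1 \<Longrightarrow> p z * m z * y z = \<psi> z + N z + M z"
  shows "wnorm M \<le> 2 * K * (wnorm (proj {n..} (\<lambda>z. q z * \<psi> z)) + e * K * wnorm (proj {..<0} (\<lambda>z. l z * \<psi> z)))"
    and "k \<ge> 0 \<Longrightarrow> fc (\<lambda>z. p z * y z) k = fc (\<lambda>z. l z * \<psi> z) k + fc (\<lambda>z. l z * M z) k"
proof -
  from wh have p: "wsupp p {0..}" "wnorm p \<le> K" and q: "wsupp q {0..}" "wnorm q \<le> K"
    and m: "wsupp m {..0}" "wnorm m \<le> K" and l: "wsupp l {..0}" "wnorm l \<le> K"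
    and pq: "\<And>z. norm z = 1 \<Longrightarrow> p z * q z = 1" and ml: "\<And>z. norm z = 1 \<Longrightarrow> m z * l z = 1"
    by (auto simp: wh_factors_def)
  note w = wsuppD(1)[OF p(1)] wsuppD(1)[OF q(1)] wsuppD(1)[OF m(1)] wsuppD(1)[OF l(1)]
     wsuppD(1)[OF y] wsuppD(1)[OF N] wsuppD(1)[OF M] \<psi>
  have K: "0 \<le> K" using p(2) wnorm_nonneg[of p] by linarith
  have eq1: "p z * y z = l z * \<psi> z + l z * N z + l z * M z" if z: "norm z = 1" for z
  proof -
    have "p z * y z = (m z * l z) * (p z * y z)" using ml z by simp
    also have "\<dots> = l z * (p z * m z * y z)" by (simp only: mult_ac)
    also have "\<dots> = l z * \<psi> z + l z * N z + l z * M z" by (simp only: eq[OF z] distrib_left)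
    finally show ?thesis .
  qed
  have eq2: "m z * y z = q z * \<psi> z + q z * M z + q z * N z" if z: "norm z = 1" for z
  proof -
    have "m z * y z = (p z * q z) * (m z * y z)" using pq z by simp
    also have "\<dots> = q z * (p z * m z * y z)" by (simp only: mult_ac)
    also have "\<dots> = q z * \<psi> z + q z * M z + q z * N z" by (simp only: eq[OF z] distrib_left add_ac)
    finally show ?thesis .
  qed
  have py: "wsupp (\<lambda>z. p z * y z) {0..}" by (rule wsupp_mult[OF p(1) y]) auto
  have my: "wsupp (\<lambda>z. m z * y z) {..<n}" by (rule wsupp_mult[OF m(1) y]) auto
  have lN: "wsupp (\<lambda>z. l z * N z) {..<0}" by (rule wsupp_mult[OF l(1) N]) auto
  have qM: "wsupp (\<lambda>z. q z * M z) {n..}" by (rule wsupp_mult[OF q(1) M]) auto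
  have "wnorm N = wnorm (\<lambda>z. m z * (l z * N z))"
    by (rule wnorm_cong) (simp add: ml mult.assoc[symmetric])
  also have "\<dots> \<le> wnorm m * wnorm (\<lambda>z. l z * N z)"
    using w by (intro wnorm_mult wiener_mult)
  also have "\<dots> \<le> K * wnorm (\<lambda>z. l z * N z)" using m by (intro mult_right_mono wnorm_nonneg)
  finally have N1: "wnorm N \<le> K * wnorm (\<lambda>z. l z * N z)" .
  have "wnorm M = wnorm (\<lambda>z. p z * (q z * M z))"
    by (rule wnorm_cong) (simp add: pq mult.assoc[symmetric])
  also have "\<dots> \<le> wnorm p * wnorm (\<lambda>z. q z * M z)"
    using w by (intro wnorm_mult wiener_mult)
  also have "\<dots> \<le> K * wnorm (\<lambda>z. q z * M z)" using p by (intro mult_right_mono wnorm_nonneg)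
  finally have M1: "wnorm M \<le> K * wnorm (\<lambda>z. q z * M z)" .
  define a where "a = wnorm (proj {..<0} (\<lambda>z. l z * \<psi> z))"
  define b where "b = wnorm (proj {n..} (\<lambda>z. q z * \<psi> z))"
  have "wnorm (\<lambda>z. l z * N z) \<le> a + wnorm (proj {..<0} (\<lambda>z. l z * M z))"
    unfolding a_def by (rule wnorm_part_le[OF eq1 _ lN]) (use w wsuppD(2)[OF py] in \<open>auto intro: wiener_mult\<close>)
  also have "wnorm (proj {..<0} (\<lambda>z. l z * M z)) \<le> wnorm (proj {..-n} l) * wnorm M"
    by (rule wnorm_proj_mult_le[OF _ M]) (use w in auto)
  also have "\<dots> \<le> e * wnorm M" using l_tail by (intro mult_right_mono wnorm_nonneg)
  finally have lN_le: "wnorm (\<lambda>z. l z * N z) \<le> a + e * wnorm M" by simp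
  have "wnorm (\<lambda>z. q z * M z) \<le> b + wnorm (proj {n..} (\<lambda>z. q z * N z))"
    unfolding b_def by (rule wnorm_part_le[OF eq2 _ qM]) (use w wsuppD(2)[OF my] in \<open>auto intro: wiener_mult\<close>)
  also have "wnorm (proj {n..} (\<lambda>z. q z * N z)) \<le> wnorm (proj {n..} q) * wnorm N"
    by (rule wnorm_proj_mult_le[OF _ N]) (use w in auto)
  also have "\<dots> \<le> e * wnorm N" using q_tail by (intro mult_right_mono wnorm_nonneg)
  finally have qM_le: "wnorm (\<lambda>z. q z * M z) \<le> b + e * wnorm N" by simp
  have "wnorm M \<le> K * (b + e * (K * (a + e * wnorm M)))"
    using M1 qM_le N1 lN_le K e
    by (meson add_left_mono mult_left_mono order_trans)
  also have "\<dots> = K * (b + e * K * a) + (K^2 * e^2) * wnorm M"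
    by (simp add: algebra_simps power2_eq_square)
  also have "\<dots> \<le> K * (b + e * K * a) + 1 / 2 * wnorm M"
    using e by (intro add_left_mono mult_right_mono wnorm_nonneg)
  finally show "wnorm M \<le> 2 * K * (b + e * K * a)" by simp
  show "fc (\<lambda>z. p z * y z) k = fc (\<lambda>z. l z * \<psi> z) k + fc (\<lambda>z. l z * M z) k" if "k \<ge> 0"
    using fourier_coeff_cong[OF eq1] wsuppD(2)[OF lN, of k] that w by (simp add: fc_add wiener_add wiener_mult)
qed

definition toep :: "(complex \<Rightarrow> complex) \<Rightarrow> nat \<Rightarrow> complex mat" where
  "toep f n = Matrix.mat n n (\<lambda>(j, k). fc f (int k - int j))"

text \<open>The columns are numbered against the powers of \<open>z\<close>: column \<open>k\<close> of the matrix belongs to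
  \<open>z\<^sup>n\<^sup>-\<^sup>1\<^sup>-\<^sup>k\<close>.\<close>

definition vpoly :: "nat \<Rightarrow> complex Matrix.vec \<Rightarrow> complex \<Rightarrow> complex" where
  "vpoly n x z = (\<Sum>k<n. vec_index x (n - 1 - k) * z powi int k)"

definition bvec :: "(complex \<Rightarrow> complex) \<Rightarrow> nat \<Rightarrow> complex Matrix.vec" where
  "bvec f n = Matrix.vec n (\<lambda>j. fc f (int n - 1 - int j))"

lemma toep_carrier [simp]: "toep f n \<in> carrier_mat n n" and bvec_carrier [simp]: "bvec f n \<in> carrier_vec n"
  by (auto simp: toep_def bvec_def)

lemma wiener_vpoly: "wiener (vpoly n x)"
  and fc_vpoly: "fc (vpoly n x) i = (\<Sum>k<n. if i = int k then vec_index x (n - 1 - k) else 0)"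
proof -
  have *: "vpoly n x = (\<lambda>z. \<Sum>k<n. vec_index x (n - 1 - k) * z powi int k)"
    by (simp add: vpoly_def fun_eq_iff)
  show "wiener (vpoly n x)" "fc (vpoly n x) i = (\<Sum>k<n. if i = int k then vec_index x (n - 1 - k) else 0)"
    unfolding *
    by (auto intro!: wiener_sum wiener_cmult wiener_powi sum.cong
        simp: fc_sum fc_cmult wiener_cmult wiener_powi fourier_coeff_powi simp del: power_int_of_nat)
qed

lemma fc_vpoly_index: "k < n \<Longrightarrow> fc (vpoly n x) (int k) = vec_index x (n - 1 - k)"
  by (simp add: fc_vpoly)

lemma wsupp_vpoly: "wsupp (vpoly n x) {0..<int n}"
  by (auto simp: wsupp_def wiener_vpoly fc_vpoly intro!: sum.neutral)

lemma fc_powi_mult: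
  assumes "wiener f"
  shows "fc (\<lambda>z. f z * z powi k) i = fc f (i - k)"
proof -
  have eq: "(\<lambda>j. fc (\<lambda>z. z powi k) j * fc f (i - j)) = (\<lambda>j. if j = k then fc f (i - k) else 0)"
    by (auto simp: fourier_coeff_powi fun_eq_iff)
  have "((\<lambda>j. if j = k then fc f (i - k) else 0) has_sum fc (\<lambda>z. z powi k * f z) i) UNIV"
    using fc_mult[OF wiener_powi assms, of k i] by (simp only: eq)
  moreover have "((\<lambda>j. if j = k then fc f (i - k) else 0) has_sum fc f (i - k)) UNIV"
    by (rule has_sum_finite_neutralI[of "{k}"]) auto
  ultimately show ?thesis by (simp add: mult.commute has_sum_unique)
qed

lemma fc_mult_vpoly:
  assumes f: "wiener f" and x: "x \<in> carrier_vec n" and j: "j < n"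
  shows "fc (\<lambda>z. f z * vpoly n x z) (int n - 1 - int j) = vec_index (toep f n *\<^sub>v x) j"
proof -
  have "fc (\<lambda>z. f z * vpoly n x z) (int n - 1 - int j)
     = fc (\<lambda>z. \<Sum>k<n. vec_index x (n - 1 - k) * (f z * z powi int k)) (int n - 1 - int j)"
    by (intro fun_cong[OF fourier_coeff_cong]) (simp add: vpoly_def sum_distrib_left mult_ac)
  also have "\<dots> = (\<Sum>k<n. vec_index x (n - 1 - k) * fc f (int n - 1 - int j - int k))"
    by (subst fc_sum) (auto intro!: wiener_cmult wiener_mult f wiener_powi
        simp: fc_cmult fc_powi_mult f wiener_mult wiener_powi simp del: power_int_of_nat)
  also have "\<dots> = (\<Sum>k<n. vec_index x k * fc f (int k - int j))"
    by (rule sum.reindex_bij_witness[where i = "\<lambda>k. n - 1 - k" and j = "\<lambda>k. n - 1 - k"]) 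
      (auto simp: of_nat_diff algebra_simps)
  also have "\<dots> = vec_index (toep f n *\<^sub>v x) j"
    using j x by (simp add: toep_def scalar_prod_def mult.commute atLeast0LessThan)
  finally show ?thesis .
qed

lemma toep_solution:
  assumes f: "wiener f" and g: "wiener g" and x: "x \<in> carrier_vec n"
    and eq: "toep f n *\<^sub>v x = bvec g n"
  obtains N M where "wsupp N {..<0}" "wsupp M {int n..}"
    "\<And>z. norm z = 1 \<Longrightarrow> f z * vpoly n x z = g z + N z + M z"
proof
  define d where "d = (\<lambda>z. f z * vpoly n x z - g z)"
  have d: "wiener d" unfolding d_def by (intro wiener_diff wiener_mult f g wiener_vpoly)
  show "wsupp (proj {..<0} d) {..<0}" "wsupp (proj {int n..} d) {int n..}"
    using d by (auto intro: wsupp_proj)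
  have d0: "fc d k = 0" if "0 \<le> k" "k < int n" for k
  proof -
    define j where "j = nat (int n - 1 - k)"
    have j: "j < n" "k = int n - 1 - int j" using that by (auto simp: j_def)
    have "fc d k = vec_index (toep f n *\<^sub>v x) j - fc g k"
      unfolding d_def using fc_mult_vpoly[OF f x j(1)] j f g
      by (simp add: fc_diff wiener_mult wiener_vpoly)
    then show ?thesis unfolding eq using j by (simp add: bvec_def)
  qed
  fix z :: complex assume z: "norm z = 1"
  have "d z = proj {..<0} d z + proj {int n..} d z"
    by (rule wiener_eqI[OF d _ _ z]) (use d d0 in \<open>auto simp: fc_add wiener_proj fc_proj intro!: wiener_add\<close>)
  then show "f z * vpoly n x z = g z + proj {..<0} d z + proj {int n..} d z"
    by (simp add: d_def algebra_simps)
qed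

lemma toep_det_nonzero:
  assumes wh: "wh_factors p q m l K"
    and q_tail: "wnorm (proj {int n..} q) \<le> e" and l_tail: "wnorm (proj {..-int n} l) \<le> e"
    and e: "0 \<le> e" "K^2 * e^2 \<le> 1 / 2"
  shows "Determinant.det (toep (\<lambda>z. p z * m z) n) \<noteq> 0"
proof
  assume "Determinant.det (toep (\<lambda>z. p z * m z) n) = 0"
  then obtain x where x: "x \<in> carrier_vec n" "x \<noteq> 0\<^sub>v n" "toep (\<lambda>z. p z * m z) n *\<^sub>v x = 0\<^sub>v n"
    using det_0_iff_vec_prod_zero_field[OF toep_carrier] by blast
  from wh have w: "wiener p" "wiener q" "wiener m" "wiener l" and p: "wsupp p {0..}" and q: "wsupp q {0..}"
    and pq: "\<And>z. norm z = 1 \<Longrightarrow> p z * q z = 1"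
    by (auto simp: wh_factors_def wsupp_def)
  have b0: "bvec (\<lambda>z. 0) n = 0\<^sub>v n" by (auto simp: bvec_def)
  obtain N M where NM: "wsupp N {..<0}" "wsupp M {int n..}"
    "\<And>z. norm z = 1 \<Longrightarrow> p z * m z * vpoly n x z = 0 + N z + M z"
    by (rule toep_solution[of "\<lambda>z. p z * m z" "\<lambda>z. 0" x n]) (use x w b0 in \<open>auto intro: wiener_mult\<close>)
  have z0: "wnorm (proj A (\<lambda>z. f z * 0)) = 0" for A f
    by (simp add: wnorm_def fc_proj cong: if_cong)
  have "wnorm M \<le> 2 * K * (wnorm (proj {int n..} (\<lambda>z. q z * 0)) + e * K * wnorm (proj {..<0} (\<lambda>z. l z * 0)))"
    by (rule finite_section(1)[OF wh q_tail l_tail e wsupp_vpoly NM(1,2) wiener_0]) (rule NM(3))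
  also have "\<dots> = 0" by (simp only: z0) simp
  finally have "wnorm M \<le> 0" .
  then have "wnorm M = 0" using wnorm_nonneg[of M] by simp
  then have M0: "fc M k = 0" for k using norm_fc_le_wnorm[OF wsuppD(1)[OF NM(2)], of k] by simp
  have lM: "fc (\<lambda>z. l z * M z) k = 0" for k
  proof -
    have "norm (fc (\<lambda>z. l z * M z) k) \<le> wnorm (\<lambda>z. l z * M z)"
      using w NM by (intro norm_fc_le_wnorm wiener_mult) (auto simp: wsupp_def)
    also have "\<dots> \<le> wnorm l * wnorm M" using w NM by (intro wnorm_mult) (auto simp: wsupp_def)
    finally show ?thesis using \<open>wnorm M = 0\<close> by simp
  qed
  have py0: "fc (\<lambda>z. p z * vpoly n x z) k = 0" for k
  proof (cases "k \<ge> 0")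
    case True
    have "fc (\<lambda>z. p z * vpoly n x z) k = fc (\<lambda>z. l z * 0) k + fc (\<lambda>z. l z * M z) k"
      by (rule finite_section(2)[OF wh q_tail l_tail e wsupp_vpoly NM(1,2) wiener_0 _ True]) (rule NM(3))
    then show ?thesis using lM by simp
  next
    case False
    have "wsupp (\<lambda>z. p z * vpoly n x z) {0..}" by (rule wsupp_mult[OF p wsupp_vpoly]) auto
    then show ?thesis using False by (auto simp: wsupp_def)
  qed
  have "p z * vpoly n x z = 0" if "norm z = 1" for z
    by (rule wiener_eqI[OF wiener_mult[OF w(1) wiener_vpoly] wiener_0 _ that]) (simp add: py0)
  moreover have "p z \<noteq> 0" if "norm z = 1" for z using pq[OF that] by auto
  ultimately have "vpoly n x z = 0" if "norm z = 1" for z using that by auto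
  then have "fc (vpoly n x) k = 0" for k
    using fun_cong[OF fourier_coeff_cong[of "vpoly n x" "\<lambda>z. 0"], of k] by simp
  then have v: "vec_index x (n - 1 - k) = 0" if "k < n" for k using fc_vpoly_index[OF that, of x] by simp
  have "vec_index x k = 0" if "k < n" for k
    using v[of "n - 1 - k"] that by simp
  then show False using x by (auto simp: vec_eq_iff)
qed

section \<open>Laurent series in an annulus\<close>

abbreviation ann :: "real \<Rightarrow> complex set" where
  "ann r \<equiv> {z. inverse r < norm z \<and> norm z < r}"

lemma open_ann: "open (ann r)"
  by (intro open_Collect_conj open_Collect_less continuous_intros)

lemma contour_integral_circlepath_annulus:
  assumes hol: "f holomorphic_on ann r" and a: "inverse r < a" "a < r" and b: "inverse r < b" "b < r"
    and r: "0 < r"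
  shows "cint a f = cint b f"
proof (rule Cauchy_theorem_homotopic_loops[OF _ open_ann hol])
  have ab: "0 < a" "0 < b" using r a b by (meson inverse_positive_iff_positive less_trans)+
  show "homotopic_loops (ann r) (circlepath 0 a) (circlepath 0 b)"
  proof (rule homotopic_loops_linear)
    fix t x :: real assume "t \<in> {0..1}"
    show "closed_segment (circlepath 0 a t) (circlepath 0 b t) \<subseteq> ann r"
    proof
      fix w assume "w \<in> closed_segment (circlepath 0 a t) (circlepath 0 b t)"
      then obtain u where u: "0 \<le> u" "u \<le> 1"
        and w: "w = (1 - u) *\<^sub>R circlepath 0 a t + u *\<^sub>R circlepath 0 b t"
        by (auto simp: closed_segment_def)
      have "w = of_real ((1 - u) * a + u * b) * exp (2 * of_real pi * \<i> * of_real t)"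
        unfolding w circlepath by (simp add: scaleR_conv_of_real algebra_simps)
      then have "norm w = \<bar>(1 - u) * a + u * b\<bar>" by (simp add: norm_mult norm_exp_eq_Re del: of_real_add of_real_mult)
      also have "\<dots> = (1 - u) * a + u * b" using u ab by (intro abs_of_nonneg add_nonneg_nonneg mult_nonneg_nonneg) auto
      finally have nw: "norm w = (1 - u) * a + u * b" .
      have "(1 - u) * a + u * b < r" using u a b
        by (intro convex_bound_lt) auto
      moreover have "inverse r < (1 - u) * a + u * b"
      proof -
        have "(1 - u) * (- a) + u * (- b) < - inverse r" using u a b by (intro convex_bound_lt) auto
        then show ?thesis by simp
      qed
      ultimately show "w \<in> ann r" using nw by auto
    qed
  qed auto
qed auto

lemma summable_on_geometric: "0 \<le> q \<Longrightarrow> q < 1 \<Longrightarrow> (\<lambda>k::nat. c * q ^ k) summable_on (UNIV :: nat set)" for q c :: real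
  by (intro summable_on_cmult_right norm_summable_imp_summable_on) (auto simp: summable_geometric)

lemma has_sum_geometric:
  fixes q :: "'a::{banach, real_normed_field}"
  shows "norm q < 1 \<Longrightarrow> ((\<lambda>k::nat. q ^ k) has_sum (1 / (1 - q))) UNIV"
  by (rule norm_summable_imp_has_sum) (auto simp: geometric_sums norm_power summable_geometric)

lemma cauchy_kernel_expansion_inside:
  assumes r: "norm z < r" and f: "continuous_on (sphere 0 r) f"
  shows "((\<lambda>k::nat. cint r (\<lambda>\<tau>. f \<tau> * z ^ k / \<tau> ^ Suc k)) has_sum
    cint r (\<lambda>\<tau>. f \<tau> / (\<tau> - z))) UNIV"
proof -
  have r0: "0 < r" using r norm_ge_zero[of z] by linarith
  obtain B where "\<forall>\<tau>\<in>sphere 0 r. norm (f \<tau>) \<le> B"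
    using compact_imp_bounded[OF compact_continuous_image[OF f]] by (auto simp: bounded_iff)
  then have B: "norm (f \<tau>) \<le> B" if "norm \<tau> = r" for \<tau> using that by auto
  show ?thesis
  proof (rule has_sum_contour_integral_circlepath[OF r0, where M = "\<lambda>k. B / r * (norm z / r) ^ k"])
    show "norm (f \<tau> * z ^ k / \<tau> ^ Suc k) \<le> B / r * (norm z / r) ^ k" if "norm \<tau> = r" for k \<tau>
      using B[OF that] that r0 by (simp add: norm_mult norm_divide norm_power divide_simps mult_right_mono)
    show "(\<lambda>k. B / r * (norm z / r) ^ k) summable_on UNIV"
      using r r0 by (intro summable_on_geometric) auto
    show "((\<lambda>k. f \<tau> * z ^ k / \<tau> ^ Suc k) has_sum f \<tau> / (\<tau> - z)) UNIV" if t: "norm \<tau> = r" for \<tau>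
    proof -
      have t0: "\<tau> \<noteq> 0" "\<tau> \<noteq> z" using t r r0 by auto
      have "((\<lambda>k. f \<tau> / \<tau> * (z / \<tau>) ^ k) has_sum f \<tau> / \<tau> * (1 / (1 - z / \<tau>))) UNIV"
        by (intro has_sum_cmult_right has_sum_geometric) (use t r r0 in \<open>simp add: norm_divide\<close>)
      also have "(\<lambda>k. f \<tau> / \<tau> * (z / \<tau>) ^ k) = (\<lambda>k. f \<tau> * z ^ k / \<tau> ^ Suc k)"
        by (simp add: fun_eq_iff power_divide)
      also have "f \<tau> / \<tau> * (1 / (1 - z / \<tau>)) = f \<tau> / (\<tau> - z)" using t0 by (simp add: field_simps)
      finally show ?thesis .
    qed
    show "continuous_on (sphere 0 r) (\<lambda>\<tau>. f \<tau> * z ^ k / \<tau> ^ Suc k)" for k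
      using r0 by (intro continuous_intros f) auto
  qed
qed

lemma cauchy_kernel_expansion_outside:
  assumes r: "0 < r" "r < norm z" and f: "continuous_on (sphere 0 r) f"
  shows "((\<lambda>k::nat. cint r (\<lambda>\<tau>. f \<tau> * \<tau> ^ k / z ^ Suc k)) has_sum
    - cint r (\<lambda>\<tau>. f \<tau> / (\<tau> - z))) UNIV"
proof -
  have z0: "z \<noteq> 0" "0 < norm z" using r by auto
  obtain B where "\<forall>\<tau>\<in>sphere 0 r. norm (f \<tau>) \<le> B"
    using compact_imp_bounded[OF compact_continuous_image[OF f]] by (auto simp: bounded_iff)
  then have B: "norm (f \<tau>) \<le> B" if "norm \<tau> = r" for \<tau> using that by auto
  have "((\<lambda>k::nat. cint r (\<lambda>\<tau>. f \<tau> * \<tau> ^ k / z ^ Suc k)) has_sum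
    cint r (\<lambda>\<tau>. - (f \<tau> / (\<tau> - z)))) UNIV"
  proof (rule has_sum_contour_integral_circlepath[OF r(1), where M = "\<lambda>k. B / norm z * (r / norm z) ^ k"])
    show "norm (f \<tau> * \<tau> ^ k / z ^ Suc k) \<le> B / norm z * (r / norm z) ^ k" if "norm \<tau> = r" for k \<tau>
      using B[OF that] that r z0 by (simp add: norm_mult norm_divide norm_power divide_simps mult_right_mono)
    show "(\<lambda>k. B / norm z * (r / norm z) ^ k) summable_on UNIV"
      using r z0 by (intro summable_on_geometric) auto
    show "((\<lambda>k. f \<tau> * \<tau> ^ k / z ^ Suc k) has_sum - (f \<tau> / (\<tau> - z))) UNIV" if t: "norm \<tau> = r" for \<tau>
    proof -
      have t0: "\<tau> \<noteq> z" using t r by auto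
      have "((\<lambda>k. f \<tau> / z * (\<tau> / z) ^ k) has_sum f \<tau> / z * (1 / (1 - \<tau> / z))) UNIV"
        by (intro has_sum_cmult_right has_sum_geometric) (use t r z0 in \<open>simp add: norm_divide divide_less_eq_1_pos\<close>)
      also have "(\<lambda>k. f \<tau> / z * (\<tau> / z) ^ k) = (\<lambda>k. f \<tau> * \<tau> ^ k / z ^ Suc k)"
        by (simp add: fun_eq_iff power_divide)
      also have "f \<tau> / z * (1 / (1 - \<tau> / z)) = - (f \<tau> / (\<tau> - z))" using t0 z0
        by (simp add: divide_simps) (simp add: algebra_simps)
      finally show ?thesis .
    qed
    show "continuous_on (sphere 0 r) (\<lambda>\<tau>. f \<tau> * \<tau> ^ k / z ^ Suc k)" for k
      using z0 by (intro continuous_intros f) auto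
  qed
  then show ?thesis by (simp add: contour_integral_neg)
qed

lemma fourier_coeff_circlepath:
  assumes hol: "f holomorphic_on ann R" and s: "inverse R < s" "s < R" and R: "1 < R"
  shows "fc f k = cint s (\<lambda>\<zeta>. f \<zeta> * \<zeta> powi (- k) / (2 * of_real pi * \<i> * \<zeta>))"
  unfolding fourier_coeff_def
proof (rule contour_integral_circlepath_annulus)
  have nz: "0 \<notin> ann R" using R by (auto simp: inverse_eq_divide)
  show "(\<lambda>\<zeta>. f \<zeta> * \<zeta> powi (- k) / (2 * of_real pi * \<i> * \<zeta>)) holomorphic_on ann R"
    by (intro holomorphic_intros hol) (use nz in auto)
qed (use s R in \<open>auto simp: inverse_less_1_iff\<close>)

lemma norm_fourier_coeff_le:
  assumes hol: "f holomorphic_on ann R" and s: "inverse R < s" "s < R" and R: "1 < R"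
    and B: "\<And>z. norm z = s \<Longrightarrow> norm (f z) \<le> B"
  shows "norm (fc f k) \<le> B * s powi (- k)"
proof -
  have "0 < inverse R" using R by simp
  then have s0: "0 < s" using s(1) by linarith
  have B0: "0 \<le> B" using B[of "of_real s"] s0 order_trans[OF norm_ge_zero] by simp
  have cont: "continuous_on (sphere 0 s) f"
    by (rule continuous_on_subset[OF holomorphic_on_imp_continuous_on[OF hol]]) (use s in auto)
  have int: "(\<lambda>\<zeta>. f \<zeta> * \<zeta> powi (- k) / (2 * of_real pi * \<i> * \<zeta>)) contour_integrable_on circlepath 0 s"
    using s0 by (intro contour_integrable_continuous_circlepath continuous_intros) (auto intro: cont)
  have "norm (cint s (\<lambda>\<zeta>. f \<zeta> * \<zeta> powi (- k) / (2 * of_real pi * \<i> * \<zeta>)))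
     \<le> B * s powi (- k) / (2 * pi * s) * (2 * pi * s)"
  proof (rule has_contour_integral_bound_circlepath)
    show "((\<lambda>\<zeta>. f \<zeta> * \<zeta> powi (- k) / (2 * of_real pi * \<i> * \<zeta>)) has_contour_integral
      cint s (\<lambda>\<zeta>. f \<zeta> * \<zeta> powi (- k) / (2 * of_real pi * \<i> * \<zeta>))) (circlepath 0 s)"
      using int by (rule has_contour_integral_integral)
    show "0 \<le> B * s powi (- k) / (2 * pi * s)" using B0 s0 by auto
    show "norm (f x * x powi (- k) / (2 * of_real pi * \<i> * x)) \<le> B * s powi (- k) / (2 * pi * s)"
      if "norm (x - 0) = s" for x
      using that B[of x] s0 by (auto simp: norm_mult norm_divide norm_power_int intro!: divide_right_mono mult_right_mono)
  qed (use s0 in auto)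
  then show ?thesis using s0 fourier_coeff_circlepath[OF hol s R, of k] by simp
qed

definition decay :: "real \<Rightarrow> real \<Rightarrow> (complex \<Rightarrow> complex) \<Rightarrow> bool" where
  "decay A s f \<longleftrightarrow> (\<forall>k. norm (fc f k) \<le> A * s powi (- \<bar>k\<bar>))"

lemma decayD: "decay A s f \<Longrightarrow> norm (fc f k) \<le> A * s powi (- \<bar>k\<bar>)"
  by (auto simp: decay_def)

lemma has_sum_geometric_int:
  fixes s :: real
  assumes "1 < s"
  shows "((\<lambda>k. A * s powi (- k)) has_sum (A * s powi (- n) * (s / (s - 1)))) {n..}"
proof -
  have 1: "((\<lambda>k::nat. A * s powi (- n) * inverse s ^ k) has_sum (A * s powi (- n) * (1 / (1 - inverse s)))) UNIV"
    using assms by (intro has_sum_cmult_right has_sum_geometric) (auto simp: inverse_less_1_iff)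
  have "A * s powi (- n) * inverse s ^ k = A * s powi (- (n + int k))" for k
  proof -
    have "s powi (- (n + int k)) = s powi (- n) * s powi (- int k)"
      using assms by (simp add: power_int_add[symmetric])
    then show ?thesis by (simp add: power_int_minus power_inverse)
  qed
  with 1 have 2: "((\<lambda>k::nat. A * s powi (- (n + int k))) has_sum (A * s powi (- n) * (1 / (1 - inverse s)))) UNIV"
    by simp
  have "1 / (1 - inverse s) = s / (s - 1)" using assms by (simp add: field_simps)
  moreover have "((\<lambda>k::nat. A * s powi (- (n + int k))) has_sum S) UNIV \<longleftrightarrow> ((\<lambda>k. A * s powi (- k)) has_sum S) {n..}" for S
    by (rule has_sum_reindex_bij_witness[where i = "\<lambda>k. nat (k - n)" and j = "\<lambda>k. n + int k"]) auto
  ultimately show ?thesis using 2 by simp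
qed

lemma has_sum_geometric_int_neg:
  fixes s :: real
  assumes "1 < s"
  shows "((\<lambda>k. A * s powi k) has_sum (A * s powi (- n) * (s / (s - 1)))) {..-n}"
  using has_sum_geometric_int[OF assms, of A n]
  by (subst has_sum_reindex_bij_witness[where i = uminus and j = uminus and T = "{n..}" and h = "\<lambda>k. A * s powi (- k)"]) auto

lemma has_sum_geometric_abs:
  fixes s :: real
  assumes "1 < s"
  shows "((\<lambda>k. A * s powi (- \<bar>k\<bar>)) has_sum (A * ((s + 1) / (s - 1)))) UNIV"
proof -
  have "((\<lambda>k. A * s powi (- \<bar>k\<bar>)) has_sum (A * s powi (- 0) * (s / (s - 1)))) {0..}"
    using has_sum_geometric_int[OF assms, of A 0] by (rule has_sum_cong[THEN iffD2, rotated]) auto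
  moreover have "((\<lambda>k. A * s powi (- \<bar>k\<bar>)) has_sum (A * s powi (- 1) * (s / (s - 1)))) {..-1}"
    using has_sum_geometric_int_neg[OF assms, of A 1] by (rule has_sum_cong[THEN iffD2, rotated]) auto
  ultimately have "((\<lambda>k. A * s powi (- \<bar>k\<bar>)) has_sum
     (A * s powi (- 0) * (s / (s - 1)) + A * s powi (- 1) * (s / (s - 1)))) ({0..} \<union> {..-1})"
    by (rule has_sum_Un_disjoint) auto
  moreover have "{0..} \<union> {..-1} = (UNIV :: int set)" by auto
  moreover have "A * s powi (- 0) * (s / (s - 1)) + A * s powi (- 1) * (s / (s - 1)) = A * ((s + 1) / (s - 1))"
    using assms by (simp add: power_int_minus add_divide_distrib distrib_left)
  ultimately show ?thesis by simp
qed

lemma decay_summable: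
  assumes "decay A s f" "1 < s"
  shows "(\<lambda>k. norm (fc f k)) summable_on UNIV"
  by (rule Infinite_Sum.abs_summable_on_comparison_test'[OF has_sum_imp_summable[OF has_sum_geometric_abs[OF assms(2)]]])
    (rule decayD[OF assms(1)])

lemma decay_nonneg: "decay A s f \<Longrightarrow> 0 \<le> A"
  using decayD[of A s f 0] order_trans[OF norm_ge_zero[of "fc f 0"]] by simp

lemma decay_wnorm_le:
  assumes "decay A s f" "1 < s" "wiener f"
  shows "wnorm f \<le> A * ((s + 1) / (s - 1))"
  by (rule wnorm_le[OF assms(3) decayD[OF assms(1)] has_sum_geometric_abs[OF assms(2)]])

lemma wnorm_proj_eq:
  assumes "wiener f" shows "((\<lambda>k. norm (fc f k)) has_sum wnorm (proj A f)) A"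
proof -
  have "((\<lambda>k. norm (fc (proj A f) k)) has_sum wnorm (proj A f)) UNIV"
    unfolding wnorm_def by (intro has_sum_infsum wiener_summable wiener_proj assms)
  also have "?this \<longleftrightarrow> ?thesis"
    by (rule has_sum_cong_neutral) (auto simp: fc_proj assms)
  finally show ?thesis .
qed

lemma decay_wnorm_proj_ge:
  assumes "decay A s f" "1 < s" "wiener f"
  shows "wnorm (proj {n..} f) \<le> A * s powi (- n) * (s / (s - 1))"
proof (rule has_sum_mono[OF wnorm_proj_eq[OF assms(3)] has_sum_geometric_int[OF assms(2)]])
  fix k
  have "s powi (- \<bar>k\<bar>) \<le> s powi (- k)" using assms by (intro power_int_increasing) auto
  with decayD[OF assms(1), of k] decay_nonneg[OF assms(1)]
  show "norm (fc f k) \<le> A * s powi (- k)" by (meson mult_left_mono order_trans)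
qed

lemma decay_wnorm_proj_le:
  assumes "decay A s f" "1 < s" "wiener f"
  shows "wnorm (proj {..-n} f) \<le> A * s powi (- n) * (s / (s - 1))"
proof (rule has_sum_mono[OF wnorm_proj_eq[OF assms(3)] has_sum_geometric_int_neg[OF assms(2)]])
  fix k
  have "s powi (- \<bar>k\<bar>) \<le> s powi k" using assms by (intro power_int_increasing) auto
  with decayD[OF assms(1), of k] decay_nonneg[OF assms(1)]
  show "norm (fc f k) \<le> A * s powi k" by (meson mult_left_mono order_trans)
qed

lemma
  assumes hol: "f holomorphic_on ann R" and s: "1 < s" "s < R"
    and B: "\<And>z. norm z = s \<Longrightarrow> norm (f z) \<le> B" "\<And>z. norm z = inverse s \<Longrightarrow> norm (f z) \<le> B"
  shows decay_holomorphic_ann: "decay B s f" and wiener_holomorphic_ann: "wiener f"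
proof -
  have R: "1 < R" and s': "inverse R < s" "inverse R < inverse s" "inverse s < R"
    using s by (auto simp: inverse_less_1_iff intro: less_trans[of _ 1])
  have "norm (fc f k) \<le> B * s powi (- \<bar>k\<bar>)" for k
  proof (cases "k \<ge> 0")
    case True then show ?thesis using norm_fourier_coeff_le[OF hol s'(1) s(2) R B(1), of k] by simp
  next
    case False then show ?thesis using norm_fourier_coeff_le[OF hol s'(2,3) R B(2), of k] s
      by (simp add: power_int_inverse power_int_minus)
  qed
  then show dec: "decay B s f" by (simp add: decay_def)
  have cont: "continuous_on (sphere 0 t) f" if "inverse R < t" "t < R" for t
    by (rule continuous_on_subset[OF holomorphic_on_imp_continuous_on[OF hol]]) (use that in auto)
  define c where "c = 2 * of_real pi * \<i>"
  have c0: "c \<noteq> 0" by (simp add: c_def)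
  have "((\<lambda>k. fc f k * z powi k) has_sum f z) UNIV" if z: "norm z = 1" for z
  proof -
    have z0: "z \<noteq> 0" using z by auto
    define g where "g = (\<lambda>t. if t = z then deriv f z else (f t - f z) / (t - z))"
    have g: "g holomorphic_on ann R"
      unfolding g_def by (rule pole_lemma_open[OF hol open_ann])
    have geq: "cint s g = cint (inverse s) g"
      using s s' R by (intro contour_integral_circlepath_annulus[OF g]) auto
    have split: "cint t g =
       cint t (\<lambda>\<tau>. f \<tau> / (\<tau> - z)) - f z * cint t (\<lambda>\<tau>. 1 / (\<tau> - z))"
      if t: "inverse R < t" "t < R" "t \<noteq> 1" "0 < t" for t
    proof -
      have ne: "\<tau> - z \<noteq> 0" if "\<tau> \<in> sphere 0 t" for \<tau> using t z that by auto
      have "cint t g = cint t (\<lambda>\<tau>. f \<tau> / (\<tau> - z) - f z * (1 / (\<tau> - z)))"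
        using t z by (intro contour_integral_eq) (auto simp: g_def diff_divide_distrib)
      also have "\<dots> = cint t (\<lambda>\<tau>. f \<tau> / (\<tau> - z)) - cint t (\<lambda>\<tau>. f z * (1 / (\<tau> - z)))"
        using t ne by (intro contour_integral_diff contour_integrable_continuous_circlepath continuous_intros) (auto intro: cont)
      also have "cint t (\<lambda>\<tau>. f z * (1 / (\<tau> - z))) = f z * cint t (\<lambda>\<tau>. 1 / (\<tau> - z))"
        using t ne by (intro contour_integral_lmul contour_integrable_continuous_circlepath continuous_intros) auto
      finally show ?thesis .
    qed
    have "((\<lambda>\<tau>. 1 / (\<tau> - z)) has_contour_integral (2 * of_real pi * \<i> * 1)) (circlepath 0 s)"
      using z s by (intro Cauchy_integral_circlepath) auto
    then have i1: "cint s (\<lambda>\<tau>. 1 / (\<tau> - z)) = c"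
      by (simp add: contour_integral_unique c_def)
    have "((\<lambda>\<tau>. 1 / (\<tau> - z)) has_contour_integral 0) (circlepath 0 (inverse s))"
    proof (rule Cauchy_theorem_disc_simple[of _ 0 1])
      show "(\<lambda>\<tau>. 1 / (\<tau> - z)) holomorphic_on ball 0 1"
        using z by (intro holomorphic_intros) auto
      show "path_image (circlepath 0 (inverse s)) \<subseteq> ball 0 1"
        using s by (auto simp: inverse_less_1_iff)
    qed auto
    then have i2: "cint (inverse s) (\<lambda>\<tau>. 1 / (\<tau> - z)) = 0"
      by (simp add: contour_integral_unique)
    have main: "f z = (cint s (\<lambda>\<tau>. f \<tau> / (\<tau> - z))
        - cint (inverse s) (\<lambda>\<tau>. f \<tau> / (\<tau> - z))) / c"
      using split[of s] split[of "inverse s"] s s' geq i1 i2 c0 by (simp add: inverse_eq_1_iff field_simps)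
    have coef: "cint t (\<lambda>\<tau>. f \<tau> * (\<tau> powi (- k) / \<tau>)) = c * fc f k"
      if t: "inverse R < t" "t < R" "0 < t" for t k
    proof -
      have "cint t (\<lambda>\<tau>. f \<tau> * (\<tau> powi (- k) / \<tau>))
        = cint t (\<lambda>\<tau>. c * (f \<tau> * \<tau> powi (- k) / (2 * of_real pi * \<i> * \<tau>)))"
        using t by (intro contour_integral_eq) (auto simp: c_def)
      also have "\<dots> = c * cint t (\<lambda>\<tau>. f \<tau> * \<tau> powi (- k) / (2 * of_real pi * \<i> * \<tau>))"
        using t by (intro contour_integral_lmul contour_integrable_continuous_circlepath continuous_intros) (auto intro: cont)
      finally show ?thesis using fourier_coeff_circlepath[OF hol t(1,2) R, of k] by simp
    qed
    have A: "((\<lambda>k::nat. c * (fc f (int k) * z powi int k)) has_sum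
        cint s (\<lambda>\<tau>. f \<tau> / (\<tau> - z))) UNIV"
    proof -
      have "cint s (\<lambda>\<tau>. f \<tau> * z ^ k / \<tau> ^ Suc k) = c * (fc f (int k) * z powi int k)" for k
      proof -
        have "cint s (\<lambda>\<tau>. f \<tau> * z ^ k / \<tau> ^ Suc k)
          = cint s (\<lambda>\<tau>. z ^ k * (f \<tau> * (\<tau> powi (- int k) / \<tau>)))"
          using s by (intro contour_integral_eq) (auto simp: power_int_minus field_simps)
        also have "\<dots> = z ^ k * cint s (\<lambda>\<tau>. f \<tau> * (\<tau> powi (- int k) / \<tau>))"
          using s s' by (intro contour_integral_lmul contour_integrable_continuous_circlepath continuous_intros) (auto intro: cont)
        finally show ?thesis using coef[of s "int k"] s s' by simp
      qed
      then show ?thesis using cauchy_kernel_expansion_inside[of z s f] z s s' cont by simp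
    qed
    have B: "((\<lambda>k::nat. c * (fc f (- int k - 1) * z powi (- int k - 1))) has_sum
        - cint (inverse s) (\<lambda>\<tau>. f \<tau> / (\<tau> - z))) UNIV"
    proof -
      have "cint (inverse s) (\<lambda>\<tau>. f \<tau> * \<tau> ^ k / z ^ Suc k) = c * (fc f (- int k - 1) * z powi (- int k - 1))" for k
      proof -
        have "cint (inverse s) (\<lambda>\<tau>. f \<tau> * \<tau> ^ k / z ^ Suc k)
          = cint (inverse s) (\<lambda>\<tau>. z powi (- int k - 1) * (f \<tau> * (\<tau> powi (- (- int k - 1)) / \<tau>)))"
          using s z0 by (intro contour_integral_eq) (auto simp: power_int_minus power_int_diff power_int_add field_simps)
        also have "\<dots> = z powi (- int k - 1) * cint (inverse s) (\<lambda>\<tau>. f \<tau> * (\<tau> powi (- (- int k - 1)) / \<tau>))"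
          using s s' by (intro contour_integral_lmul contour_integrable_continuous_circlepath continuous_intros) (auto intro: cont)
        finally show ?thesis using coef[of "inverse s" "- int k - 1"] s s' by simp
      qed
      then show ?thesis using cauchy_kernel_expansion_outside[of "inverse s" z f] z s s' cont by (simp add: inverse_less_1_iff)
    qed
    have A': "((\<lambda>k. c * (fc f k * z powi k)) has_sum
        cint s (\<lambda>\<tau>. f \<tau> / (\<tau> - z))) {0..}"
      using A by (subst has_sum_reindex_bij_witness[where i = int and j = nat and T = UNIV and h = "\<lambda>k::nat. c * (fc f (int k) * z powi int k)"]) auto
    have B': "((\<lambda>k. c * (fc f k * z powi k)) has_sum
        - cint (inverse s) (\<lambda>\<tau>. f \<tau> / (\<tau> - z))) {..<0}"
      using B by (subst has_sum_reindex_bij_witness[where i = "\<lambda>k. - int k - 1" and j = "\<lambda>k. nat (- k - 1)" and T = UNIV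
        and h = "\<lambda>k::nat. c * (fc f (- int k - 1) * z powi (- int k - 1))"]) auto
    have "((\<lambda>k. c * (fc f k * z powi k)) has_sum c * f z) ({0..} \<union> {..<0})"
    proof -
      have "((\<lambda>k. c * (fc f k * z powi k)) has_sum (cint s (\<lambda>\<tau>. f \<tau> / (\<tau> - z))
        + - cint (inverse s) (\<lambda>\<tau>. f \<tau> / (\<tau> - z)))) ({0..} \<union> {..<0})"
        by (rule has_sum_Un_disjoint[OF A' B']) auto
      then show ?thesis using main c0 by simp
    qed
    moreover have "{0..} \<union> {..<0} = (UNIV :: int set)" by auto
    ultimately have "((\<lambda>k. c * (fc f k * z powi k)) has_sum c * f z) UNIV" by simp
    from has_sum_cmult_right[OF this, of "1 / c"] show ?thesis using c0 by simp
  qed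
  then show "wiener f" using decay_summable[OF dec s(1)] by (simp add: wiener_def)
qed

lemma
  assumes f: "wiener f"
  shows wiener_reflect: "wiener (\<lambda>z. f (1 / z))" and fc_reflect: "fc (\<lambda>z. f (1 / z)) k = fc f (- k)"
proof -
  have 1: "(\<lambda>k. norm (fc f (- k))) summable_on UNIV"
    using wiener_summable[OF f, of UNIV]
    by (subst summable_on_reindex_bij_witness[where i = uminus and j = uminus]) auto
  have 2: "((\<lambda>k. fc f (- k) * z powi k) has_sum f (1 / z)) UNIV" if z: "norm z = 1" for z
  proof -
    have "((\<lambda>k. fc f k * (1 / z) powi k) has_sum f (1 / z)) UNIV"
      using z by (intro wiener_has_sum[OF f]) (simp add: norm_divide)
    also have "?this \<longleftrightarrow> ?thesis"
      by (rule has_sum_reindex_bij_witness[where i = uminus and j = uminus])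
        (auto simp: power_int_minus power_int_divide_distrib divide_inverse power_int_inverse)
    finally show ?thesis .
  qed
  show "wiener (\<lambda>z. f (1 / z))" "fc (\<lambda>z. f (1 / z)) k = fc f (- k)"
    using wienerI[OF 1 2] by auto
qed

lemma
  assumes hol: "f holomorphic_on ball 0 R" and R: "1 < R"
  shows fc_ball_neg: "k < 0 \<Longrightarrow> fc f k = 0"
    and fc_ball_nonneg: "fc f (int i) = fps_nth (fps_expansion f 0) i"
proof -
  have cont: "continuous_on (cball 0 1) f"
    by (rule continuous_on_subset[OF holomorphic_on_imp_continuous_on[OF hol]]) (use R in auto)
  have hol1: "f holomorphic_on ball 0 1" by (rule holomorphic_on_subset[OF hol]) (use R in auto)
  show "fc f k = 0" if k: "k < 0"
  proof -
    have "fc f k = cint 1 (\<lambda>\<zeta>. f \<zeta> * \<zeta> ^ nat (- k - 1) / (2 * of_real pi * \<i>))"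
      unfolding fourier_coeff_def
    proof (rule contour_integral_eq)
      fix \<zeta> :: complex assume "\<zeta> \<in> path_image (circlepath 0 1)"
      then have z0: "\<zeta> \<noteq> 0" by auto
      have "\<zeta> powi (- k) = \<zeta> powi (int (Suc (nat (- k - 1))))" using k by (intro arg_cong[where f = "\<lambda>i. \<zeta> powi i"]) simp
      also have "\<dots> = \<zeta> * \<zeta> ^ nat (- k - 1)" by (simp only: power_int_of_nat power_Suc)
      finally have "\<zeta> powi (- k) = \<zeta> * \<zeta> ^ nat (- k - 1)" .
      then show "f \<zeta> * \<zeta> powi (- k) / (2 * of_real pi * \<i> * \<zeta>) = f \<zeta> * \<zeta> ^ nat (- k - 1) / (2 * of_real pi * \<i>)"
        using z0 by simp
    qed
    also have "\<dots> = 0"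
      using R by (intro contour_integral_unique Cauchy_theorem_disc_simple[of _ 0 R] holomorphic_intros hol) auto
    finally show ?thesis .
  qed
  have "fc f (int i) = cint 1 (\<lambda>u. 1 / (2 * of_real pi * \<i>) * (f u / (u - 0) ^ Suc i))"
    unfolding fourier_coeff_def
    by (rule contour_integral_eq) (auto simp: power_int_minus field_simps)
  also have "\<dots> = 1 / (2 * of_real pi * \<i>) * cint 1 (\<lambda>u. f u / (u - 0) ^ Suc i)"
    by (intro contour_integral_lmul contour_integrable_continuous_circlepath continuous_intros)
      (auto intro: continuous_on_subset[OF cont])
  also have "\<dots> = (deriv ^^ i) f 0 / fact i"
    by (subst Cauchy_contour_integral_circlepath[OF cont hol1]) auto
  finally show "fc f (int i) = fps_nth (fps_expansion f 0) i" by (simp add: fps_expansion_def)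
qed

lemma ball_subset_ann: "ann R \<subseteq> ball 0 R" by auto

lemma
  assumes hol: "f holomorphic_on ball 0 R" and R: "1 < s" "s < R"
    and B: "\<And>z. norm z \<le> s \<Longrightarrow> norm (f z) \<le> B"
  shows decay_holomorphic_ball: "decay B s f" and wsupp_holomorphic_ball: "wsupp f {0..}"
proof -
  have hol': "f holomorphic_on ann R" by (rule holomorphic_on_subset[OF hol ball_subset_ann])
  have "inverse s < s" using R by (simp add: inverse_less_1_iff less_trans[of _ 1])
  then have B': "norm (f z) \<le> B" if "norm z = s \<or> norm z = inverse s" for z
    using B that by auto
  show "decay B s f" by (rule decay_holomorphic_ann[OF hol' R]) (use B' in auto)
  have "wiener f" by (rule wiener_holomorphic_ann[OF hol' R]) (use B' in auto)
  then show "wsupp f {0..}" using fc_ball_neg[OF hol] R by (auto simp: wsupp_def)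
qed

lemma
  assumes hol: "f holomorphic_on ball 0 R" and R: "1 < s" "s < R"
    and B: "\<And>z. norm z \<le> s \<Longrightarrow> norm (f z) \<le> B"
  shows decay_reflect_ball: "decay B s (\<lambda>z. f (1 / z))" and wsupp_reflect_ball: "wsupp (\<lambda>z. f (1 / z)) {..0}"
proof -
  note 1 = decay_holomorphic_ball[OF assms] and 2 = wsupp_holomorphic_ball[OF assms]
  note 3 = fc_reflect[OF wsuppD(1)[OF 2]]
  show "decay B s (\<lambda>z. f (1 / z))"
    unfolding decay_def
  proof
    fix k show "norm (fc (\<lambda>z. f (1 / z)) k) \<le> B * s powi (- \<bar>k\<bar>)" using decayD[OF 1, of "- k"] 3[of k] by simp
  qed
  show "wsupp (\<lambda>z. f (1 / z)) {..0}"
    using 2 3 by (auto simp: wsupp_def wiener_reflect)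
qed

lemma holomorphic_ball_bounded:
  assumes hol: "f holomorphic_on ball 0 R" and s: "s < R"
  obtains b where "\<And>z. norm z \<le> s \<Longrightarrow> norm (f z :: complex) \<le> b"
proof -
  have "compact (f ` cball 0 s)"
    by (intro compact_continuous_image continuous_on_subset[OF holomorphic_on_imp_continuous_on[OF hol]]) (use s in auto)
  then obtain b where "\<forall>z\<in>cball 0 s. norm (f z) \<le> b" by (auto dest!: compact_imp_bounded simp: bounded_iff)
  then show thesis by (intro that[of b]) simp
qed

lemma wiener_ball:
  assumes hol: "f holomorphic_on ball 0 R" and R: "1 < R"
  shows "wiener f"
proof -
  obtain s where s: "1 < s" "s < R" using dense[OF R] by blast
  obtain b where "\<And>z. norm z \<le> s \<Longrightarrow> norm (f z) \<le> b"
    using holomorphic_ball_bounded[OF hol s(2)] by blast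
  then have "wsupp f {0..}" by (rule wsupp_holomorphic_ball[OF hol s])
  then show ?thesis by (rule wsuppD)
qed

definition inside :: "(complex \<Rightarrow> complex) \<Rightarrow> complex \<Rightarrow> complex" where
  "inside f a = (if norm a < 1 then f a else 0)"

lemma cauchy_integral_unit_circle:
  assumes hol: "f holomorphic_on ball 0 R" and R: "1 < R" and a: "norm a \<noteq> 1"
  shows "((\<lambda>z. f z / (z - a)) has_contour_integral (2 * of_real pi * \<i> * inside f a)) (circlepath 0 1)"
proof (cases "norm a < 1")
  case True
  have "((\<lambda>z. f z / (z - a)) has_contour_integral (2 * of_real pi * \<i> * f a)) (circlepath 0 1)"
    by (rule Cauchy_integral_circlepath)
      (use R True in \<open>auto intro: continuous_on_subset[OF holomorphic_on_imp_continuous_on[OF hol]] holomorphic_on_subset[OF hol]\<close>)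
  then show ?thesis using True by (simp add: inside_def)
next
  case False
  then have a1: "1 < norm a" using a by simp
  have "((\<lambda>z. f z / (z - a)) has_contour_integral 0) (circlepath 0 1)"
  proof (rule Cauchy_theorem_disc_simple[of _ 0 "min R (norm a)"])
    show "(\<lambda>z. f z / (z - a)) holomorphic_on ball 0 (min R (norm a))"
      by (intro holomorphic_intros holomorphic_on_subset[OF hol]) (use a1 in auto)
  qed (use R a1 in auto)
  then show ?thesis using False by (simp add: inside_def)
qed

lemma
  assumes hol: "f holomorphic_on ball 0 R" and R: "1 < R" and a: "norm a \<noteq> 1"
  shows fc_cauchy_0: "fc (\<lambda>z. f z * (z / (z - a))) 0 = inside f a"
    and fc_cauchy_neg1: "fc (\<lambda>z. f z * (z / (z - a))) (-1) = a * inside f a"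
    and fc_cauchy_1: "a \<noteq> 0 \<Longrightarrow> fc (\<lambda>z. f z * (z / (z - a))) 1 = (inside f a - f 0) / a"
proof -
  define c where "c = 2 * of_real pi * \<i>"
  have c0: "c \<noteq> 0" by (simp add: c_def)
  have az: "z - a \<noteq> 0" if "norm z = 1" for z using a that by auto
  have "((\<lambda>z. 1 / c * (f z / (z - a))) has_contour_integral 1 / c * (c * inside f a)) (circlepath 0 1)"
    using cauchy_integral_unit_circle[OF hol R a] unfolding c_def by (rule has_contour_integral_lmul)
  also have "1 / c * (c * inside f a) = inside f a" using c0 by simp
  finally have 0: "((\<lambda>z. 1 / c * (f z / (z - a))) has_contour_integral inside f a) (circlepath 0 1)" .
  show "fc (\<lambda>z. f z * (z / (z - a))) 0 = inside f a"
    unfolding fourier_coeff_def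
    by (subst contour_integral_unique[OF 0, symmetric], rule contour_integral_eq) (auto simp: c_def mult_ac)
  have hol1: "(\<lambda>z. z * f z) holomorphic_on ball 0 R" by (intro holomorphic_intros hol)
  have "((\<lambda>z. 1 / c * (z * f z / (z - a))) has_contour_integral 1 / c * (c * inside (\<lambda>z. z * f z) a)) (circlepath 0 1)"
    using cauchy_integral_unit_circle[OF hol1 R a] unfolding c_def by (rule has_contour_integral_lmul)
  also have "1 / c * (c * inside (\<lambda>z. z * f z) a) = a * inside f a" using c0 by (simp add: inside_def)
  finally have m1: "((\<lambda>z. 1 / c * (z * f z / (z - a))) has_contour_integral a * inside f a) (circlepath 0 1)" .
  show "fc (\<lambda>z. f z * (z / (z - a))) (-1) = a * inside f a"
    unfolding fourier_coeff_def
    by (subst contour_integral_unique[OF m1, symmetric], rule contour_integral_eq) (auto simp: c_def mult_ac)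
  show "fc (\<lambda>z. f z * (z / (z - a))) 1 = (inside f a - f 0) / a" if a0: "a \<noteq> 0"
  proof -
    have "((\<lambda>z. 1 / c * (f z / (z - 0))) has_contour_integral 1 / c * (c * inside f 0)) (circlepath 0 1)"
      using cauchy_integral_unit_circle[OF hol R, of 0] unfolding c_def by (intro has_contour_integral_lmul) auto
    also have "1 / c * (c * inside f 0) = f 0" using c0 by (simp add: inside_def)
    finally have z: "((\<lambda>z. 1 / c * (f z / (z - 0))) has_contour_integral f 0) (circlepath 0 1)" .
    have d: "((\<lambda>z. (1 / c * (f z / (z - a)) - 1 / c * (f z / (z - 0))) / a) has_contour_integral (inside f a - f 0) / a) (circlepath 0 1)"
      by (intro has_contour_integral_div has_contour_integral_diff 0 z)
    show ?thesis unfolding fourier_coeff_def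
    proof (subst contour_integral_unique[OF d, symmetric], rule contour_integral_eq)
      fix z assume "z \<in> path_image (circlepath 0 1)"
      then have "z \<noteq> 0" "z - a \<noteq> 0" using az[of z] by auto
      then show "f z * (z / (z - a)) * z powi - 1 / (2 * complex_of_real pi * \<i> * z)
         = (1 / c * (f z / (z - a)) - 1 / c * (f z / (z - 0))) / a"
        using a0 c0 unfolding c_def[symmetric] by (simp add: power_int_minus divide_simps) (simp add: algebra_simps)
    qed
  qed
qed

section \<open>The logarithm of the symbol\<close>

lemma exp_eq_imp_diff_constant:
  fixes f g :: "'a::topological_space \<Rightarrow> complex"
  assumes S: "connected S" and f: "continuous_on S f" and g: "continuous_on S g"
    and eq: "\<And>x. x \<in> S \<Longrightarrow> exp (f x) = exp (g x)"
  obtains c where "\<And>x. x \<in> S \<Longrightarrow> f x = g x + c"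
proof -
  have "(\<lambda>x. f x - g x) constant_on S"
  proof (rule continuous_discrete_range_constant[OF S])
    show "continuous_on S (\<lambda>x. f x - g x)" by (intro continuous_intros f g)
    fix x assume x: "x \<in> S"
    have int: "\<exists>n::int. f y - g y = of_int (2 * n) * pi * \<i>" if "y \<in> S" for y
      using eq[OF that] by (auto simp: exp_eq algebra_simps)
    show "\<exists>e>0. \<forall>y. y \<in> S \<and> f y - g y \<noteq> f x - g x \<longrightarrow> e \<le> norm (f y - g y - (f x - g x))"
    proof (intro exI[of _ "2 * pi"] conjI allI impI)
      fix y assume y: "y \<in> S \<and> f y - g y \<noteq> f x - g x"
      obtain m n :: int where mn: "f x - g x = of_int (2 * m) * pi * \<i>" "f y - g y = of_int (2 * n) * pi * \<i>"
        using int[of x] int[of y] x y by blast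
      have "m \<noteq> n" using mn y by auto
      then have "1 \<le> \<bar>n - m\<bar>" by linarith
      then have "1 \<le> \<bar>real_of_int (n - m)\<bar>" by linarith
      moreover have "f y - g y - (f x - g x) = of_real (2 * real_of_int (n - m) * pi) * \<i>"
        unfolding mn by (simp add: algebra_simps)
      ultimately show "2 * pi \<le> norm (f y - g y - (f x - g x))"
        by (simp add: norm_mult abs_mult del: of_real_mult of_int_diff)
    qed auto
  qed
  then obtain c where "\<And>x. x \<in> S \<Longrightarrow> f x - g x = c" by (auto simp: constant_on_def)
  then show thesis by (intro that[of c]) (simp add: algebra_simps)
qed

lemma holomorphic_log_annulus:
  assumes R: "1 < R" and hol: "\<Phi> holomorphic_on ann R" and nz: "\<And>z. z \<in> ann R \<Longrightarrow> \<Phi> z \<noteq> 0"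
    and wn: "winding_number (\<Phi> \<circ> circlepath 0 1) 0 = 0"
  obtains V where "V holomorphic_on ann R" "\<And>z. z \<in> ann R \<Longrightarrow> exp (V z) = \<Phi> z"
proof -
  define S where "S = {s::complex. - ln R < Re s \<and> Re s < ln R}"
  have S: "convex S" "open S"
  proof -
    have "S = {s. - ln R < Re s} \<inter> {s. Re s < ln R}" by (auto simp: S_def)
    then show "convex S" by (simp only: convex_Int convex_halfspace_Re_gt convex_halfspace_Re_lt)
    show "open S" unfolding S_def by (intro open_Collect_conj open_Collect_less continuous_intros)
  qed
  have exp_S: "exp s \<in> ann R \<longleftrightarrow> s \<in> S" for s
  proof -
    have "inverse R < exp (Re s) \<longleftrightarrow> - ln R < Re s"
      using R exp_less_cancel_iff[of "- ln R" "Re s"] by (simp add: exp_minus)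
    moreover have "exp (Re s) < R \<longleftrightarrow> Re s < ln R"
      using R exp_less_cancel_iff[of "Re s" "ln R"] by simp
    ultimately show ?thesis by (simp add: S_def)
  qed
  have img: "exp ` S \<subseteq> ann R" using exp_S by blast
  have "(\<lambda>s. \<Phi> (exp s)) holomorphic_on S"
    by (rule holomorphic_on_compose_gen[of exp S \<Phi> "ann R", unfolded o_def, OF _ hol img])
      (intro holomorphic_intros)
  then obtain L where L: "L holomorphic_on S" "\<And>s. s \<in> S \<Longrightarrow> \<Phi> (exp s) = exp (L s)"
    by (rule contractible_imp_holomorphic_log[OF _ convex_imp_contractible[OF S(1)]]) (use nz img in blast)+
  have contL: "continuous_on S L" using L(1) by (rule holomorphic_on_imp_continuous_on)
  define p where "p = 2 * of_real pi * \<i>"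
  have shift: "s + p \<in> S" "s - p \<in> S" if "s \<in> S" for s using that by (auto simp: S_def p_def)
  have "path (\<Phi> \<circ> circlepath 0 1)"
    by (intro path_continuous_image continuous_on_subset[OF holomorphic_on_imp_continuous_on[OF hol]])
      (use R in \<open>auto simp: inverse_less_1_iff\<close>)
  moreover have "0 \<notin> path_image (\<Phi> \<circ> circlepath 0 1)"
    using nz R by (auto simp: path_image_compose inverse_less_1_iff)
  ultimately obtain q where q: "path q" "pathfinish q - pathstart q = 2 * of_real pi * \<i> * winding_number (\<Phi> \<circ> circlepath 0 1) 0"
    "\<And>t. t \<in> {0..1} \<Longrightarrow> (\<Phi> \<circ> circlepath 0 1) t = 0 + exp (q t)"
    by (rule winding_number_as_continuous_log) (rule that)
  have "\<And>t. t \<in> {0..1} \<Longrightarrow> exp (q t) = exp (L (p * of_real t))"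
  proof -
    fix t :: real assume t: "t \<in> {0..1}"
    have "p * of_real t \<in> S" using R by (simp add: S_def p_def)
    then show "exp (q t) = exp (L (p * of_real t))"
      using q(3)[OF t] L(2)[of "p * of_real t"] by (simp add: circlepath p_def)
  qed
  moreover have "continuous_on {0..1} (\<lambda>t. L (p * of_real t))"
    by (rule continuous_on_compose2[OF contL]) (use R in \<open>auto intro!: continuous_intros simp: S_def p_def\<close>)
  ultimately obtain c where c: "\<And>t. t \<in> {0..1} \<Longrightarrow> q t = L (p * of_real t) + c"
    using exp_eq_imp_diff_constant[of "{0..1::real}" q "\<lambda>t. L (p * of_real t)"] q(1) by (auto simp: path_def)
  have L0: "L p = L 0"
    using q(2) c[of 0] c[of 1] wn by (simp add: pathfinish_def pathstart_def)
  obtain d where d: "\<And>s. s \<in> S \<Longrightarrow> L (s + p) = L s + d"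
  proof (rule exp_eq_imp_diff_constant[of S "\<lambda>s. L (s + p)" L])
    show "connected S" using S by (rule_tac convex_connected)
    show "continuous_on S (\<lambda>s. L (s + p))"
      by (rule continuous_on_compose2[OF contL]) (use shift in \<open>auto intro!: continuous_intros\<close>)
    show "exp (L (s + p)) = exp (L s)" if "s \<in> S" for s
      using L(2)[OF that] L(2)[OF shift(1)[OF that]] by (simp add: exp_add p_def exp_two_pi_i)
  qed (use contL in auto)
  have d0: "L (s + p) = L s" if "s \<in> S" for s
    using d[OF that] d[of 0] L0 R by (simp add: S_def)
  have dn: "L (s + of_nat n * p) = L s" if "s \<in> S" for s n
    using that
  proof (induction n arbitrary: s)
    case (Suc n)
    have "L (s + of_nat (Suc n) * p) = L ((s + p) + of_nat n * p)" by (simp add: algebra_simps)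
    then show ?case using Suc shift d0 by simp
  qed auto
  have Leq: "L s = L t" if st: "s \<in> S" "t \<in> S" "exp s = exp t" for s t
  proof -
    obtain n :: int where n: "s = t + of_int n * p"
      using st(3) by (auto simp: exp_eq p_def algebra_simps)
    show ?thesis
    proof (cases "n \<ge> 0")
      case True then show ?thesis using dn[OF st(2), of "nat n"] n by simp
    next
      case False
      then have "t = s + of_nat (nat (- n)) * p" using n by (simp add: algebra_simps)
      then show ?thesis using dn[OF st(1), of "nat (- n)"] by simp
    qed
  qed
  define V where "V = (\<lambda>z. L (Ln z))"
  have ann0: "z \<noteq> 0" if "z \<in> ann R" for z using that R by auto
  have V: "V (exp s) = L s" if "s \<in> S" for s
    unfolding V_def using that by (intro Leq) (auto simp: exp_S[symmetric])
  show thesis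
  proof
    show "exp (V z) = \<Phi> z" if "z \<in> ann R" for z
      using L(2)[of "Ln z"] exp_S[of "Ln z"] ann0[OF that] that by (simp add: V_def)
    show "V holomorphic_on ann R"
      unfolding holomorphic_on_def
    proof
      fix z0 assume z0: "z0 \<in> ann R"
      define T where "T = {z. z \<in> ann R \<and> z / z0 \<notin> \<real>\<^sub>\<le>\<^sub>0}"
      have T: "open T"
      proof -
        have "open ((\<lambda>z. z / z0) -` (- \<real>\<^sub>\<le>\<^sub>0))"
          using ann0[OF z0] by (intro open_vimage open_Compl closed_nonpos_Reals_complex continuous_intros) auto
        moreover have "T = ann R \<inter> ((\<lambda>z. z / z0) -` (- \<real>\<^sub>\<le>\<^sub>0))" by (auto simp: T_def)
        ultimately show ?thesis using open_ann[of R] by (simp add: open_Int)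
      qed
      have e: "exp (Ln (z / z0) + Ln z0) = z" if "z \<in> T" for z
        using that ann0[OF z0] ann0[of z] by (simp add: T_def exp_add)
      have TS: "Ln (z / z0) + Ln z0 \<in> S" if "z \<in> T" for z
        using e[OF that] that exp_S[of "Ln (z / z0) + Ln z0"] by (simp add: T_def)
      have "(\<lambda>z. L (Ln (z / z0) + Ln z0)) holomorphic_on T"
        by (rule holomorphic_on_compose_gen[of "\<lambda>z. Ln (z / z0) + Ln z0" T L S, unfolded o_def])
          (use TS L(1) ann0[OF z0] in \<open>auto intro!: holomorphic_intros simp: T_def\<close>)
      then have "V holomorphic_on T"
      proof (rule holomorphic_transform)
        show "L (Ln (z / z0) + Ln z0) = V z" if "z \<in> T" for z using V[OF TS[OF that]] e[OF that] by simp
      qed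
      moreover have "z0 \<in> T" using z0 ann0[OF z0] by (simp add: T_def)
      ultimately show "V field_differentiable at z0 within ann R"
        using T holomorphic_on_imp_differentiable_at field_differentiable_at_within by blast
    qed
  qed
qed

lemma log_symbol_holomorphic_ext:
  assumes R: "1 < R" and hol: "\<Phi> holomorphic_on ann R" and nz: "\<And>z. z \<in> ann R \<Longrightarrow> \<Phi> z \<noteq> 0"
    and wn: "winding_number (\<phi> \<circ> circlepath 0 1) 0 = 0" and eq: "\<And>z. norm z = 1 \<Longrightarrow> \<Phi> z = \<phi> z"
  obtains V where "V holomorphic_on ann R" "\<And>z. norm z = 1 \<Longrightarrow> V z = log_symbol \<phi> z"
    "\<And>z. norm z = 1 \<Longrightarrow> exp (V z) = \<phi> z"
proof -
  have circ: "sphere 0 1 \<subseteq> ann R" using R by (auto simp: inverse_less_1_iff)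
  have "\<Phi> (circlepath 0 1 t) = \<phi> (circlepath 0 1 t)" for t
    by (rule eq) (simp add: circlepath norm_mult)
  then have "\<Phi> \<circ> circlepath 0 1 = \<phi> \<circ> circlepath 0 1" by (simp add: fun_eq_iff)
  then obtain W where W: "W holomorphic_on ann R" "\<And>z. z \<in> ann R \<Longrightarrow> exp (W z) = \<Phi> z"
    using holomorphic_log_annulus[OF R hol nz] wn by auto
  have contW: "continuous_on unit_circle W"
    by (rule continuous_on_subset[OF holomorphic_on_imp_continuous_on[OF W(1)] circ])
  have "\<exists>g. continuous_on unit_circle g \<and> (\<forall>z\<in>unit_circle. exp (g z) = \<phi> z)"
    using contW W(2) eq circ by (intro exI[of _ W]) (auto simp: subset_iff)
  from someI_ex[OF this]
  have g: "continuous_on unit_circle (log_symbol \<phi>)" "\<And>z. z \<in> unit_circle \<Longrightarrow> exp (log_symbol \<phi> z) = \<phi> z"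
    unfolding log_symbol_def by blast+
  obtain c where c: "\<And>z. z \<in> unit_circle \<Longrightarrow> log_symbol \<phi> z = W z + c"
    by (rule exp_eq_imp_diff_constant[of unit_circle "log_symbol \<phi>" W])
      (use g contW W(2) eq circ in \<open>auto simp: connected_sphere subset_iff\<close>)
  show thesis
    by (rule that[of "\<lambda>z. W z + c"]) (use c g W in \<open>auto intro!: holomorphic_intros\<close>)
qed

section \<open>Determinants\<close>

lemma mat_solution:
  fixes A :: "complex mat"
  assumes A: "A \<in> carrier_mat n n" and b: "b \<in> carrier_vec n" and det: "Determinant.det A \<noteq> 0"
  obtains x where "x \<in> carrier_vec n" "A *\<^sub>v x = b"
proof
  define x where "x = (1 / Determinant.det A) \<cdot>\<^sub>v (adj_mat A *\<^sub>v b)"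
  show x: "x \<in> carrier_vec n" unfolding x_def using adj_mat(1)[OF A] b by auto
  have "A *\<^sub>v (adj_mat A *\<^sub>v b) = (Determinant.det A \<cdot>\<^sub>m 1\<^sub>m n) *\<^sub>v b"
    using adj_mat[OF A] A b by (metis assoc_mult_mat_vec)
  also have "\<dots> = Determinant.det A \<cdot>\<^sub>v b" using b by auto
  finally show "A *\<^sub>v x = b"
    unfolding x_def using adj_mat(1)[OF A] A b det
    by (subst mult_mat_vec[of _ n n]) (auto simp: smult_smult_assoc)
qed

lemma det_2x2:
  fixes A :: "complex mat"
  assumes A: "A \<in> carrier_mat 2 2"
  shows "Determinant.det A = A $$ (0, 0) * A $$ (1, 1) - A $$ (0, 1) * A $$ (1, 0)"
proof -
  have d: "Determinant.det (mat_delete A i j) = (mat_delete A i j) $$ (0, 0)" for i j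
    using mat_delete_carrier[OF A, of i j] by (intro det_single) auto
  have "Determinant.det A = (\<Sum>i<2. A $$ (i, 0) * cofactor A i 0)"
    by (rule laplace_expansion_column[OF A]) auto
  also have "\<dots> = A $$ (0, 0) * cofactor A 0 0 + A $$ (1, 0) * cofactor A 1 0"
    by (simp add: numeral_2_eq_2)
  also have "\<dots> = A $$ (0, 0) * A $$ (1, 1) - A $$ (0, 1) * A $$ (1, 0)"
    unfolding cofactor_def d using A by (simp add: mat_delete_def)
  finally show ?thesis .
qed

lemma bordered_toeplitz_det_eq:
  assumes n: "2 \<le> n" and x: "x1 \<in> carrier_vec n" "x2 \<in> carrier_vec n"
    and eq: "toep f n *\<^sub>v x1 = bvec g1 n" "toep f n *\<^sub>v x2 = bvec g2 n"
  shows "bordered_toeplitz_det f g1 g2 n = Determinant.det (toep f n) *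
    (vec_index x1 (n - 2) * vec_index x2 (n - 1) - vec_index x2 (n - 2) * vec_index x1 (n - 1))"
proof -
  define X where "X = four_block_mat (1\<^sub>m (n - 2)) (Matrix.mat (n - 2) 2 (\<lambda>(i, k). vec_index (if k = 0 then x1 else x2) i))
    (0\<^sub>m 2 (n - 2)) (Matrix.mat 2 2 (\<lambda>(i, k). vec_index (if k = 0 then x1 else x2) (n - 2 + i)))"
  have X_eq: "X = Matrix.mat n n (\<lambda>(i, k). if k < n - 2 then (if i = k then 1 else 0)
      else vec_index (if k = n - 2 then x1 else x2) i)"
    unfolding X_def using n by (intro eq_matI) auto
  have detX: "Determinant.det X = vec_index x1 (n - 2) * vec_index x2 (n - 1) - vec_index x2 (n - 2) * vec_index x1 (n - 1)"
  proof -
    have "Suc (n - 2) = n - 1" using n by simp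
    then show ?thesis unfolding X_def
      by (subst det_four_block_mat_lower_left_zero[of _ "n - 2" _ 2]) (auto simp: det_2x2)
  qed
  have "bordered_toeplitz_matrix f g1 g2 n = toep f n * X"
  proof (rule eq_matI)
    fix j k assume "j < dim_row (toep f n * X)" "k < dim_col (toep f n * X)"
    then have jk: "j < n" "k < n" by (auto simp: toep_def X_eq)
    have prod: "(toep f n * X) $$ (j, k) = (\<Sum>i = 0..<n. fc f (int i - int j) * X $$ (i, k))"
      using jk by (simp add: toep_def X_eq scalar_prod_def)
    have vec: "(\<Sum>i = 0..<n. fc f (int i - int j) * vec_index x i) = fc g (int n - 1 - int j)"
      if "x \<in> carrier_vec n" "toep f n *\<^sub>v x = bvec g n" for x g
    proof -
      have "(\<Sum>i = 0..<n. fc f (int i - int j) * vec_index x i) = vec_index (toep f n *\<^sub>v x) j"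
        using jk that(1) by (simp add: toep_def scalar_prod_def)
      then show ?thesis using that(2) jk by (simp add: bvec_def)
    qed
    consider "k < n - 2" | "k = n - 2" | "k = n - 1" "k \<noteq> n - 2" using jk by linarith
    then show "bordered_toeplitz_matrix f g1 g2 n $$ (j, k) = (toep f n * X) $$ (j, k)"
    proof cases
      case 1
      have "(\<Sum>i = 0..<n. fc f (int i - int j) * X $$ (i, k)) = (\<Sum>i = 0..<n. if i = k then fc f (int i - int j) else 0)"
        using 1 jk by (intro sum.cong) (auto simp: X_eq)
      then show ?thesis unfolding prod using 1 jk by (simp add: bordered_toeplitz_matrix_def)
    next
      case 2
      have "(\<Sum>i = 0..<n. fc f (int i - int j) * X $$ (i, k)) = (\<Sum>i = 0..<n. fc f (int i - int j) * vec_index x1 i)"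
        using 2 jk by (intro sum.cong) (auto simp: X_eq)
      then show ?thesis unfolding prod using 2 jk vec[OF x(1) eq(1)] by (simp add: bordered_toeplitz_matrix_def)
    next
      case 3
      have "(\<Sum>i = 0..<n. fc f (int i - int j) * X $$ (i, k)) = (\<Sum>i = 0..<n. fc f (int i - int j) * vec_index x2 i)"
        using 3 jk n by (intro sum.cong) (auto simp: X_eq)
      moreover have "\<not> n - 1 < n - 2" by linarith
      ultimately show ?thesis unfolding prod using 3 jk n vec[OF x(2) eq(2)] by (simp add: bordered_toeplitz_matrix_def)
    qed
  qed (auto simp: bordered_toeplitz_matrix_def toep_def X_eq)
  moreover have "X \<in> carrier_mat n n" by (simp add: X_eq)
  ultimately show ?thesis
    unfolding bordered_toeplitz_det_def using det_mult[OF toep_carrier, of X] detX by simp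
qed

lemma det_has_field_derivative:
  fixes a :: "complex \<Rightarrow> nat \<Rightarrow> nat \<Rightarrow> complex"
  assumes a: "\<And>i k. i < n \<Longrightarrow> k < n \<Longrightarrow> ((\<lambda>t. a t i k) has_field_derivative a' i k) (at t0)"
  shows "((\<lambda>t. Determinant.det (Matrix.mat n n (\<lambda>(i, k). a t i k))) has_field_derivative
    (\<Sum>c<n. Determinant.det (Matrix.mat n n (\<lambda>(i, k). if k = c then a' i k else a t0 i k)))) (at t0)"
proof -
  let ?P = "{\<pi>. \<pi> permutes {0..<n}}"
  have det: "Determinant.det (Matrix.mat n n (\<lambda>(i, k). f i k)) = (\<Sum>\<pi>\<in>?P. signof \<pi> * (\<Prod>i = 0..<n. f i (\<pi> i)))"
    for f :: "nat \<Rightarrow> nat \<Rightarrow> complex"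
    by (subst det_def') (auto intro!: sum.cong prod.cong dest: permutes_in_image)
  have "((\<lambda>t. \<Sum>\<pi>\<in>?P. signof \<pi> * (\<Prod>i = 0..<n. a t i (\<pi> i))) has_field_derivative
     (\<Sum>\<pi>\<in>?P. signof \<pi> * (\<Sum>i = 0..<n. a' i (\<pi> i) * (\<Prod>j\<in>{0..<n} - {i}. a t0 j (\<pi> j))))) (at t0)"
  proof (intro DERIV_sum DERIV_cmult has_field_derivative_prod)
    fix \<pi> i assume "\<pi> \<in> ?P" "i \<in> {0..<n}"
    then show "((\<lambda>t. a t i (\<pi> i)) has_field_derivative a' i (\<pi> i)) (at t0)"
      by (intro a) (auto dest: permutes_in_image[of \<pi> _ i])
  qed
  also have "(\<Sum>\<pi>\<in>?P. signof \<pi> * (\<Sum>i = 0..<n. a' i (\<pi> i) * (\<Prod>j\<in>{0..<n} - {i}. a t0 j (\<pi> j))))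
     = (\<Sum>\<pi>\<in>?P. \<Sum>c = 0..<n. signof \<pi> * (\<Prod>j = 0..<n. if \<pi> j = c then a' j (\<pi> j) else a t0 j (\<pi> j)))"
  proof (rule sum.cong[OF refl])
    fix \<pi> assume "\<pi> \<in> ?P"
    then have p: "\<pi> permutes {0..<n}" by simp
    have "a' i (\<pi> i) * (\<Prod>j\<in>{0..<n} - {i}. a t0 j (\<pi> j)) = (\<Prod>j = 0..<n. if \<pi> j = \<pi> i then a' j (\<pi> j) else a t0 j (\<pi> j))"
      if i: "i \<in> {0..<n}" for i
    proof -
      have "(\<Prod>j = 0..<n. if \<pi> j = \<pi> i then a' j (\<pi> j) else a t0 j (\<pi> j))
        = (\<Prod>j = 0..<n. if j = i then a' j (\<pi> j) else a t0 j (\<pi> j))"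
        using permutes_inj[OF p] by (intro prod.cong) (auto dest: injD)
      also have "\<dots> = a' i (\<pi> i) * (\<Prod>j\<in>{0..<n} - {i}. if j = i then a' j (\<pi> j) else a t0 j (\<pi> j))"
        using i by (subst prod.remove[of _ i]) auto
      also have "(\<Prod>j\<in>{0..<n} - {i}. if j = i then a' j (\<pi> j) else a t0 j (\<pi> j)) = (\<Prod>j\<in>{0..<n} - {i}. a t0 j (\<pi> j))"
        by (intro prod.cong) auto
      finally show ?thesis by simp
    qed
    then have "(\<Sum>i = 0..<n. a' i (\<pi> i) * (\<Prod>j\<in>{0..<n} - {i}. a t0 j (\<pi> j)))
      = (\<Sum>i = 0..<n. (\<lambda>c. \<Prod>j = 0..<n. if \<pi> j = c then a' j (\<pi> j) else a t0 j (\<pi> j)) (\<pi> i))"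
      by (intro sum.cong) auto
    also have "\<dots> = (\<Sum>c = 0..<n. \<Prod>j = 0..<n. if \<pi> j = c then a' j (\<pi> j) else a t0 j (\<pi> j))"
      using sum.permute[OF p, of "\<lambda>c. \<Prod>j = 0..<n. if \<pi> j = c then a' j (\<pi> j) else a t0 j (\<pi> j)"] by (simp add: o_def)
    finally show "signof \<pi> * (\<Sum>i = 0..<n. a' i (\<pi> i) * (\<Prod>j\<in>{0..<n} - {i}. a t0 j (\<pi> j)))
      = (\<Sum>c = 0..<n. signof \<pi> * (\<Prod>j = 0..<n. if \<pi> j = c then a' j (\<pi> j) else a t0 j (\<pi> j)))"
      by (simp add: sum_distrib_left)
  qed
  also have "\<dots> = (\<Sum>c<n. \<Sum>\<pi>\<in>?P. signof \<pi> * (\<Prod>j = 0..<n. if \<pi> j = c then a' j (\<pi> j) else a t0 j (\<pi> j)))"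
    by (subst sum.swap) (simp add: atLeast0LessThan)
  finally show ?thesis unfolding det .
qed

lemma fc_exp_has_field_derivative:
  assumes f: "continuous_on unit_circle f" and u: "continuous_on unit_circle u"
  shows "((\<lambda>t. fc (\<lambda>z. f z * exp (t * u z)) j) has_field_derivative
    fc (\<lambda>z. u z * (f z * exp (t0 * u z))) j) (at t0)"
proof -
  define w where "w = (\<lambda>x. circlepath 0 1 x :: complex)"
  have w: "norm (w x) = 1" "w x \<noteq> 0" for x by (auto simp: w_def circlepath norm_mult)
  have cw: "continuous_on A w" for A unfolding w_def circlepath by (intro continuous_intros)
  have eq: "fc h j = integral (cbox 0 1) (\<lambda>x. h (w x) * w x powi (- j))" for h
  proof -
    have "fc h j = integral (cbox 0 1) (\<lambda>x. h (w x) * w x powi (- j) / (2 * of_real pi * \<i> * w x)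
        * vector_derivative (circlepath 0 1) (at x))"
      unfolding fourier_coeff_def contour_integral_integral w_def by simp
    also have "\<dots> = integral (cbox 0 1) (\<lambda>x. h (w x) * w x powi (- j))"
    proof (rule integral_cong)
      fix x :: real assume x: "x \<in> cbox 0 1"
      have "vector_derivative (circlepath 0 1) (at x) = 2 * of_real pi * \<i> * w x"
        unfolding vector_derivative_circlepath by (simp add: w_def circlepath)
      then show "h (w x) * w x powi (- j) / (2 * of_real pi * \<i> * w x) * vector_derivative (circlepath 0 1) (at x)
         = h (w x) * w x powi (- j)" using w[of x] by simp
    qed
    finally show ?thesis .
  qed
  have cf: "continuous_on A (\<lambda>x. f (w x))" and cu: "continuous_on A (\<lambda>x. u (w x))" for A
    by (rule continuous_on_compose2[OF f cw], use w in force) (rule continuous_on_compose2[OF u cw], use w in force)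
  have cp: "continuous_on A (\<lambda>x. w x powi (- j))" for A
    using w by (intro continuous_intros cw) auto
  show ?thesis unfolding eq
  proof (rule leibniz_rule_field_derivative[where U = UNIV and fx = "\<lambda>t x. u (w x) * (f (w x) * exp (t * u (w x))) * w x powi (- j)"])
    show "((\<lambda>t. f (w x) * exp (t * u (w x)) * w x powi - j) has_field_derivative
       u (w x) * (f (w x) * exp (t * u (w x))) * w x powi - j) (at t)" for t x
      by (auto intro!: derivative_eq_intros simp: algebra_simps)
    show "(\<lambda>x. f (w x) * exp (t * u (w x)) * w x powi - j) integrable_on cbox 0 1" for t
      by (intro integrable_continuous continuous_intros cf cu cp)
    have snd': "continuous_on A (\<lambda>p::complex \<times> real. g (snd p))" if "continuous_on UNIV g" for A and g :: "real \<Rightarrow> complex"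
      by (rule continuous_on_compose2[OF that]) (auto intro: continuous_intros)
    show "continuous_on (UNIV \<times> cbox 0 1) (\<lambda>(t, x). u (w x) * (f (w x) * exp (t * u (w x))) * w x powi - j)"
      unfolding split_def by (intro continuous_intros snd'[OF cf] snd'[OF cu] snd'[OF cp])
  qed auto
qed

lemma fc_mult_nonneg:
  assumes f: "wsupp f {0..}" and g: "wsupp g {0..}"
  shows "fc (\<lambda>z. f z * g z) (int k) = (\<Sum>i\<le>k. fc f (int i) * fc g (int k - int i))"
proof -
  have "((\<lambda>j. fc f j * fc g (int k - j)) has_sum fc (\<lambda>z. f z * g z) (int k)) UNIV"
    by (rule fc_mult[OF wsuppD(1)[OF f] wsuppD(1)[OF g]])
  moreover have "((\<lambda>j. fc f j * fc g (int k - j)) has_sum (\<Sum>j\<in>{0..int k}. fc f j * fc g (int k - j))) UNIV"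
    by (rule has_sum_finite_neutralI) (use wsuppD(2)[OF f] wsuppD(2)[OF g] in auto)
  moreover have "(\<Sum>j\<in>{0..int k}. fc f j * fc g (int k - j)) = (\<Sum>i\<le>k. fc f (int i) * fc g (int k - int i))"
    by (rule sum.reindex_bij_witness[where i = int and j = nat]) auto
  ultimately show ?thesis by (metis has_sum_unique)
qed

section \<open>Bordered determinants relative to Toeplitz determinants\<close>

locale szego_factors =
  fixes R s \<rho> B :: real and Vp Vm :: "complex \<Rightarrow> complex"
  assumes s: "1 < s" "s < R" and \<rho>: "1 < \<rho>" "\<rho> < s^2"
    and Vp: "Vp holomorphic_on ball 0 R" and Vm: "Vm holomorphic_on ball 0 R" and Vm0: "Vm 0 = 0"
    and VpB: "\<And>z. norm z \<le> s \<Longrightarrow> norm (Vp z) \<le> B" and VmB: "\<And>z. norm z \<le> s \<Longrightarrow> norm (Vm z) \<le> B"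
begin

text \<open>The factor \<open>m t\<close> runs from \<open>1\<close> at \<open>t = 0\<close> to the factor of the symbol at \<open>t = 1\<close>. The
  functions \<open>q\<close> and \<open>l t\<close> are the inverses of \<open>p\<close> and \<open>m t\<close>.\<close>

definition p :: "complex \<Rightarrow> complex" where "p z = exp (Vp z)"
definition q :: "complex \<Rightarrow> complex" where "q z = exp (- Vp z)"
definition m :: "complex \<Rightarrow> complex \<Rightarrow> complex" where "m t z = exp (t * Vm (1 / z))"
definition l :: "complex \<Rightarrow> complex \<Rightarrow> complex" where "l t z = exp (- t * Vm (1 / z))"

definition T :: real where "T = s / (s - 1)"
definition K :: real where "K = exp B * ((s + 1) / (s - 1))"
definition e :: "nat \<Rightarrow> real" where "e n = exp B * s powi (- int n) * T"
definition small :: "nat \<Rightarrow> bool" where "small n \<longleftrightarrow> K^2 * (e n)^2 \<le> 1 / 2"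

lemma R: "1 < R" using s by simp

lemma T_pos: "0 < T" and K_pos: "0 < K" and e_nonneg: "0 \<le> e n"
  using s by (auto simp: T_def K_def e_def)

lemma B_nonneg: "0 \<le> B"
  using VpB[of 0] s order_trans[OF norm_ge_zero] by simp

lemma norm_exp_mult_le:
  assumes "norm (t::complex) \<le> 1" "norm w \<le> B"
  shows "norm (exp (t * w)) \<le> exp B"
proof -
  have "norm (t * w) \<le> 1 * B" unfolding norm_mult using assms by (intro mult_mono) auto
  then have "exp (norm (t * w)) \<le> exp B" by simp
  with norm_exp[of "t * w"] show ?thesis by (rule order_trans)
qed

lemma
  shows decay_p: "decay (exp B) s p" and wsupp_p: "wsupp p {0..}"
    and decay_q: "decay (exp B) s q" and wsupp_q: "wsupp q {0..}"
proof -
  have hol: "p holomorphic_on ball 0 R" "q holomorphic_on ball 0 R"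
    unfolding p_def q_def by (intro holomorphic_intros Vp)+
  have bound: "norm (p z) \<le> exp B" "norm (q z) \<le> exp B" if "norm z \<le> s" for z
    using norm_exp_mult_le[of 1, OF _ VpB[OF that]] norm_exp_mult_le[of "-1", OF _ VpB[OF that]]
    by (auto simp: p_def q_def)
  show "decay (exp B) s p" by (rule decay_holomorphic_ball[OF hol(1) s bound(1)])
  show "wsupp p {0..}" by (rule wsupp_holomorphic_ball[OF hol(1) s bound(1)])
  show "decay (exp B) s q" by (rule decay_holomorphic_ball[OF hol(2) s bound(2)])
  show "wsupp q {0..}" by (rule wsupp_holomorphic_ball[OF hol(2) s bound(2)])
qed

lemma
  assumes t: "norm t \<le> 1"
  shows decay_m: "decay (exp B) s (m t)" and wsupp_m: "wsupp (m t) {..0}"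
    and decay_l: "decay (exp B) s (l t)" and wsupp_l: "wsupp (l t) {..0}"
proof -
  have *: "(\<lambda>z. exp (c * Vm z)) holomorphic_on ball 0 R" for c
    by (intro holomorphic_intros Vm)
  have **: "norm (exp (c * Vm z)) \<le> exp B" if "norm z \<le> s" "norm c \<le> 1" for z c
    using norm_exp_mult_le[OF that(2) VmB[OF that(1)]] .
  have t': "norm (- t) \<le> 1" using t by simp
  show "decay (exp B) s (m t)" unfolding m_def by (rule decay_reflect_ball[OF * s **[OF _ t]])
  show "wsupp (m t) {..0}" unfolding m_def by (rule wsupp_reflect_ball[OF * s **[OF _ t]])
  show "decay (exp B) s (l t)" unfolding l_def by (rule decay_reflect_ball[OF * s **[OF _ t']])
  show "wsupp (l t) {..0}" unfolding l_def by (rule wsupp_reflect_ball[OF * s **[OF _ t']])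
qed

lemma pq: "p z * q z = 1" and ml: "m t z * l t z = 1"
  by (simp_all add: p_def q_def m_def l_def exp_minus)

lemma wh:
  assumes t: "norm t \<le> 1"
  shows "wh_factors p q (m t) (l t) K"
  using decay_wnorm_le[OF decay_p s(1)] decay_wnorm_le[OF decay_q s(1)]
    decay_wnorm_le[OF decay_m[OF t] s(1)] decay_wnorm_le[OF decay_l[OF t] s(1)]
    wsupp_p wsupp_q wsupp_m[OF t] wsupp_l[OF t] pq ml
  by (auto simp: wh_factors_def K_def wsupp_def)

lemma wnorm_le_K:
  assumes "norm t \<le> 1"
  shows "wnorm p \<le> K" "wnorm q \<le> K" "wnorm (m t) \<le> K" "wnorm (l t) \<le> K"
    "wiener p" "wiener q" "wiener (m t)" "wiener (l t)"
  using wh[OF assms] by (auto simp: wh_factors_def wsupp_def)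

lemma tails:
  assumes t: "norm t \<le> 1"
  shows "wnorm (proj {int n..} q) \<le> e n" "wnorm (proj {..- int n} (l t)) \<le> e n"
  using decay_wnorm_proj_ge[OF decay_q s(1), of "int n"] decay_wnorm_proj_le[OF decay_l[OF t] s(1), of "int n"]
    wnorm_le_K[OF t] by (auto simp: e_def T_def)

lemma eventually_small: "eventually small sequentially"
proof -
  have "(\<lambda>n. inverse s ^ n) \<longlonglongrightarrow> 0"
    using LIMSEQ_inverse_realpow_zero[OF s(1)] by (simp add: power_inverse)
  then have "(\<lambda>n. K^2 * (exp B * inverse s ^ n * T)^2) \<longlonglongrightarrow> K^2 * (exp B * 0 * T)^2"
    by (intro tendsto_mult tendsto_power tendsto_const)
  then have "eventually (\<lambda>n. K^2 * (exp B * inverse s ^ n * T)^2 < 1 / 2) sequentially"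
    by (rule order_tendstoD) auto
  then show ?thesis
    by eventually_elim (simp add: small_def e_def power_int_minus power_inverse)
qed

lemma det_nonzero:
  assumes t: "norm t \<le> 1" and n: "small n"
  shows "Determinant.det (toep (\<lambda>z. p z * m t z) n) \<noteq> 0"
  using n by (intro toep_det_nonzero[OF wh[OF t] tails[OF t] e_nonneg]) (simp add: small_def)

lemma solution_estimate:
  assumes t: "norm t \<le> 1" and n: "small n"
    and y: "wsupp y {0..<int n}" and N: "wsupp N {..<0}" and M: "wsupp M {int n..}" and \<psi>: "wiener \<psi>"
    and eq: "\<And>z. norm z = 1 \<Longrightarrow> p z * m t z * y z = \<psi> z + N z + M z"
  shows "wnorm M \<le> 2 * K * (wnorm (proj {int n..} (\<lambda>z. q z * \<psi> z)) + e n * K * wnorm (proj {..<0} (\<lambda>z. l t z * \<psi> z)))"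
    and "k \<ge> 0 \<Longrightarrow> fc (\<lambda>z. p z * y z) k = fc (\<lambda>z. l t z * \<psi> z) k + fc (\<lambda>z. l t z * M z) k"
    and "j \<le> i \<Longrightarrow> norm (fc (\<lambda>z. l t z * M z) j) \<le> exp B * s powi (i - int n) * T * wnorm M"
proof -
  have e': "K^2 * (e n)^2 \<le> 1 / 2" using n by (simp add: small_def)
  show "wnorm M \<le> 2 * K * (wnorm (proj {int n..} (\<lambda>z. q z * \<psi> z)) + e n * K * wnorm (proj {..<0} (\<lambda>z. l t z * \<psi> z)))"
    by (rule finite_section(1)[OF wh[OF t] tails[OF t] e_nonneg e' y N M \<psi> eq])
  show "k \<ge> 0 \<Longrightarrow> fc (\<lambda>z. p z * y z) k = fc (\<lambda>z. l t z * \<psi> z) k + fc (\<lambda>z. l t z * M z) k"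
    by (rule finite_section(2)[OF wh[OF t] tails[OF t] e_nonneg e' y N M \<psi> eq])
  assume ji: "j \<le> i"
  have lw: "wiener (l t)" and Mw: "wiener M" using wnorm_le_K[OF t] wsuppD(1)[OF M] by auto
  have "norm (fc (\<lambda>z. l t z * M z) j) = norm (fc (proj {..i} (\<lambda>z. l t z * M z)) j)"
    using ji by (simp add: fc_proj wiener_mult lw Mw)
  also have "\<dots> \<le> wnorm (proj {..i} (\<lambda>z. l t z * M z))"
    by (intro norm_fc_le_wnorm wiener_proj wiener_mult lw Mw)
  also have "\<dots> \<le> wnorm (proj {..- (int n - i)} (l t)) * wnorm M"
    by (rule wnorm_proj_mult_le[OF lw M]) auto
  also have "\<dots> \<le> exp B * s powi (- (int n - i)) * T * wnorm M"
    using decay_wnorm_proj_le[OF decay_l[OF t] s(1) lw, of "int n - i"]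
    by (intro mult_right_mono wnorm_nonneg) (simp add: T_def)
  finally show "norm (fc (\<lambda>z. l t z * M z) j) \<le> exp B * s powi (i - int n) * T * wnorm M" by simp
qed

lemma bordered_coeff:
  assumes \<psi>: "wiener \<psi>" and dec: "decay D s (\<lambda>z. q z * \<psi> z)"
  shows "\<exists>C. \<forall>n x k. small n \<longrightarrow> x \<in> carrier_vec n \<longrightarrow> toep (\<lambda>z. p z * m 1 z) n *\<^sub>v x = bvec \<psi> n \<longrightarrow> k \<in> {0, 1} \<longrightarrow>
     norm (fc (\<lambda>z. p z * vpoly n x z) k - fc (\<lambda>z. l 1 z * \<psi> z) k) \<le> C * s powi (- 2 * int n)"
proof (intro exI allI impI)
  fix n x and k :: int
  assume n: "small n" and x: "x \<in> carrier_vec n" and eq: "toep (\<lambda>z. p z * m 1 z) n *\<^sub>v x = bvec \<psi> n"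
    and k: "k \<in> {0, 1}"
  have t: "norm (1::complex) \<le> 1" by simp
  note w = wnorm_le_K[OF t]
  obtain N M where NM: "wsupp N {..<0}" "wsupp M {int n..}"
    "\<And>z. norm z = 1 \<Longrightarrow> p z * m 1 z * vpoly n x z = \<psi> z + N z + M z"
    by (rule toep_solution[OF wiener_mult[OF w(5,7)] \<psi> x eq]) blast
  note est = solution_estimate[OF t n wsupp_vpoly NM(1,2) \<psi> NM(3)]
  have b: "wnorm (proj {int n..} (\<lambda>z. q z * \<psi> z)) \<le> D * s powi (- int n) * T"
    unfolding T_def by (rule decay_wnorm_proj_ge[OF dec s(1) wiener_mult[OF w(6) \<psi>]])
  have "wnorm (proj {..<0} (\<lambda>z. l 1 z * \<psi> z)) \<le> wnorm (\<lambda>z. l 1 z * \<psi> z)"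
    by (intro wnorm_proj_le wiener_mult w \<psi>)
  also have "\<dots> \<le> wnorm (l 1) * wnorm \<psi>" by (intro wnorm_mult w \<psi>)
  also have "\<dots> \<le> K * wnorm \<psi>" using w by (intro mult_right_mono wnorm_nonneg)
  finally have a: "wnorm (proj {..<0} (\<lambda>z. l 1 z * \<psi> z)) \<le> K * wnorm \<psi>" .
  have "wnorm M \<le> 2 * K * (wnorm (proj {int n..} (\<lambda>z. q z * \<psi> z)) + e n * K * wnorm (proj {..<0} (\<lambda>z. l 1 z * \<psi> z)))"
    by (rule est(1))
  also have "\<dots> \<le> 2 * K * (D * s powi (- int n) * T + e n * K * (K * wnorm \<psi>))"
    using K_pos e_nonneg by (intro mult_left_mono add_mono a b) auto
  also have "\<dots> = 2 * K * (D * T + exp B * T * K * (K * wnorm \<psi>)) * s powi (- int n)"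
    by (simp add: e_def algebra_simps)
  finally have M: "wnorm M \<le> 2 * K * (D * T + exp B * T * K * (K * wnorm \<psi>)) * s powi (- int n)" .
  have s0: "s \<noteq> 0" using s by simp
  have "norm (fc (\<lambda>z. p z * vpoly n x z) k - fc (\<lambda>z. l 1 z * \<psi> z) k) = norm (fc (\<lambda>z. l 1 z * M z) k)"
    using est(2)[of k] k by auto
  also have "\<dots> \<le> exp B * s powi (1 - int n) * T * wnorm M"
    by (rule est(3)) (use k in auto)
  also have "\<dots> \<le> exp B * s powi (1 - int n) * T * (2 * K * (D * T + exp B * T * K * (K * wnorm \<psi>)) * s powi (- int n))"
    using s T_pos by (intro mult_left_mono M) auto
  also have "\<dots> = exp B * s * T * (2 * K * (D * T + exp B * T * K * (K * wnorm \<psi>))) * (s powi (- int n) * s powi (- int n))"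
    using s0 by (simp add: power_int_diff power_int_minus field_simps)
  also have "s powi (- int n) * s powi (- int n) = s powi (- 2 * int n)"
    using s0 by (simp add: power_int_add[symmetric])
  finally show "norm (fc (\<lambda>z. p z * vpoly n x z) k - fc (\<lambda>z. l 1 z * \<psi> z) k)
    \<le> (exp B * s * T * (2 * K * (D * T + exp B * T * K * (K * wnorm \<psi>)))) * s powi (- 2 * int n)" .
qed

definition limit_det :: "(complex \<Rightarrow> complex) \<Rightarrow> (complex \<Rightarrow> complex) \<Rightarrow> complex" where
  "limit_det \<psi>1 \<psi>2 = fc (\<lambda>z. l 1 z * \<psi>2 z) 0 * fc (\<lambda>z. l 1 z * \<psi>1 z) 1
     - fc (\<lambda>z. l 1 z * \<psi>1 z) 0 * fc (\<lambda>z. l 1 z * \<psi>2 z) 1"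

lemma det_perturb:
  fixes a b c d a' b' c' d' :: complex
  assumes "norm (a' - a) \<le> \<epsilon>" "norm (b' - b) \<le> \<epsilon>" "norm (c' - c) \<le> \<epsilon>" "norm (d' - d) \<le> \<epsilon>" "\<epsilon> \<le> C"
  shows "norm ((a' * d' - b' * c') - (a * d - b * c)) \<le> \<epsilon> * (norm a + norm b + norm c + norm d + 2 * C)"
proof -
  have e: "0 \<le> \<epsilon>" using assms(1) norm_ge_zero order_trans by blast
  have "(a' * d' - b' * c') - (a * d - b * c) = ((a' - a) * d + a * (d' - d) + (a' - a) * (d' - d))
      - ((b' - b) * c + b * (c' - c) + (b' - b) * (c' - c))" by (simp add: algebra_simps)
  also have "norm \<dots> \<le> (norm ((a' - a) * d) + norm (a * (d' - d)) + norm ((a' - a) * (d' - d)))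
      + (norm ((b' - b) * c) + norm (b * (c' - c)) + norm ((b' - b) * (c' - c)))"
    by (intro order_trans[OF norm_triangle_ineq4] add_mono norm_triangle_le order_refl)
  also have "\<dots> \<le> (\<epsilon> * norm d + norm a * \<epsilon> + \<epsilon> * C) + (\<epsilon> * norm c + norm b * \<epsilon> + \<epsilon> * C)"
    unfolding norm_mult using assms e by (intro add_mono mult_mono) auto
  finally show ?thesis by (simp add: algebra_simps)
qed

lemma bordered_asymp:
  assumes \<psi>1: "wiener \<psi>1" "decay D1 s (\<lambda>z. q z * \<psi>1 z)" and \<psi>2: "wiener \<psi>2" "decay D2 s (\<lambda>z. q z * \<psi>2 z)"
  shows "\<exists>C. \<forall>n\<ge>2. small n \<longrightarrow> (\<exists>\<delta>. norm \<delta> \<le> C * s powi (- 2 * int n) \<and>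
     bordered_toeplitz_det (\<lambda>z. p z * m 1 z) \<psi>1 \<psi>2 n =
       Determinant.det (toep (\<lambda>z. p z * m 1 z) n) * (limit_det \<psi>1 \<psi>2 + \<delta>) / (fc p 0)^2)"
proof -
  obtain C1 where C1: "\<And>n x k. small n \<Longrightarrow> x \<in> carrier_vec n \<Longrightarrow> toep (\<lambda>z. p z * m 1 z) n *\<^sub>v x = bvec \<psi>1 n \<Longrightarrow> k \<in> {0, 1} \<Longrightarrow>
     norm (fc (\<lambda>z. p z * vpoly n x z) k - fc (\<lambda>z. l 1 z * \<psi>1 z) k) \<le> C1 * s powi (- 2 * int n)"
    using bordered_coeff[OF \<psi>1] by blast
  obtain C2 where C2: "\<And>n x k. small n \<Longrightarrow> x \<in> carrier_vec n \<Longrightarrow> toep (\<lambda>z. p z * m 1 z) n *\<^sub>v x = bvec \<psi>2 n \<Longrightarrow> k \<in> {0, 1} \<Longrightarrow>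
     norm (fc (\<lambda>z. p z * vpoly n x z) k - fc (\<lambda>z. l 1 z * \<psi>2 z) k) \<le> C2 * s powi (- 2 * int n)"
    using bordered_coeff[OF \<psi>2] by blast
  define C where "C = max 0 (max C1 C2)"
  define c where "c \<psi> k = fc (\<lambda>z. l 1 z * \<psi> z) k" for \<psi> k
  define C' where "C' = C * (norm (c \<psi>2 0) + norm (c \<psi>1 0) + norm (c \<psi>2 1) + norm (c \<psi>1 1) + 2 * C)"
  have p0: "fc p 0 \<noteq> 0"
  proof -
    have "fc (\<lambda>z. p z * q z) (int 0) = fc p 0 * fc q 0"
      by (subst fc_mult_nonneg[OF wsupp_p wsupp_q]) simp
    moreover have "fc (\<lambda>z. p z * q z) 0 = 1"
      using fourier_coeff_powi[of 0 0] by (simp add: pq)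
    ultimately show ?thesis by auto
  qed
  show ?thesis
  proof (intro exI[of _ C'] allI impI)
    fix n :: nat assume n2: "2 \<le> n" and n: "small n"
    have t: "norm (1::complex) \<le> 1" by simp
    have det: "Determinant.det (toep (\<lambda>z. p z * m 1 z) n) \<noteq> 0" by (rule det_nonzero[OF t n])
    obtain x1 where x1: "x1 \<in> carrier_vec n" "toep (\<lambda>z. p z * m 1 z) n *\<^sub>v x1 = bvec \<psi>1 n"
      by (rule mat_solution[OF toep_carrier bvec_carrier det])
    obtain x2 where x2: "x2 \<in> carrier_vec n" "toep (\<lambda>z. p z * m 1 z) n *\<^sub>v x2 = bvec \<psi>2 n"
      by (rule mat_solution[OF toep_carrier bvec_carrier det])
    define u where "u x k = fc (\<lambda>z. p z * vpoly n x z) k" for x k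
    have u0: "u x 0 = fc p 0 * vec_index x (n - 1)"
      and u1: "u x 1 = fc p 0 * vec_index x (n - 2) + fc p 1 * vec_index x (n - 1)" for x
    proof -
      have sv: "wsupp (vpoly n x) {0..}" by (rule wsupp_mono[OF wsupp_vpoly]) auto
      have v: "fc (vpoly n x) 0 = vec_index x (n - 1)" "fc (vpoly n x) 1 = vec_index x (n - 2)"
        using fc_vpoly_index[of 0 n x] fc_vpoly_index[of 1 n x] n2 by (auto simp: numeral_2_eq_2)
      show "u x 0 = fc p 0 * vec_index x (n - 1)"
        using fc_mult_nonneg[OF wsupp_p sv, of 0] v by (simp add: u_def)
      show "u x 1 = fc p 0 * vec_index x (n - 2) + fc p 1 * vec_index x (n - 1)"
        using fc_mult_nonneg[OF wsupp_p sv, of 1] v by (simp add: u_def)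
    qed
    define \<epsilon> where "\<epsilon> = C * s powi (- 2 * int n)"
    have le: "C1 * s powi (- 2 * int n) \<le> \<epsilon>" "C2 * s powi (- 2 * int n) \<le> \<epsilon>"
      unfolding \<epsilon>_def C_def using s by (intro mult_right_mono; simp)+
    have b: "norm (u x2 0 - c \<psi>2 0) \<le> \<epsilon>" "norm (u x1 0 - c \<psi>1 0) \<le> \<epsilon>"
      "norm (u x2 1 - c \<psi>2 1) \<le> \<epsilon>" "norm (u x1 1 - c \<psi>1 1) \<le> \<epsilon>"
      unfolding u_def c_def
      using C1[OF n x1, of 0] C1[OF n x1, of 1] C2[OF n x2, of 0] C2[OF n x2, of 1] le by auto
    have "s powi (- 2 * int n) \<le> s powi 0" using s by (intro power_int_increasing) auto
    then have "\<epsilon> \<le> C" unfolding \<epsilon>_def using mult_left_mono[of "s powi (- 2 * int n)" 1 C] by (simp add: C_def)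
    define \<delta> where "\<delta> = (u x2 0 * u x1 1 - u x1 0 * u x2 1) - limit_det \<psi>1 \<psi>2"
    have "norm \<delta> \<le> \<epsilon> * (norm (c \<psi>2 0) + norm (c \<psi>1 0) + norm (c \<psi>2 1) + norm (c \<psi>1 1) + 2 * C)"
      unfolding \<delta>_def limit_det_def c_def[symmetric] by (rule det_perturb[OF b \<open>\<epsilon> \<le> C\<close>])
    then have "norm \<delta> \<le> C' * s powi (- 2 * int n)" by (simp add: C'_def \<epsilon>_def mult_ac)
    moreover have "bordered_toeplitz_det (\<lambda>z. p z * m 1 z) \<psi>1 \<psi>2 n =
       Determinant.det (toep (\<lambda>z. p z * m 1 z) n) * (limit_det \<psi>1 \<psi>2 + \<delta>) / (fc p 0)^2"
    proof -
      have "limit_det \<psi>1 \<psi>2 + \<delta> = (fc p 0)^2 * (vec_index x1 (n - 2) * vec_index x2 (n - 1) - vec_index x2 (n - 2) * vec_index x1 (n - 1))"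
        unfolding \<delta>_def u0 u1 by (simp add: algebra_simps power2_eq_square)
      then show ?thesis
        unfolding bordered_toeplitz_det_eq[OF n2 x1(1) x2(1) x1(2) x2(2)] using p0 by simp
    qed
    ultimately show "\<exists>\<delta>. norm \<delta> \<le> C' * s powi (- 2 * int n) \<and>
     bordered_toeplitz_det (\<lambda>z. p z * m 1 z) \<psi>1 \<psi>2 n =
       Determinant.det (toep (\<lambda>z. p z * m 1 z) n) * (limit_det \<psi>1 \<psi>2 + \<delta>) / (fc p 0)^2" by blast
  qed
qed

end

section \<open>The strong Szego theorem with an exponential error term\<close>

lemma gronwall_unit_segment:
  fixes f f' :: "complex \<Rightarrow> complex"
  assumes der: "\<And>t. t \<in> closed_segment 0 1 \<Longrightarrow> (f has_field_derivative f' t) (at t)"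
    and le: "\<And>t. t \<in> closed_segment 0 1 \<Longrightarrow> norm (f' t) \<le> \<epsilon> * norm (f t)" and \<epsilon>: "0 \<le> \<epsilon>" "\<epsilon> \<le> 1 / 2"
  shows "norm (f 1 - f 0) \<le> 2 * \<epsilon> * norm (f 0)"
proof -
  let ?S = "closed_segment 0 1 :: complex set"
  have cont: "continuous_on ?S (\<lambda>t. norm (f t))"
    using der by (intro continuous_on_norm DERIV_continuous_on[of _ _ f']) (auto intro: has_field_derivative_at_within)
  obtain t0 where t0: "t0 \<in> ?S" "\<And>t. t \<in> ?S \<Longrightarrow> norm (f t) \<le> norm (f t0)"
    using continuous_attains_sup[OF compact_segment _ cont] by auto
  define M where "M = norm (f t0)"
  have b: "norm (f' t) \<le> \<epsilon> * M" if "t \<in> ?S" for t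
    using le[OF that] mult_left_mono[OF t0(2)[OF that] \<epsilon>(1)] by (simp add: M_def)
  have diff: "norm (f t - f 0) \<le> \<epsilon> * M" if t: "t \<in> ?S" for t
  proof -
    have "norm (f t - f 0) \<le> (\<epsilon> * M) * norm (t - 0)"
    proof (rule field_differentiable_bound[of ?S f f'])
      show "(f has_field_derivative f' z) (at z within ?S)" if "z \<in> ?S" for z
        using der[OF that] by (rule has_field_derivative_at_within)
    qed (use b t in auto)
    also have "\<dots> \<le> (\<epsilon> * M) * 1"
      using segment_bound1[OF t] \<epsilon> by (intro mult_left_mono) (auto simp: M_def)
    finally show ?thesis by simp
  qed
  have "M \<le> norm (f 0) + \<epsilon> * M"
    using diff[OF t0(1)] norm_triangle_ineq[of "f t0 - f 0" "f 0"] by (simp add: M_def)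
  also have "\<dots> \<le> norm (f 0) + 1 / 2 * M" using \<epsilon> by (intro add_left_mono mult_right_mono) (auto simp: M_def)
  finally have "M \<le> 2 * norm (f 0)" by simp
  then have "\<epsilon> * M \<le> \<epsilon> * (2 * norm (f 0))" using \<epsilon> by (intro mult_left_mono) auto
  with diff[of 1] show ?thesis by simp
qed

lemma sum_triangle_count:
  fixes h :: "nat \<Rightarrow> complex"
  shows "(\<Sum>k<n. \<Sum>i\<le>k. h i) = (\<Sum>i<n. of_nat (n - i) * h i)"
proof (induction n)
  case (Suc n)
  have "(\<Sum>k<Suc n. \<Sum>i\<le>k. h i) = (\<Sum>i<n. of_nat (n - i) * h i) + (\<Sum>i\<le>n. h i)"
    by (simp only: sum.lessThan_Suc Suc)
  also have "\<dots> = (\<Sum>i<n. of_nat (n - i) * h i + h i) + h n"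
    by (simp add: sum.distrib lessThan_Suc_atMost[symmetric])
  also have "\<dots> = (\<Sum>i<Suc n. of_nat (Suc n - i) * h i)"
    by (simp add: Suc_diff_le algebra_simps)
  finally show ?case .
qed simp

context szego_factors
begin

definition u :: "complex \<Rightarrow> complex" where "u z = Vm (1 / z)"

definition v :: "nat \<Rightarrow> complex" where "v k = fc Vp (int k)"
definition w :: "nat \<Rightarrow> complex" where "w k = fc Vm (int k)"

lemma decay_u: "decay B s u" and wsupp_u: "wsupp u {..<0}" and fc_u: "fc u (- int k) = w k"
proof -
  have u: "u = (\<lambda>z. Vm (1 / z))" by (simp add: u_def fun_eq_iff)
  show "decay B s u" unfolding u by (rule decay_reflect_ball[OF Vm s VmB])
  have Vmw: "wiener Vm" by (rule wiener_ball[OF Vm R])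
  show fcu: "fc u (- int k) = w k" for k unfolding u w_def using fc_reflect[OF Vmw] by simp
  have "fc Vm 0 = 0"
    using fc_ball_nonneg[OF Vm R, of 0] Vm0 by (simp add: fps_expansion_def)
  then have "fc u 0 = 0" using fcu[of 0] by (simp add: w_def)
  moreover have "wsupp u {..0}" unfolding u by (rule wsupp_reflect_ball[OF Vm s VmB])
  ultimately show "wsupp u {..<0}" unfolding wsupp_def by (metis atMost_iff lessThan_iff less_le)
qed

lemma m_eq: "m t z = exp (t * u z)" by (simp add: m_def u_def)

definition r :: "nat \<Rightarrow> complex \<Rightarrow> complex" where
  "r k = proj {..<0} (\<lambda>z. u z * z powi int k)"

definition S :: "nat \<Rightarrow> complex" where
  "S k = (\<Sum>i\<le>k. fc q (int i) * fc (\<lambda>z. p z * r k z) (int k - int i))"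

lemma wiener_u_powi: "wiener (\<lambda>z. u z * z powi k)"
  using wsuppD(1)[OF wsupp_u] by (intro wiener_mult wiener_powi)

lemma wsupp_r: "wsupp (r k) {..<0}"
  unfolding r_def by (intro wsupp_proj wiener_u_powi)

lemma fc_r: "fc (r k) j = (if j < 0 then fc u (j - int k) else 0)"
  unfolding r_def using fc_powi_mult[OF wsuppD(1)[OF wsupp_u], of "int k" j]
  by (simp add: fc_proj wiener_u_powi del: power_int_of_nat)

lemma wnorm_r: "wnorm (r k) \<le> B * T * s powi (- int k)"
proof -
  have u: "wiener u" using wsupp_u by (rule wsuppD)
  have "wsupp (\<lambda>z. z powi int k) {int k}"
    using wiener_powi fourier_coeff_powi by (auto simp: wsupp_def simp del: power_int_of_nat)
  then have "wnorm (r k) \<le> wnorm (proj {..- int k} u) * wnorm (\<lambda>z. z powi int k)"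
    unfolding r_def by (rule wnorm_proj_mult_le[OF u]) auto
  also have "\<dots> = wnorm (proj {..- int k} u)" by (simp only: wnorm_powi mult_1_right)
  also have "\<dots> \<le> B * s powi (- int k) * T"
    unfolding T_def by (rule decay_wnorm_proj_le[OF decay_u s(1) u])
  finally show ?thesis by (simp add: mult_ac)
qed

text \<open>Splitting \<open>u z\<^sup>k\<close> into a polynomial part \<open>h\<close> and \<open>r k\<close>, the polynomial part is itself a solution and
  has no \<open>k\<close>-th coefficient. For the rest, \<open>q \<psi> = m r\<close> has no powers \<open>\<ge> n\<close>, so that \<open>M\<close> is already small;
  the further factors \<open>s\<^sup>k\<^sup>-\<^sup>n\<close> and \<open>s\<^sup>-\<^sup>k\<close> come from \<open>l\<close> and \<open>r k\<close>.\<close>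

lemma trace_coeff:
  "\<exists>C\<ge>0. \<forall>t n k x. norm t \<le> 1 \<longrightarrow> small n \<longrightarrow> k < n \<longrightarrow> x \<in> carrier_vec n \<longrightarrow>
     toep (\<lambda>z. p z * m t z) n *\<^sub>v x = bvec (\<lambda>z. u z * (p z * m t z) * z powi int k) n \<longrightarrow>
     norm (fc (vpoly n x) (int k) - S k) \<le> C * s powi (- 2 * int n)"
proof (intro exI conjI allI impI)
  let ?C = "K * (exp B * T * (2 * K * (exp B * T * K * (K * (B * T)))))"
  show "0 \<le> ?C" using K_pos T_pos B_nonneg by simp
  fix t n k x
  assume t: "norm (t::complex) \<le> 1" and n: "small n" and k: "k < n" and x: "x \<in> carrier_vec n"
    and eq: "toep (\<lambda>z. p z * m t z) n *\<^sub>v x = bvec (\<lambda>z. u z * (p z * m t z) * z powi int k) n"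
  note W = wnorm_le_K[OF t]
  have uw: "wiener u" and rw: "wiener (r k)" using wsupp_u wsupp_r by (auto intro: wsuppD)
  define h where "h = proj {0..} (\<lambda>z. u z * z powi int k)"
  have hw: "wiener h" unfolding h_def by (intro wiener_proj wiener_u_powi)
  have fc_h: "fc h j = (if 0 \<le> j then fc u (j - int k) else 0)" for j
    unfolding h_def using fc_powi_mult[OF uw, of "int k" j]
    by (simp add: fc_proj wiener_u_powi del: power_int_of_nat)
  have h: "wsupp h {0..<int k}"
    using hw fc_h wsuppD(2)[OF wsupp_u] by (auto simp: wsupp_def)
  have split: "u z * z powi int k = h z + r k z" if z: "norm z = 1" for z
  proof (rule wiener_eqI[OF wiener_u_powi wiener_add[OF hw rw] _ z])
    fix j show "fc (\<lambda>z. u z * z powi int k) j = fc (\<lambda>z. h z + r k z) j"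
      unfolding fc_add[OF hw rw] fc_h fc_r fc_powi_mult[OF uw] by simp
  qed
  have \<psi>w: "wiener (\<lambda>z. u z * (p z * m t z) * z powi int k)"
    by (intro wiener_mult wiener_powi uw W)
  obtain N M where NM: "wsupp N {..<0}" "wsupp M {int n..}"
    "\<And>z. norm z = 1 \<Longrightarrow> p z * m t z * vpoly n x z = u z * (p z * m t z) * z powi int k + N z + M z"
    by (rule toep_solution[OF wiener_mult[OF W(5,7)] \<psi>w x eq]) blast
  define y where "y = (\<lambda>z. vpoly n x z - h z)"
  have y: "wsupp y {0..<int n}"
    unfolding y_def by (intro wsupp_diff wsupp_vpoly wsupp_mono[OF h]) (use k in auto)
  define \<psi> where "\<psi> = (\<lambda>z. p z * m t z * r k z)"
  have \<psi>: "wiener \<psi>" unfolding \<psi>_def by (intro wiener_mult W rw)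
  have yeq: "p z * m t z * y z = \<psi> z + N z + M z" if z: "norm z = 1" for z
  proof -
    have "p z * m t z * vpoly n x z = p z * m t z * (u z * z powi int k) + N z + M z"
      unfolding NM(3)[OF z] by (simp only: mult_ac)
    then have "p z * m t z * y z = p z * m t z * (u z * z powi int k) + N z + M z - p z * m t z * h z"
      unfolding y_def by (simp only: right_diff_distrib)
    also have "\<dots> = \<psi> z + N z + M z" unfolding split[OF z] \<psi>_def by (simp add: algebra_simps)
    finally show ?thesis .
  qed
  note est = solution_estimate[OF t n y NM(1,2) \<psi> yeq]
  have q\<psi>: "q z * \<psi> z = m t z * r k z" and l\<psi>: "l t z * \<psi> z = p z * r k z" for z
  proof -
    have "q z * \<psi> z = (p z * q z) * (m t z * r k z)" by (simp only: \<psi>_def mult_ac)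
    then show "q z * \<psi> z = m t z * r k z" by (simp add: pq)
    have "l t z * \<psi> z = (m t z * l t z) * (p z * r k z)" by (simp only: \<psi>_def mult_ac)
    then show "l t z * \<psi> z = p z * r k z" by (simp add: ml)
  qed
  have mr: "wsupp (\<lambda>z. m t z * r k z) {..<0}" by (rule wsupp_mult[OF wsupp_m[OF t] wsupp_r]) auto
  have "wnorm (proj {int n..} (\<lambda>z. m t z * r k z)) = 0"
    unfolding wnorm_def using wsuppD[OF mr] by (simp add: fc_proj infsum_0)
  then have b: "wnorm (proj {int n..} (\<lambda>z. q z * \<psi> z)) = 0" by (simp only: q\<psi>)
  have "wnorm (proj {..<0} (\<lambda>z. l t z * \<psi> z)) \<le> wnorm (\<lambda>z. p z * r k z)"
    unfolding l\<psi> by (intro wnorm_proj_le wiener_mult W rw)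
  also have "\<dots> \<le> wnorm p * wnorm (r k)" by (intro wnorm_mult W rw)
  also have "\<dots> \<le> K * (B * T * s powi (- int k))"
    using W K_pos by (intro mult_mono wnorm_r wnorm_nonneg) auto
  finally have a: "wnorm (proj {..<0} (\<lambda>z. l t z * \<psi> z)) \<le> K * (B * T * s powi (- int k))" .
  have "wnorm M \<le> 2 * K * (e n * K * wnorm (proj {..<0} (\<lambda>z. l t z * \<psi> z)))"
    using est(1) unfolding b by simp
  also have "\<dots> \<le> 2 * K * (e n * K * (K * (B * T * s powi (- int k))))"
    using K_pos e_nonneg by (intro mult_left_mono a) auto
  finally have M: "wnorm M \<le> 2 * K * (e n * K * (K * (B * T * s powi (- int k))))" .
  define D where "D = exp B * s powi (int k - int n) * T * wnorm M"
  have D: "norm (fc (\<lambda>z. l t z * M z) j) \<le> D" if "j \<le> int k" for j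
    unfolding D_def by (rule est(3)[OF _ that])
  have s0: "s \<noteq> 0" using s by simp
  have D_le: "D \<le> exp B * T * (2 * K * (exp B * T * K * (K * (B * T)))) * s powi (- 2 * int n)"
  proof -
    have "D \<le> exp B * s powi (int k - int n) * T * (2 * K * (e n * K * (K * (B * T * s powi (- int k)))))"
      unfolding D_def using s T_pos by (intro mult_left_mono M) auto
    also have "\<dots> = exp B * T * (2 * K * (exp B * T * K * (K * (B * T)))) * (s powi (int k - int n) * s powi (- int n) * s powi (- int k))"
      by (simp add: e_def mult_ac)
    also have "s powi (int k - int n) * s powi (- int n) * s powi (- int k) = s powi (- 2 * int n)"
      using s0 by (simp add: power_int_add[symmetric])
    finally show ?thesis .
  qed
  have pyw: "wsupp (\<lambda>z. p z * y z) {0..}" by (rule wsupp_mult[OF wsupp_p y]) auto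
  have "q z * (p z * y z) = y z" for z
  proof -
    have "q z * (p z * y z) = (p z * q z) * y z" by (simp only: mult_ac)
    then show ?thesis by (simp add: pq)
  qed
  then have "fc y (int k) = fc (\<lambda>z. q z * (p z * y z)) (int k)" by (simp only:)
  also have "\<dots> = (\<Sum>i\<le>k. fc q (int i) * fc (\<lambda>z. p z * y z) (int k - int i))"
    by (rule fc_mult_nonneg[OF wsupp_q pyw])
  also have "\<dots> = (\<Sum>i\<le>k. fc q (int i) * (fc (\<lambda>z. p z * r k z) (int k - int i) + fc (\<lambda>z. l t z * M z) (int k - int i)))"
  proof (rule sum.cong[OF refl])
    fix i assume "i \<in> {..k}"
    then have "0 \<le> int k - int i" by simp
    from est(2)[OF _ this] show "fc q (int i) * fc (\<lambda>z. p z * y z) (int k - int i)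
      = fc q (int i) * (fc (\<lambda>z. p z * r k z) (int k - int i) + fc (\<lambda>z. l t z * M z) (int k - int i))"
      unfolding l\<psi> by simp
  qed
  also have "\<dots> = S k + (\<Sum>i\<le>k. fc q (int i) * fc (\<lambda>z. l t z * M z) (int k - int i))"
    by (simp add: S_def distrib_left sum.distrib)
  finally have fy: "fc y (int k) = S k + (\<Sum>i\<le>k. fc q (int i) * fc (\<lambda>z. l t z * M z) (int k - int i))" .
  have "fc (vpoly n x) (int k) = fc y (int k)"
    unfolding y_def using fc_diff[OF wiener_vpoly hw, of n x "int k"] wsuppD(2)[OF h, of "int k"] by simp
  then have "norm (fc (vpoly n x) (int k) - S k) = norm (\<Sum>i\<le>k. fc q (int i) * fc (\<lambda>z. l t z * M z) (int k - int i))"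
    using fy by simp
  also have "\<dots> \<le> (\<Sum>i\<le>k. norm (fc q (int i)) * D)"
    unfolding norm_mult[symmetric] using D by (intro sum_norm_le) (auto simp: norm_mult intro: mult_left_mono)
  also have "\<dots> = (\<Sum>j\<in>int ` {..k}. norm (fc q j)) * D"
    by (simp add: sum.reindex sum_distrib_right)
  also have "\<dots> \<le> K * D"
  proof (rule mult_right_mono)
    have "(\<Sum>j\<in>int ` {..k}. norm (fc q j)) \<le> wnorm q"
      unfolding wnorm_def by (rule finite_sum_le_infsum) (use wiener_summable[OF W(6)] in auto)
    then show "(\<Sum>j\<in>int ` {..k}. norm (fc q j)) \<le> K" using W(2) by simp
    show "0 \<le> D" using D[of 0] by (meson norm_ge_zero of_nat_0_le_iff order_trans)
  qed
  also have "\<dots> \<le> K * (exp B * T * (2 * K * (exp B * T * K * (K * (B * T)))) * s powi (- 2 * int n))"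
    using K_pos by (intro mult_left_mono D_le) auto
  finally show "norm (fc (vpoly n x) (int k) - S k) \<le> ?C * s powi (- 2 * int n)" by (simp add: mult_ac)
qed

definition g :: "nat \<Rightarrow> nat \<Rightarrow> complex" where
  "g N k = (\<Sum>i\<le>k. fc q (int i) * fc p (int (N - i)))"

lemma S_has_sum: "((\<lambda>N. if k < N then w N * g N k else 0) has_sum S k) UNIV"
proof -
  have rw: "wiener (r k)" using wsupp_r by (rule wsuppD)
  have pw: "wiener p" using wsupp_p by (rule wsuppD)
  have i: "((\<lambda>N. if k < N then fc p (int (N - i)) * w N else 0) has_sum fc (\<lambda>z. p z * r k z) (int k - int i)) UNIV"
    if i: "i \<le> k" for i
  proof -
    have "((\<lambda>a. fc p a * fc (r k) (int k - int i - a)) has_sum fc (\<lambda>z. p z * r k z) (int k - int i)) UNIV"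
      by (rule fc_mult[OF pw rw])
    also have "?this \<longleftrightarrow> ((\<lambda>a. fc p a * fc (r k) (int k - int i - a)) has_sum fc (\<lambda>z. p z * r k z) (int k - int i)) {int k - int i<..}"
      by (rule has_sum_cong_neutral) (auto simp: fc_r)
    also have "\<dots> \<longleftrightarrow> ((\<lambda>N. fc p (int (N - i)) * w N) has_sum fc (\<lambda>z. p z * r k z) (int k - int i)) {k<..}"
    proof (rule has_sum_reindex_bij_witness[where i = "\<lambda>N. int N - int i" and j = "\<lambda>a. nat (a + int i)"])
      fix a assume a: "a \<in> {int k - int i<..}"
      have "- int (nat (a + int i)) = int k - int i - a - int k" using a i by auto
      then have "w (nat (a + int i)) = fc u (int k - int i - a - int k)" using fc_u[of "nat (a + int i)"] by simp
      moreover have "int (nat (a + int i) - i) = a" using a i by auto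
      ultimately show "fc p (int (nat (a + int i) - i)) * w (nat (a + int i)) = fc p a * fc (r k) (int k - int i - a)"
        using a by (simp add: fc_r)
    qed (use i in auto)
    also have "\<dots> \<longleftrightarrow> ((\<lambda>N. if k < N then fc p (int (N - i)) * w N else 0) has_sum fc (\<lambda>z. p z * r k z) (int k - int i)) UNIV"
      by (rule has_sum_cong_neutral) auto
    finally show ?thesis .
  qed
  have "((\<lambda>N. \<Sum>i\<in>I. fc q (int i) * (if k < N then fc p (int (N - i)) * w N else 0)) has_sum
      (\<Sum>i\<in>I. fc q (int i) * fc (\<lambda>z. p z * r k z) (int k - int i))) UNIV" if "finite I" "I \<subseteq> {..k}" for I
    using that by (induction I) (auto intro!: has_sum_add has_sum_cmult_right i)
  from this[of "{..k}"] have "((\<lambda>N. \<Sum>i\<le>k. fc q (int i) * (if k < N then fc p (int (N - i)) * w N else 0)) has_sum S k) UNIV"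
    by (simp add: S_def)
  moreover have "(\<Sum>i\<le>k. fc q (int i) * (if k < N then fc p (int (N - i)) * w N else 0)) = (if k < N then w N * g N k else 0)" for N
    by (simp add: g_def sum_distrib_left mult_ac)
  ultimately show ?thesis by simp
qed

lemma geometric_dominates: "\<exists>C\<ge>0. \<forall>n::nat. real n * s powi (- 2 * int n) \<le> C * inverse \<rho> ^ n"
proof -
  have "norm (\<rho> / s^2) < 1" using s \<rho> by simp
  then have "(\<lambda>n. of_nat n * (\<rho> / s^2) ^ n) \<longlonglongrightarrow> 0" by (rule powser_times_n_limit_0)
  then have "Bseq (\<lambda>n. of_nat n * (\<rho> / s^2) ^ n)" by (intro convergent_imp_Bseq) (auto simp: convergent_def)
  then obtain C where C: "C > 0" "\<And>n. norm (of_nat n * (\<rho> / s^2) ^ n :: real) \<le> C" by (auto elim: BseqE)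
  have "real n * s powi (- 2 * int n) \<le> C * inverse \<rho> ^ n" for n
  proof -
    have "s powi (- 2 * int n) = inverse (s ^ (2 * n))" by (simp add: power_int_minus flip: power_int_of_nat)
    then have "real n * s powi (- 2 * int n) = (of_nat n * (\<rho> / s^2) ^ n) * inverse \<rho> ^ n"
      using \<rho> by (simp add: power_mult divide_inverse power_inverse power_mult_distrib)
    also have "\<dots> \<le> C * inverse \<rho> ^ n" using C(2)[of n] \<rho> by (intro mult_right_mono) auto
    finally show ?thesis .
  qed
  then show ?thesis using C(1) by (intro exI[of _ C]) auto
qed

lemma norm_wg_le: "\<exists>C\<ge>0. \<forall>k N. k < N \<longrightarrow> norm (w N * g N k) \<le> C * inverse \<rho> ^ N"
proof -
  obtain C where C: "C \<ge> 0" "\<And>n::nat. real n * s powi (- 2 * int n) \<le> C * inverse \<rho> ^ n"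
    using geometric_dominates by blast
  have s0: "s \<noteq> 0" using s by simp
  have "norm (w N * g N k) \<le> (B * exp B * exp B * C) * inverse \<rho> ^ N" if kN: "k < N" for k N
  proof -
    have w: "norm (w N) \<le> B * s powi (- int N)"
      using decayD[OF decay_u, of "- int N"] fc_u[of N] by simp
    have "norm (g N k) \<le> (\<Sum>i\<le>k. exp B * exp B * s powi (- int N))"
      unfolding g_def
    proof (rule sum_norm_le)
      fix i assume "i \<in> {..k}"
      then have i: "i \<le> N" using kN by auto
      have "norm (fc q (int i) * fc p (int (N - i))) \<le> (exp B * s powi (- int i)) * (exp B * s powi (- int (N - i)))"
        unfolding norm_mult using decayD[OF decay_q, of "int i"] decayD[OF decay_p, of "int (N - i)"]
        by (intro mult_mono) (use s in auto)
      also have "\<dots> = exp B * exp B * (s powi (- int i) * s powi (- int (N - i)))" by simp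
      also have "s powi (- int i) * s powi (- int (N - i)) = s powi (- int N)"
        using s0 i by (simp add: power_int_add[symmetric] of_nat_diff)
      finally show "norm (fc q (int i) * fc p (int (N - i))) \<le> exp B * exp B * s powi (- int N)" .
    qed
    also have "\<dots> = real (Suc k) * (exp B * exp B * s powi (- int N))" by simp
    also have "\<dots> \<le> real N * (exp B * exp B * s powi (- int N))"
      using kN s by (intro mult_right_mono) auto
    finally have g: "norm (g N k) \<le> real N * (exp B * exp B * s powi (- int N))" .
    have "norm (w N * g N k) \<le> (B * s powi (- int N)) * (real N * (exp B * exp B * s powi (- int N)))"
      unfolding norm_mult using B_nonneg s by (intro mult_mono w g) auto
    also have "\<dots> = B * exp B * exp B * (real N * (s powi (- int N) * s powi (- int N)))" by (simp add: mult_ac)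
    also have "s powi (- int N) * s powi (- int N) = s powi (- 2 * int N)"
      using s0 by (simp add: power_int_add[symmetric])
    also have "B * exp B * exp B * (real N * s powi (- 2 * int N)) \<le> B * exp B * exp B * (C * inverse \<rho> ^ N)"
      using B_nonneg by (intro mult_left_mono C(2)) auto
    finally show ?thesis by (simp add: mult_ac)
  qed
  then show ?thesis using C(1) B_nonneg by (intro exI[of _ "B * exp B * exp B * C"]) auto
qed

text \<open>This is the coefficient identity of \<open>z p' / p = z (log p)'\<close>.\<close>

lemma sum_g: "(\<Sum>k<N. g N k) = of_nat N * v N"
proof -
  have hol: "p holomorphic_on ball 0 R" "q holomorphic_on ball 0 R"
    unfolding p_def q_def by (intro holomorphic_intros Vp)+
  define P where "P = fps_expansion p 0"
  define Q where "Q = fps_expansion q 0"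
  define V where "V = fps_expansion Vp 0"
  have exps: "p has_fps_expansion P" "q has_fps_expansion Q" "Vp has_fps_expansion V"
    unfolding P_def Q_def V_def using R hol Vp by (auto intro!: has_fps_expansion_fps_expansion[of "ball 0 R"])
  have nth: "fc p (int i) = fps_nth P i" "fc q (int i) = fps_nth Q i" "v i = fps_nth V i" for i
    unfolding P_def Q_def V_def v_def using fc_ball_nonneg R hol Vp by auto
  have PQ: "P * Q = 1"
  proof -
    have "(\<lambda>z. p z * q z) has_fps_expansion P * Q" by (intro fps_expansion_intros exps)
    then have "(\<lambda>z. 1) has_fps_expansion P * Q" by (simp add: pq)
    moreover have "(\<lambda>z::complex. 1) has_fps_expansion 1" by (intro fps_expansion_intros)
    ultimately show ?thesis using fps_expansion_unique_complex by blast
  qed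
  have dP: "fps_deriv P = fps_deriv V * P"
  proof -
    have 1: "deriv p has_fps_expansion fps_deriv P" by (rule has_fps_expansion_deriv[OF exps(1)])
    have 2: "(\<lambda>z. deriv Vp z * p z) has_fps_expansion fps_deriv V * P"
      by (intro has_fps_expansion_mult has_fps_expansion_deriv exps)
    have "eventually (\<lambda>z. z \<in> ball 0 R) (nhds (0::complex))" using R by (intro eventually_nhds_in_open) auto
    then have "eventually (\<lambda>z. deriv p z = deriv Vp z * p z) (nhds 0)"
    proof eventually_elim
      case (elim z)
      have "(Vp has_field_derivative deriv Vp z) (at z)"
        using elim by (intro holomorphic_derivI[OF Vp]) auto
      then have "(p has_field_derivative exp (Vp z) * deriv Vp z) (at z)"
        unfolding p_def by (rule DERIV_fun_exp)
      then show ?case by (simp add: DERIV_imp_deriv p_def)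
    qed
    with 2 have "deriv p has_fps_expansion fps_deriv V * P"
      by (subst has_fps_expansion_cong[OF _ refl]) auto
    with 1 show ?thesis using fps_expansion_unique_complex by blast
  qed
  have "Q * (fps_X * fps_deriv P) = (P * Q) * (fps_X * fps_deriv V)" unfolding dP by (simp only: mult_ac)
  also have "\<dots> = fps_X * fps_deriv V" by (simp add: PQ)
  finally have "fps_nth (Q * (fps_X * fps_deriv P)) N = fps_nth (fps_X * fps_deriv V) N" by (rule arg_cong)
  moreover have X: "fps_nth (fps_X * fps_deriv F) i = of_nat i * fps_nth F i" for F :: "complex fps" and i
    by (cases i) auto
  ultimately have "(\<Sum>i = 0..N. fps_nth Q i * (of_nat (N - i) * fps_nth P (N - i))) = of_nat N * v N"
    by (simp only: fps_mult_nth X nth)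
  moreover have "(\<Sum>i = 0..N. fps_nth Q i * (of_nat (N - i) * fps_nth P (N - i)))
    = (\<Sum>i<N. of_nat (N - i) * (fps_nth Q i * fps_nth P (N - i)))"
    by (simp add: sum.last_plus atLeast0AtMost lessThan_Suc_atMost[symmetric] mult_ac)
  moreover have "(\<Sum>k<N. g N k) = (\<Sum>i<N. of_nat (N - i) * (fps_nth Q i * fps_nth P (N - i)))"
    unfolding g_def nth by (rule sum_triangle_count)
  ultimately show ?thesis by simp
qed

end

context szego_factors
begin

lemma has_sum_geometric_tail:
  fixes y :: real
  assumes "0 \<le> y" "y < 1"
  shows "((\<lambda>k. y ^ (n + k)) has_sum (y ^ n / (1 - y))) UNIV"
  using has_sum_cmult_right[OF has_sum_geometric[of y], of "y ^ n"] assms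
  by (simp add: power_add)

definition \<kappa> :: complex where "\<kappa> = (\<Sum>k. of_nat k * v k * w k)"

lemma trace_main_term: "\<exists>C\<ge>0. \<forall>n. norm ((\<Sum>k<n. S k) - \<kappa>) \<le> C * inverse \<rho> ^ n"
proof -
  obtain C where C: "C \<ge> 0" "\<And>k N. k < N \<Longrightarrow> norm (w N * g N k) \<le> C * inverse \<rho> ^ N"
    using norm_wg_le by blast
  define y where "y = inverse \<rho>"
  have y: "0 \<le> y" "y < 1" using \<rho> by (auto simp: y_def inverse_less_1_iff)
  define f where "f k N = (if k < N then w N * g N k else 0)" for k N
  define F where "F k N = (if k < N then C * y ^ N else 0)" for k N :: nat
  have fF: "norm (f k N) \<le> F k N" for k N using C by (auto simp: f_def F_def y_def)
  have f: "(f k has_sum S k) UNIV" for k unfolding f_def by (rule S_has_sum)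
  have F: "(F k has_sum (C * (y ^ Suc k / (1 - y)))) UNIV" for k
  proof -
    have "((\<lambda>i. C * y ^ (Suc k + i)) has_sum (C * (y ^ Suc k / (1 - y)))) UNIV"
      by (intro has_sum_cmult_right has_sum_geometric_tail y)
    also have "?this \<longleftrightarrow> (F k has_sum (C * (y ^ Suc k / (1 - y)))) {k<..}"
      by (rule has_sum_reindex_bij_witness[where i = "\<lambda>N. N - Suc k" and j = "\<lambda>i. Suc k + i"]) (auto simp: F_def)
    also have "\<dots> \<longleftrightarrow> (F k has_sum (C * (y ^ Suc k / (1 - y)))) UNIV"
      by (rule has_sum_cong_neutral) (auto simp: F_def)
    finally show ?thesis .
  qed
  have S_le: "norm (S k) \<le> C / (1 - y) * y ^ k" for k
  proof -
    have "norm (S k) \<le> C * (y ^ Suc k / (1 - y))" by (rule norm_infsum_le[OF f F fF])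
    also have "\<dots> \<le> C * (y ^ k / (1 - y))"
      using C y by (intro mult_left_mono divide_right_mono power_decreasing) auto
    finally show ?thesis by simp
  qed
  have Fs: "(\<lambda>(k, N). F k N) summable_on (UNIV \<times> UNIV)"
  proof (rule summable_on_SigmaI)
    show "((\<lambda>N. case (k, N) of (k, N) \<Rightarrow> F k N) has_sum (C * (y ^ Suc k / (1 - y)))) UNIV" for k
      using F[of k] by simp
    have "(\<lambda>k. C * y / (1 - y) * y ^ k) summable_on UNIV" by (rule summable_on_geometric[OF y])
    then show "(\<lambda>k. C * (y ^ Suc k / (1 - y))) summable_on UNIV" by (simp add: mult_ac)
  qed (use C y in \<open>auto simp: F_def\<close>)
  have "(\<lambda>p. norm (case p of (k, N) \<Rightarrow> f k N)) summable_on (UNIV \<times> UNIV)"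
    by (rule Infinite_Sum.abs_summable_on_comparison_test'[OF Fs]) (use fF in auto)
  then have fs: "(\<lambda>(k, N). f k N) summable_on (UNIV \<times> UNIV)" by (rule abs_summable_summable)
  define t where "t = infsum (\<lambda>(k, N). f k N) (UNIV \<times> UNIV)"
  have ft: "((\<lambda>(k, N). f k N) has_sum t) (UNIV \<times> UNIV)"
    unfolding t_def using fs by (rule has_sum_infsum)
  have St: "(S has_sum t) UNIV"
    by (rule has_sum_SigmaD[OF ft]) (use f in simp)
  have ft': "((\<lambda>(N, k). f k N) has_sum t) (UNIV \<times> UNIV)"
    using ft by (subst has_sum_swap) (simp add: case_prod_unfold)
  have "((\<lambda>N. of_nat N * v N * w N) has_sum t) UNIV"
  proof (rule has_sum_SigmaD[OF ft'])
    fix N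
    have "((\<lambda>k. f k N) has_sum (\<Sum>k<N. f k N)) UNIV"
      by (rule has_sum_finite_neutralI[of "{..<N}"]) (auto simp: f_def)
    also have "(\<Sum>k<N. f k N) = w N * (\<Sum>k<N. g N k)" by (simp add: f_def sum_distrib_left)
    also have "\<dots> = of_nat N * v N * w N" by (simp add: sum_g)
    finally show "((\<lambda>k. case (N, k) of (N, k) \<Rightarrow> f k N) has_sum of_nat N * v N * w N) UNIV" by simp
  qed
  then have sums: "(\<lambda>N. of_nat N * v N * w N) sums t" by (rule has_sum_imp_sums)
  then have t: "\<kappa> = t" unfolding \<kappa>_def by (simp add: sums_iff)
  have "norm ((\<Sum>k<n. S k) - \<kappa>) \<le> C / (1 - y) / (1 - y) * y ^ n" for n
  proof -
    have "(\<lambda>k. S (k + n)) sums (t - (\<Sum>k<n. S k))"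
      using has_sum_imp_sums[OF St] by (rule sums_split_initial_segment)
    moreover have geo: "((\<lambda>k. C / (1 - y) * y ^ (n + k)) has_sum (C / (1 - y) * (y ^ n / (1 - y)))) UNIV"
      by (intro has_sum_cmult_right has_sum_geometric_tail y)
    have le: "norm (S (k + n)) \<le> C / (1 - y) * y ^ (n + k)" for k
      using S_le[of "k + n"] by (simp add: add.commute)
    have "summable (\<lambda>k. norm (S (k + n)))"
      using summable_on_imp_summable[OF has_sum_imp_summable[OF geo]]
      by (rule summable_comparison_test') (use le in auto)
    ultimately have "((\<lambda>k. S (k + n)) has_sum (t - (\<Sum>k<n. S k))) UNIV"
      by (intro norm_summable_imp_has_sum)
    from norm_infsum_le[OF this geo le] show ?thesis unfolding t
      by (simp add: norm_minus_commute)
  qed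
  then show "\<exists>C\<ge>0. \<forall>n. norm ((\<Sum>k<n. S k) - \<kappa>) \<le> C * inverse \<rho> ^ n"
    using C y by (intro exI[of _ "C / (1 - y) / (1 - y)"]) (auto simp: y_def)
qed

definition D :: "nat \<Rightarrow> complex \<Rightarrow> complex" where
  "D n t = Determinant.det (toep (\<lambda>z. p z * m t z) n)"

lemma D_derivative:
  "\<exists>C\<ge>0. \<forall>n t. small n \<longrightarrow> norm t \<le> 1 \<longrightarrow> (\<exists>D'. (D n has_field_derivative D') (at t) \<and>
     norm (D' - \<kappa> * D n t) \<le> C * inverse \<rho> ^ n * norm (D n t))"
proof -
  obtain C1 where C1: "C1 \<ge> 0" "\<And>t n k x. norm t \<le> 1 \<Longrightarrow> small n \<Longrightarrow> k < n \<Longrightarrow> x \<in> carrier_vec n \<Longrightarrow>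
     toep (\<lambda>z. p z * m t z) n *\<^sub>v x = bvec (\<lambda>z. u z * (p z * m t z) * z powi int k) n \<Longrightarrow>
     norm (fc (vpoly n x) (int k) - S k) \<le> C1 * s powi (- 2 * int n)"
    using trace_coeff by blast
  obtain C2 where C2: "C2 \<ge> 0" "\<And>n. norm ((\<Sum>k<n. S k) - \<kappa>) \<le> C2 * inverse \<rho> ^ n"
    using trace_main_term by blast
  obtain C3 where C3: "C3 \<ge> 0" "\<And>n::nat. real n * s powi (- 2 * int n) \<le> C3 * inverse \<rho> ^ n"
    using geometric_dominates by blast
  have "\<exists>D'. (D n has_field_derivative D') (at t) \<and> norm (D' - \<kappa> * D n t) \<le> (C1 * C3 + C2) * inverse \<rho> ^ n * norm (D n t)"
    if n: "small n" and t: "norm t \<le> 1" for n t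
  proof -
    note W = wnorm_le_K[OF t]
    have uw: "wiener u" using wsupp_u by (rule wsuppD)
    let ?A = "toep (\<lambda>z. p z * m t z) n"
    have det: "Determinant.det ?A \<noteq> 0" by (rule det_nonzero[OF t n])
    have "\<exists>x. x \<in> carrier_vec n \<and> ?A *\<^sub>v x = bvec (\<lambda>z. u z * (p z * m t z) * z powi int k) n" for k
      using mat_solution[OF toep_carrier bvec_carrier det] by metis
    then obtain x where x: "\<And>k. x k \<in> carrier_vec n"
      "\<And>k. ?A *\<^sub>v x k = bvec (\<lambda>z. u z * (p z * m t z) * z powi int k) n" by metis
    define tr where "tr = (\<Sum>k<n. fc (vpoly n (x k)) (int k))"
    have cont: "continuous_on unit_circle p" "continuous_on unit_circle u"
    proof -
      have c: "continuous_on (ball 0 R) Vp" "continuous_on (ball 0 R) Vm"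
        using Vp Vm by (auto intro: holomorphic_on_imp_continuous_on)
      show "continuous_on unit_circle p"
        unfolding p_def by (intro continuous_on_exp continuous_on_subset[OF c(1)]) (use R in auto)
      show "continuous_on unit_circle u"
        unfolding u_def by (rule continuous_on_compose2[OF c(2)])
          (use R in \<open>auto intro!: continuous_intros simp: norm_divide\<close>)
    qed
    let ?M = "\<lambda>c. Matrix.mat n n (\<lambda>(i, k). if k = c then fc (\<lambda>z. u z * (p z * exp (t * u z))) (int k - int i)
         else fc (\<lambda>z. p z * exp (t * u z)) (int k - int i))"
    have "((\<lambda>t. Determinant.det (Matrix.mat n n (\<lambda>(i, k). fc (\<lambda>z. p z * exp (t * u z)) (int k - int i)))) has_field_derivative
      (\<Sum>c<n. Determinant.det (?M c))) (at t)"
      by (intro det_has_field_derivative fc_exp_has_field_derivative cont)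
    also have "(\<lambda>t. Determinant.det (Matrix.mat n n (\<lambda>(i, k). fc (\<lambda>z. p z * exp (t * u z)) (int k - int i)))) = D n"
      by (simp add: D_def toep_def m_eq fun_eq_iff)
    also have "(\<Sum>c<n. Determinant.det (?M c)) = (\<Sum>c<n. fc (vpoly n (x (n - 1 - c))) (int (n - 1 - c)) * D n t)"
    proof (rule sum.cong[OF refl])
      fix c assume "c \<in> {..<n}"
      then have c: "c < n" by simp
      have fw: "wiener (\<lambda>z. u z * (p z * m t z))" by (intro wiener_mult uw W)
      have "?M c = replace_col ?A (?A *\<^sub>v x (n - 1 - c)) c"
      proof (rule eq_matI)
        fix i k assume "i < dim_row (replace_col ?A (?A *\<^sub>v x (n - 1 - c)) c)" "k < dim_col (replace_col ?A (?A *\<^sub>v x (n - 1 - c)) c)"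
        then have ik: "i < n" "k < n" by (auto simp: replace_col_def toep_def)
        have "fc (\<lambda>z. u z * (p z * m t z) * z powi int (n - 1 - c)) (int n - 1 - int i) = fc (\<lambda>z. u z * (p z * m t z)) (int c - int i)"
          unfolding fc_powi_mult[OF fw] using c by (simp add: of_nat_diff)
        then show "?M c $$ (i, k) = replace_col ?A (?A *\<^sub>v x (n - 1 - c)) c $$ (i, k)"
          unfolding x(2) using ik by (simp add: replace_col_def bvec_def m_eq) (simp add: toep_def m_eq)
      qed (auto simp: replace_col_def toep_def)
      then have "Determinant.det (?M c) = vec_index (x (n - 1 - c)) c * Determinant.det ?A"
        using cramer_lemma_mat[OF toep_carrier x(1) c] by simp
      also have "vec_index (x (n - 1 - c)) c = fc (vpoly n (x (n - 1 - c))) (int (n - 1 - c))"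
        using c by (subst fc_vpoly_index) auto
      finally show "Determinant.det (?M c) = fc (vpoly n (x (n - 1 - c))) (int (n - 1 - c)) * D n t"
        by (simp add: D_def)
    qed
    also have "\<dots> = (\<Sum>k<n. fc (vpoly n (x k)) (int k) * D n t)"
      by (rule sum.reindex_bij_witness[where i = "\<lambda>k. n - 1 - k" and j = "\<lambda>k. n - 1 - k"]) auto
    also have "\<dots> = tr * D n t" by (simp add: tr_def sum_distrib_right)
    finally have der: "(D n has_field_derivative tr * D n t) (at t)" .
    have "norm (tr - (\<Sum>k<n. S k)) = norm (\<Sum>k<n. fc (vpoly n (x k)) (int k) - S k)"
      by (simp add: tr_def sum_subtractf)
    also have "\<dots> \<le> (\<Sum>k<n. C1 * s powi (- 2 * int n))"
      by (rule sum_norm_le) (use C1(2)[OF t n _ x] in auto)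
    also have "\<dots> = C1 * (real n * s powi (- 2 * int n))" by simp
    also have "\<dots> \<le> C1 * (C3 * inverse \<rho> ^ n)" by (intro mult_left_mono C1 C3)
    finally have "norm (tr - \<kappa>) \<le> C1 * (C3 * inverse \<rho> ^ n) + C2 * inverse \<rho> ^ n"
      using C2(2)[of n] norm_triangle_ineq[of "tr - (\<Sum>k<n. S k)" "(\<Sum>k<n. S k) - \<kappa>"] by simp
    then have "norm (tr - \<kappa>) * norm (D n t) \<le> ((C1 * C3 + C2) * inverse \<rho> ^ n) * norm (D n t)"
      by (intro mult_right_mono) (auto simp: algebra_simps)
    then show ?thesis using der
      by (intro exI[of _ "tr * D n t"]) (simp add: norm_mult[symmetric] left_diff_distrib)
  qed
  moreover have "0 \<le> C1 * C3 + C2" using C1 C2 C3 by simp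
  ultimately show ?thesis by blast
qed

lemma D_0: "D n 0 = fc p 0 ^ n"
proof -
  have m0: "m 0 z = 1" for z by (simp add: m_def)
  have ut: "upper_triangular (toep p n)"
    using wsuppD(2)[OF wsupp_p] by (auto simp: upper_triangular_def toep_def)
  have "Determinant.det (toep p n) = prod_list (diag_mat (toep p n))"
    by (rule det_upper_triangular[OF ut toep_carrier])
  also have "diag_mat (toep p n) = map (\<lambda>i. fc p 0) [0..<n]"
    by (auto simp: diag_mat_def toep_def)
  also have "prod_list \<dots> = fc p 0 ^ n" by (induction n) (auto simp: mult.commute)
  finally show ?thesis by (simp add: D_def m0)
qed

theorem szego_asymp:
  "\<exists>C. eventually (\<lambda>n. \<exists>\<delta>. norm \<delta> \<le> C * inverse \<rho> ^ n \<and>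
     Determinant.det (toep (\<lambda>z. p z * m 1 z) n) = fc p 0 ^ n * exp \<kappa> * (1 + \<delta>)) sequentially"
proof -
  obtain C where C: "C \<ge> 0" "\<And>n t. small n \<Longrightarrow> norm t \<le> 1 \<Longrightarrow> \<exists>D'. (D n has_field_derivative D') (at t) \<and>
     norm (D' - \<kappa> * D n t) \<le> C * inverse \<rho> ^ n * norm (D n t)"
    using D_derivative by blast
  have "(\<lambda>n. C * inverse \<rho> ^ n) \<longlonglongrightarrow> C * 0"
    using LIMSEQ_inverse_realpow_zero[OF \<rho>(1)] by (intro tendsto_mult tendsto_const) (simp add: power_inverse)
  then have "eventually (\<lambda>n. C * inverse \<rho> ^ n < 1 / 2) sequentially"
    by (rule order_tendstoD) auto
  with eventually_small have "eventually (\<lambda>n. \<exists>\<delta>. norm \<delta> \<le> (2 * C) * inverse \<rho> ^ n \<and>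
     Determinant.det (toep (\<lambda>z. p z * m 1 z) n) = fc p 0 ^ n * exp \<kappa> * (1 + \<delta>)) sequentially"
  proof eventually_elim
    case (elim n)
    define \<epsilon> where "\<epsilon> = C * inverse \<rho> ^ n"
    have \<epsilon>: "0 \<le> \<epsilon>" "\<epsilon> \<le> 1 / 2" using C \<rho> elim by (auto simp: \<epsilon>_def)
    define f where "f t = D n t * exp (- \<kappa> * t)" for t
    have seg: "norm t \<le> 1" if "t \<in> closed_segment 0 1" for t :: complex
      using segment_bound1[OF that] by simp
    have "\<forall>t\<in>closed_segment 0 1. \<exists>f'. (f has_field_derivative f') (at t) \<and> norm f' \<le> \<epsilon> * norm (f t)"
    proof
      fix t :: complex assume "t \<in> closed_segment 0 1"
      then obtain D' where D': "(D n has_field_derivative D') (at t)" "norm (D' - \<kappa> * D n t) \<le> \<epsilon> * norm (D n t)"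
        using C(2)[OF elim(1) seg] by (auto simp: \<epsilon>_def)
      have "(f has_field_derivative (D' - \<kappa> * D n t) * exp (- \<kappa> * t)) (at t)"
        unfolding f_def by (auto intro!: derivative_eq_intros D' simp: algebra_simps)
      moreover have "norm ((D' - \<kappa> * D n t) * exp (- \<kappa> * t)) \<le> \<epsilon> * norm (f t)"
        unfolding f_def norm_mult using mult_right_mono[OF D'(2), of "norm (exp (- \<kappa> * t))"] by (simp add: mult_ac)
      ultimately show "\<exists>f'. (f has_field_derivative f') (at t) \<and> norm f' \<le> \<epsilon> * norm (f t)" by blast
    qed
    then obtain f' where f': "\<And>t. t \<in> closed_segment 0 1 \<Longrightarrow> (f has_field_derivative f' t) (at t)"
      "\<And>t. t \<in> closed_segment 0 1 \<Longrightarrow> norm (f' t) \<le> \<epsilon> * norm (f t)" by metis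
    have "norm (f 1 - f 0) \<le> 2 * \<epsilon> * norm (f 0)" by (rule gronwall_unit_segment[OF f' \<epsilon>])
    moreover have f0: "f 0 = fc p 0 ^ n" by (simp add: f_def D_0)
    moreover have "f 0 \<noteq> 0" using det_nonzero[of 0 n] elim(1) by (simp add: f_def D_def)
    ultimately have "norm ((f 1 - f 0) / f 0) \<le> 2 * \<epsilon>"
      by (simp add: norm_divide divide_le_eq)
    moreover have "Determinant.det (toep (\<lambda>z. p z * m 1 z) n) = fc p 0 ^ n * exp \<kappa> * (1 + (f 1 - f 0) / f 0)"
    proof -
      have "D n 1 = f 1 * exp \<kappa>" by (simp add: f_def exp_minus)
      also have "f 1 = f 0 * (1 + (f 1 - f 0) / f 0)" using \<open>f 0 \<noteq> 0\<close> by (simp add: field_simps)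
      finally show ?thesis unfolding f0 by (simp add: D_def mult_ac)
    qed
    ultimately show ?case unfolding \<epsilon>_def by (intro exI[of _ "(f 1 - f 0) / f 0"]) auto
  qed
  then show ?thesis by blast
qed

end

section \<open>Evaluation of the limit\<close>

lemma holomorphic_ann_bound:
  assumes hol: "f holomorphic_on ann R" and s: "1 < s" "s < R"
  obtains D where "decay D s f" "wiener f"
proof -
  have i: "inverse R < inverse s" "inverse s < s" using s by (auto simp: inverse_less_1_iff less_trans[of _ 1])
  then have "inverse R < s" by (rule less_trans)
  moreover have "inverse s < R" using i(2) s(2) by (rule less_trans)
  ultimately have r: "inverse R < t \<and> t < R" if "t = s \<or> t = inverse s" for t
    using that s(2) i(1) by blast
  have "x \<in> ann R" if "x \<in> sphere 0 s \<union> sphere 0 (inverse s)" for x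
  proof -
    have "norm x = s \<or> norm x = inverse s" using that by simp
    from r[OF this] show ?thesis by simp
  qed
  then have "sphere 0 s \<union> sphere 0 (inverse s) \<subseteq> ann R" by blast
  then have "continuous_on (sphere 0 s \<union> sphere 0 (inverse s)) f"
    by (rule continuous_on_subset[OF holomorphic_on_imp_continuous_on[OF hol]])
  then have "compact (f ` (sphere 0 s \<union> sphere 0 (inverse s)))"
    by (intro compact_continuous_image compact_Un) auto
  then obtain D where D: "\<forall>z\<in>sphere 0 s \<union> sphere 0 (inverse s). norm (f z) \<le> D"
    by (auto dest!: compact_imp_bounded simp: bounded_iff)
  show thesis
    by (rule that[of D]; rule decay_holomorphic_ann[OF hol s] wiener_holomorphic_ann[OF hol s]) (use D in auto)
qed

lemma wiener_ann:
  assumes "f holomorphic_on ann R" "1 < R" shows "wiener f"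
proof -
  obtain s where "1 < s" "s < R" using dense[OF assms(2)] by blast
  then show ?thesis using holomorphic_ann_bound[OF assms(1)] by blast
qed

lemma power_series_part:
  assumes R: "1 < R" "R < R'" and c: "\<And>k::nat. norm (c k) \<le> A * R' powi (- int k)"
  shows "eval_fps (Abs_fps c) holomorphic_on ball 0 R"
    and "fc (eval_fps (Abs_fps c)) (int k) = c k"
proof -
  have A: "0 \<le> A" using order_trans[OF norm_ge_zero c[of 0]] by simp
  have "summable (\<lambda>k. c k * of_real R ^ k)"
  proof (rule summable_comparison_test')
    show "summable (\<lambda>k. A * (R / R') ^ k)" using R by (intro summable_mult summable_geometric) auto
    show "norm (c k * of_real R ^ k) \<le> A * (R / R') ^ k" if "k \<ge> 0" for k
    proof -
      have "norm (c k * of_real R ^ k) = norm (c k) * R ^ k" using R by (simp add: norm_mult norm_power)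
      also have "\<dots> \<le> (A * R' powi (- int k)) * R ^ k" using R by (intro mult_right_mono c) auto
      also have "\<dots> = A * (R / R') ^ k" 
        by (simp add: power_int_minus divide_inverse power_mult_distrib power_inverse mult_ac)
      finally show ?thesis .
    qed
  qed
  then have "conv_radius c \<ge> norm (of_real R :: complex)" by (rule conv_radius_geI)
  then have cr: "fps_conv_radius (Abs_fps c) \<ge> ereal R" using R by (simp add: fps_conv_radius_def)
  show hol: "eval_fps (Abs_fps c) holomorphic_on ball 0 R"
  proof (rule holomorphic_on_eval_fps, rule subsetI)
    fix x :: complex assume "x \<in> ball 0 R"
    then have "ereal (norm x) < ereal R" by simp
    also note cr
    finally show "x \<in> eball 0 (fps_conv_radius (Abs_fps c))" by (simp add: in_eball_iff)
  qed
  have "0 < ereal R" using R by simp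
  also note cr
  finally have "0 < fps_conv_radius (Abs_fps c)" .
  then have "eval_fps (Abs_fps c) has_fps_expansion Abs_fps c" by (rule eval_fps_has_fps_expansion)
  moreover have "eval_fps (Abs_fps c) has_fps_expansion fps_expansion (eval_fps (Abs_fps c)) 0"
    using R by (intro has_fps_expansion_fps_expansion[OF _ _ hol]) auto
  ultimately have "fps_expansion (eval_fps (Abs_fps c)) 0 = Abs_fps c" using fps_expansion_unique_complex by blast
  then show "fc (eval_fps (Abs_fps c)) (int k) = c k"
    using fc_ball_nonneg[OF hol R(1), of k] by simp
qed

lemma laurent_split:
  assumes hol: "V holomorphic_on ann \<rho>" and R: "1 < R" "R < \<rho>"
  obtains Vp Vm where "Vp holomorphic_on ball 0 R" "Vm holomorphic_on ball 0 R" "Vm 0 = 0"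
    "\<And>k. fc Vp (int k) = fc V (int k)" "\<And>k. 0 < k \<Longrightarrow> fc Vm (int k) = fc V (- int k)" "fc Vm 0 = 0"
    "\<And>z. norm z = 1 \<Longrightarrow> V z = Vp z + Vm (1 / z)"
proof -
  obtain R' where R': "R < R'" "R' < \<rho>" using dense[OF R(2)] by blast
  have R1: "1 < R'" using R R' by simp
  obtain A where A: "decay A R' V" "wiener V" using holomorphic_ann_bound[OF hol R1 R'(2)] by blast
  define cp where "cp k = fc V (int k)" for k
  define cm where "cm k = (if k = 0 then 0 else fc V (- int k))" for k
  have "norm (cp k) \<le> A * R' powi (- int k)" for k using decayD[OF A(1), of "int k"] by (simp add: cp_def)
  note P = power_series_part[OF R(1) R'(1) this]
  have "norm (cm k) \<le> A * R' powi (- int k)" for k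
    using decayD[OF A(1), of "- int k"] decay_nonneg[OF A(1)] R1 by (auto simp: cm_def)
  note M = power_series_part[OF R(1) R'(1) this]
  define Vp where "Vp = eval_fps (Abs_fps cp)"
  define Vm where "Vm = eval_fps (Abs_fps cm)"
  have fp: "fc Vp (int k) = cp k" and fm: "fc Vm (int k) = cm k" for k
    unfolding Vp_def Vm_def by (rule P M)+
  have holp: "Vp holomorphic_on ball 0 R" and holm: "Vm holomorphic_on ball 0 R"
    unfolding Vp_def Vm_def by (rule P M)+
  have w: "wiener Vp" "wiener Vm" using holp holm wiener_ball R by auto
  have neg: "fc Vp k = 0" "fc Vm k = 0" if "k < 0" for k
    using fc_ball_neg[OF holp R(1) that] fc_ball_neg[OF holm R(1) that] by auto
  show thesis
  proof
    show "Vp holomorphic_on ball 0 R" "Vm holomorphic_on ball 0 R" by (rule holp holm)+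
    show "Vm 0 = 0" by (simp add: Vm_def eval_fps_at_0 cm_def)
    show "fc Vp (int k) = fc V (int k)" for k by (simp add: fp cp_def)
    show "fc Vm (int k) = fc V (- int k)" if "0 < k" for k using that by (simp add: fm cm_def)
    show fm0: "fc Vm 0 = 0" using fm[of 0] by (simp add: cm_def)
    show "V z = Vp z + Vm (1 / z)" if z: "norm z = 1" for z
    proof (rule wiener_eqI[OF A(2) wiener_add[OF w(1) wiener_reflect[OF w(2)]] _ z])
      fix k
      show "fc V k = fc (\<lambda>z. Vp z + Vm (1 / z)) k"
      proof (cases "k \<ge> 0")
        case True
        have "fc Vm (- k) = 0" using neg(2)[of "- k"] fm0 True by (cases "k = 0") auto
        then show ?thesis using True fp[of "nat k"]
          by (simp add: fc_add w wiener_reflect fc_reflect cp_def)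
      next
        case False
        then show ?thesis using neg(1)[of k] fm[of "nat (- k)"]
          by (simp add: fc_add w wiener_reflect fc_reflect cm_def)
      qed
    qed
  qed
qed

lemma fc_exp:
  assumes hol: "f holomorphic_on ball 0 R" and R: "1 < R"
  shows "fc (\<lambda>z. exp (f z)) 0 = exp (fc f 0)"
    and "fc (\<lambda>z. exp (f z)) 1 = exp (fc f 0) * fc f 1"
    and "fc (\<lambda>z. exp (f z)) 2 = exp (fc f 0) * (fc f 2 + (fc f 1)^2 / 2)"
proof -
  have hole: "(\<lambda>z. exp (f z)) holomorphic_on ball 0 R" by (intro holomorphic_intros hol)
  have zero: "fc f 0 = f 0" and e0: "fc (\<lambda>z. exp (f z)) 0 = exp (f 0)"
    using fc_ball_nonneg[OF hol R, of 0] fc_ball_nonneg[OF hole R, of 0] by (simp_all add: fps_expansion_def)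
  show "fc (\<lambda>z. exp (f z)) 0 = exp (fc f 0)" by (simp add: zero e0)
  have df: "(f has_field_derivative deriv f z) (at z)" if "z \<in> ball 0 R" for z
    using that by (intro holomorphic_derivI[OF hol]) auto
  have d2f: "(deriv f has_field_derivative deriv (deriv f) z) (at z)" if "z \<in> ball 0 R" for z
    using that by (intro holomorphic_derivI[OF holomorphic_deriv[OF hol]]) auto
  have d1: "deriv (\<lambda>z. exp (f z)) z = exp (f z) * deriv f z" if "z \<in> ball 0 R" for z
    by (intro DERIV_imp_deriv DERIV_fun_exp df that)
  have one: "fc f 1 = deriv f 0" and e1: "fc (\<lambda>z. exp (f z)) 1 = exp (f 0) * deriv f 0"
    using fc_ball_nonneg[OF hol R, of 1] fc_ball_nonneg[OF hole R, of 1] d1[of 0] R by (simp_all add: fps_expansion_def)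
  show "fc (\<lambda>z. exp (f z)) 1 = exp (fc f 0) * fc f 1" by (simp add: zero one e1)
  have "(deriv (\<lambda>z. exp (f z)) has_field_derivative exp (f 0) * deriv f 0 * deriv f 0 + deriv (deriv f) 0 * exp (f 0)) (at 0)"
  proof (rule has_field_derivative_transform_within_open[where S = "ball 0 R"])
    show "((\<lambda>z. exp (f z) * deriv f z) has_field_derivative exp (f 0) * deriv f 0 * deriv f 0 + deriv (deriv f) 0 * exp (f 0)) (at 0)"
      using R by (intro DERIV_mult DERIV_fun_exp df d2f) auto
  qed (use d1 R in auto)
  then have d2: "deriv (deriv (\<lambda>z. exp (f z))) 0 = exp (f 0) * deriv f 0 * deriv f 0 + deriv (deriv f) 0 * exp (f 0)"
    by (rule DERIV_imp_deriv)
  have two: "fc f 2 = deriv (deriv f) 0 / 2" and e2: "fc (\<lambda>z. exp (f z)) 2 = deriv (deriv (\<lambda>z. exp (f z))) 0 / 2"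
    using fc_ball_nonneg[OF hol R, of 2] fc_ball_nonneg[OF hole R, of 2] by (simp_all add: fps_expansion_def numeral_2_eq_2)
  show "fc (\<lambda>z. exp (f z)) 2 = exp (fc f 0) * (fc f 2 + (fc f 1)^2 / 2)"
    unfolding e2 d2 zero one two by (simp add: field_simps power2_eq_square)
qed

lemma wiener_cauchy_kernel:
  assumes "norm a \<noteq> 1"
  shows "wiener (\<lambda>z. 1 / (z - a))" "wiener (\<lambda>z. z / (z - a))"
proof -
  obtain R where R: "1 < R" "a \<notin> ann R"
  proof (cases "norm a < 1")
    case True
    show thesis
    proof (cases "a = 0")
      case True then show thesis by (intro that[of 2]) auto
    next
      case False
      with True show thesis by (intro that[of "inverse (norm a)"]) (auto simp: one_less_inverse_iff)
    qed
  next
    case False then show thesis using assms by (intro that[of "norm a"]) auto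
  qed
  have "(\<lambda>z. 1 / (z - a)) holomorphic_on ann R" "(\<lambda>z. z / (z - a)) holomorphic_on ann R"
    using R by (auto intro!: holomorphic_intros)
  then show "wiener (\<lambda>z. 1 / (z - a))" "wiener (\<lambda>z. z / (z - a))" using wiener_ann R(1) by blast+
qed

lemma cauchy_kernel_reflect:
  fixes z c :: complex
  assumes "norm z = 1" "c \<noteq> 0" "norm c \<noteq> 1"
  shows "1 / (z - c) = - (1 / c) * ((1 / z) / (1 / z - 1 / c))"
proof -
  have "z \<noteq> 0" "z - c \<noteq> 0" using assms by auto
  moreover have "1 / z - 1 / c = - ((z - c) / (z * c))"
    using assms \<open>z \<noteq> 0\<close> by (simp add: field_simps)
  ultimately show ?thesis using assms by (simp only: divide_minus_right) simp
qed

lemma fc_reflect_cauchy: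
  assumes hol: "f holomorphic_on ball 0 R" and R: "1 < R" and c: "c \<noteq> 0" "norm c \<noteq> 1"
  shows "fc (\<lambda>z. f (1 / z) * (1 / (z - c))) k = - (1 / c) * fc (\<lambda>z. f z * (z / (z - 1 / c))) (- k)"
proof -
  have c1: "norm (1 / c) \<noteq> 1" using c by (simp add: norm_divide divide_eq_1_iff)
  have w: "wiener (\<lambda>z. f z * (z / (z - 1 / c)))"
    by (rule wiener_mult[OF wiener_ball[OF hol R] wiener_cauchy_kernel(2)[OF c1]])
  have "fc (\<lambda>z. f (1 / z) * (1 / (z - c))) k = fc (\<lambda>z. - (1 / c) * (f (1 / z) * ((1 / z) / (1 / z - 1 / c)))) k"
  proof (intro fun_cong[OF fourier_coeff_cong])
    fix z :: complex assume z: "norm z = 1"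
    show "f (1 / z) * (1 / (z - c)) = - (1 / c) * (f (1 / z) * ((1 / z) / (1 / z - 1 / c)))"
      unfolding cauchy_kernel_reflect[OF z c] by (simp only: mult_ac)
  qed
  also have "\<dots> = - (1 / c) * fc (\<lambda>z. f (1 / z) * ((1 / z) / (1 / z - 1 / c))) k"
    by (rule fc_cmult[OF wiener_reflect[OF w]])
  also have "fc (\<lambda>z. f (1 / z) * ((1 / z) / (1 / z - 1 / c))) k = fc (\<lambda>z. f z * (z / (z - 1 / c))) (- k)"
    by (rule fc_reflect[OF w])
  finally show ?thesis .
qed

lemma fc_linear_combination:
  assumes "finite A" "wiener f1" "wiener f2" "wiener f3" "wiener f4" "wiener f5" "wiener f6"
    and "\<And>j. j \<in> A \<Longrightarrow> wiener (P j)" "\<And>j. j \<in> A \<Longrightarrow> wiener (Q j)"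
  shows "fc (\<lambda>z. a * f1 z + b * f2 z + c * f3 z + (\<Sum>j\<in>A. x j * P j z)
      + (d * f4 z + e * f5 z + g * f6 z + (\<Sum>j\<in>A. y j * Q j z))) k =
    a * fc f1 k + b * fc f2 k + c * fc f3 k + (\<Sum>j\<in>A. x j * fc (P j) k)
      + (d * fc f4 k + e * fc f5 k + g * fc f6 k + (\<Sum>j\<in>A. y j * fc (Q j) k))"
  using assms by (simp add: fc_add fc_cmult fc_sum wiener_add wiener_cmult wiener_sum)

context szego_factors
begin

definition \<alpha> :: "complex \<Rightarrow> complex" where
  "\<alpha> c = exp (inside Vp c - inside Vm (1 / c))"

definition sym :: "complex \<Rightarrow> complex" where "sym z = p z * m 1 z"

definition lh :: "complex \<Rightarrow> complex" where "lh z = exp (- Vm z)"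

lemma l_eq: "l 1 z = lh (1 / z)" by (simp add: l_def lh_def)

lemma hol_lh: "lh holomorphic_on ball 0 R" and hol_p: "p holomorphic_on ball 0 R"
  unfolding lh_def p_def by (intro holomorphic_intros Vm Vp)+

lemma w0: "w 0 = 0"
  using fc_ball_nonneg[OF Vm R, of 0] Vm0 by (simp add: w_def fps_expansion_def)

lemma fc_l: "fc (l 1) 0 = 1" "fc (l 1) (- 1) = - w 1" "0 < k \<Longrightarrow> fc (l 1) k = 0"
proof -
  have nV: "(\<lambda>z. - Vm z) holomorphic_on ball 0 R" by (intro holomorphic_intros Vm)
  have fn: "fc (\<lambda>z. - Vm z) k = - fc Vm k" for k
    using fc_cmult[OF wiener_ball[OF Vm R], of "-1"] by simp
  have refl: "fc (l 1) k = fc lh (- k)" for k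
    using fc_reflect[OF wiener_ball[OF hol_lh R], of k] by (simp add: l_eq[symmetric])
  have z: "fc Vm 0 = 0" using w0 by (simp add: w_def)
  show "fc (l 1) 0 = 1" unfolding refl lh_def using fc_exp(1)[OF nV R] by (simp add: fn z)
  show "fc (l 1) (- 1) = - w 1" unfolding refl lh_def using fc_exp(2)[OF nV R] by (simp add: fn z w_def)
  show "fc (l 1) k = 0" if "0 < k" using wsuppD(2)[OF wsupp_l[of 1], of k] that by simp
qed

lemma fc_p: "fc p 0 = exp (v 0)" "fc p 1 = exp (v 0) * v 1" "fc p 2 = exp (v 0) * (v 2 + (v 1)^2 / 2)"
  "fc p (- 1) = 0" "p 0 = exp (v 0)"
proof -
  show "fc p 0 = exp (v 0)" "fc p 1 = exp (v 0) * v 1" "fc p 2 = exp (v 0) * (v 2 + (v 1)^2 / 2)"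
    using fc_exp[OF Vp R] by (simp_all add: p_def[abs_def] v_def)
  show "fc p (- 1) = 0" using wsuppD(2)[OF wsupp_p, of "-1"] by simp
  show "p 0 = exp (v 0)" using fc_ball_nonneg[OF Vp R, of 0] by (simp add: p_def v_def fps_expansion_def)
qed

lemma alpha_inner: "c \<noteq> 0 \<Longrightarrow> norm c < 1 \<Longrightarrow> inside p c = \<alpha> c"
  by (simp add: inside_def p_def \<alpha>_def norm_divide)

lemma alpha_outer: "norm c > 1 \<Longrightarrow> inside lh (1 / c) = \<alpha> c"
  by (simp add: inside_def lh_def \<alpha>_def norm_divide divide_less_eq)

definition border_ok :: "border \<Rightarrow> bool" where
  "border_ok Bd \<longleftrightarrow> (\<forall>j\<in>{1..bord_m Bd}. bord_c Bd j \<noteq> 0 \<and> bord_c Bd j \<notin> ann R)"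

lemma border_okD:
  assumes "border_ok Bd" "j \<in> {1..bord_m Bd}"
  shows "bord_c Bd j \<noteq> 0" "bord_c Bd j \<notin> ann R" "norm (bord_c Bd j) \<noteq> 1"
proof -
  show "bord_c Bd j \<noteq> 0" and c: "bord_c Bd j \<notin> ann R" using assms by (auto simp: border_ok_def)
  have "inverse R < 1" using R by (simp add: inverse_less_1_iff)
  then show "norm (bord_c Bd j) \<noteq> 1" using c R by auto
qed

lemma holomorphic_border:
  assumes "border_ok Bd"
  shows "border_q1 Bd holomorphic_on ann R" "border_q2 Bd holomorphic_on ann R"
proof -
  have z: "z \<noteq> 0" if "z \<in> ann R" for z using that R by auto
  have c: "z - bord_c Bd j \<noteq> 0" if "z \<in> ann R" "j \<in> {1..bord_m Bd}" for z j
    using border_okD(2)[OF assms that(2)] that(1) by auto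
  show "border_q1 Bd holomorphic_on ann R"
    unfolding border_q1_def by (intro holomorphic_intros) (use z c in blast)+
  show "border_q2 Bd holomorphic_on ann R"
    unfolding border_q2_def by (intro holomorphic_intros) (use z c in blast)+
qed

lemma holomorphic_factors: "p holomorphic_on ann R" "q holomorphic_on ann R" "m t holomorphic_on ann R"
proof -
  have z: "1 / z \<in> ball 0 R" if "z \<in> ann R" for z
  proof -
    have "0 < norm z" using that R by (auto intro: less_trans[of 0 "inverse R"])
    then show ?thesis using that R by (simp add: norm_divide field_simps)
  qed
  have nz: "z \<noteq> 0" if "z \<in> ann R" for z using that R by auto
  have Vr: "(\<lambda>z. Vm (1 / z)) holomorphic_on ann R"
    by (rule holomorphic_on_compose_gen[of "\<lambda>z. 1 / z" "ann R" Vm "ball 0 R", unfolded o_def])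
      (use Vm z nz in \<open>auto intro!: holomorphic_intros\<close>)
  show "p holomorphic_on ann R" "q holomorphic_on ann R" "m t holomorphic_on ann R"
    unfolding p_def q_def m_def
    by (intro holomorphic_intros holomorphic_on_subset[OF Vp ball_subset_ann] Vr)+
qed

lemma border_psi_decay:
  assumes "border_ok Bd"
  obtains D where "wiener (border_psi sym Bd)" "decay D s (\<lambda>z. q z * border_psi sym Bd z)"
proof -
  have h: "border_psi sym Bd holomorphic_on ann R"
    unfolding border_psi_def[abs_def] sym_def by (intro holomorphic_intros holomorphic_border[OF assms] holomorphic_factors)
  have "(\<lambda>z. q z * border_psi sym Bd z) holomorphic_on ann R"
    by (intro holomorphic_intros h holomorphic_factors)
  then obtain D where "decay D s (\<lambda>z. q z * border_psi sym Bd z)"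
    using holomorphic_ann_bound s by blast
  then show thesis using that wiener_ann[OF h R] by blast
qed

lemma fc_border:
  assumes ok: "border_ok Bd"
  shows "fc (\<lambda>z. l 1 z * border_psi sym Bd z) k =
     bord_a0 Bd * fc p k + bord_a1 Bd * fc p (k - 1) + bord_b Bd 0 * fc p (k + 1)
     + (\<Sum>j=1..bord_m Bd. bord_b Bd j * fc (\<lambda>z. p z * (z / (z - bord_c Bd j))) k)
     + (bord_a0h Bd * fc (l 1) k + bord_a1h Bd * fc (l 1) (k - 1) + bord_bh Bd 0 * fc (l 1) (k + 1)
     + (\<Sum>j=1..bord_m Bd. bord_bh Bd j * fc (\<lambda>z. l 1 z * (1 / (z - bord_c Bd j))) k))"
proof -
  have W: "wiener p" "wiener (l 1)" using wnorm_le_K[of 1] by auto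
  let ?A = "{1..bord_m Bd}"
  have W1: "wiener (\<lambda>z. p z * (z / (z - bord_c Bd j)))" "wiener (\<lambda>z. l 1 z * (1 / (z - bord_c Bd j)))"
    if "j \<in> ?A" for j
    by (rule wiener_mult[OF W(1) wiener_cauchy_kernel(2)] wiener_mult[OF W(2) wiener_cauchy_kernel(1)],
        rule border_okD(3)[OF ok that])+
  have eq: "l 1 z * border_psi sym Bd z =
     bord_a0 Bd * p z + bord_a1 Bd * (p z * z powi 1) + bord_b Bd 0 * (p z * z powi (- 1))
     + (\<Sum>j\<in>?A. bord_b Bd j * (p z * (z / (z - bord_c Bd j))))
     + (bord_a0h Bd * l 1 z + bord_a1h Bd * (l 1 z * z powi 1) + bord_bh Bd 0 * (l 1 z * z powi (- 1))
     + (\<Sum>j\<in>?A. bord_bh Bd j * (l 1 z * (1 / (z - bord_c Bd j)))))" for z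
  proof -
    have "l 1 z * border_psi sym Bd z = (m 1 z * l 1 z) * (p z * border_q1 Bd z) + l 1 z * border_q2 Bd z"
      by (simp add: border_psi_def sym_def algebra_simps)
    also have "\<dots> = p z * border_q1 Bd z + l 1 z * border_q2 Bd z" by (simp add: ml)
    finally show ?thesis
      by (simp add: border_q1_def border_q2_def power_int_minus divide_inverse distrib_left sum_distrib_left mult_ac)
  qed
  have Wp: "wiener (\<lambda>z. p z * z powi i)" "wiener (\<lambda>z. l 1 z * z powi i)" for i
    by (intro wiener_mult wiener_powi W)+
  have "fc (\<lambda>z. l 1 z * border_psi sym Bd z) k =
     bord_a0 Bd * fc p k + bord_a1 Bd * fc (\<lambda>z. p z * z powi 1) k + bord_b Bd 0 * fc (\<lambda>z. p z * z powi (- 1)) k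
     + (\<Sum>j\<in>?A. bord_b Bd j * fc (\<lambda>z. p z * (z / (z - bord_c Bd j))) k)
     + (bord_a0h Bd * fc (l 1) k + bord_a1h Bd * fc (\<lambda>z. l 1 z * z powi 1) k + bord_bh Bd 0 * fc (\<lambda>z. l 1 z * z powi (- 1)) k
     + (\<Sum>j\<in>?A. bord_bh Bd j * fc (\<lambda>z. l 1 z * (1 / (z - bord_c Bd j))) k))"
    unfolding eq by (rule fc_linear_combination[OF _ W(1) Wp(1) Wp(1) W(2) Wp(2) Wp(2) W1]) auto
  then show ?thesis unfolding fc_powi_mult[OF W(1)] fc_powi_mult[OF W(2)] by simp
qed

lemma border_sums:
  assumes ok: "border_ok Bd"
  shows "(\<Sum>j=1..bord_m Bd. f j * inside p (bord_c Bd j)) = (\<Sum>j\<in>inner_poles Bd. f j * \<alpha> (bord_c Bd j))"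
    and "(\<Sum>j=1..bord_m Bd. f j * inside lh (1 / bord_c Bd j)) = (\<Sum>j\<in>outer_poles Bd. f j * \<alpha> (bord_c Bd j))"
proof -
  note c = border_okD[OF ok]
  have "(\<Sum>j=1..bord_m Bd. f j * inside p (bord_c Bd j))
     = (\<Sum>j=1..bord_m Bd. if 0 < cmod (bord_c Bd j) \<and> cmod (bord_c Bd j) < 1 then f j * \<alpha> (bord_c Bd j) else 0)"
  proof (intro sum.cong refl)
    fix j assume j: "j \<in> {1..bord_m Bd}"
    show "f j * inside p (bord_c Bd j) = (if 0 < cmod (bord_c Bd j) \<and> cmod (bord_c Bd j) < 1 then f j * \<alpha> (bord_c Bd j) else 0)"
      using c[OF j] alpha_inner[of "bord_c Bd j"] by (auto simp: inside_def)
  qed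
  also have "\<dots> = (\<Sum>j\<in>inner_poles Bd. f j * \<alpha> (bord_c Bd j))"
    by (rule sum.inter_filter[symmetric]) simp
  finally show "(\<Sum>j=1..bord_m Bd. f j * inside p (bord_c Bd j)) = (\<Sum>j\<in>inner_poles Bd. f j * \<alpha> (bord_c Bd j))" .
  have "(\<Sum>j=1..bord_m Bd. f j * inside lh (1 / bord_c Bd j))
     = (\<Sum>j=1..bord_m Bd. if cmod (bord_c Bd j) > 1 then f j * \<alpha> (bord_c Bd j) else 0)"
  proof (intro sum.cong refl)
    fix j assume j: "j \<in> {1..bord_m Bd}"
    show "f j * inside lh (1 / bord_c Bd j) = (if cmod (bord_c Bd j) > 1 then f j * \<alpha> (bord_c Bd j) else 0)"
    proof (cases "cmod (bord_c Bd j) > 1")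
      case True then show ?thesis using alpha_outer by simp
    next
      case False
      then have "\<not> norm (1 / bord_c Bd j) < 1" using c(1)[OF j] by (simp add: norm_divide)
      then show ?thesis using False by (simp add: inside_def)
    qed
  qed
  also have "\<dots> = (\<Sum>j\<in>outer_poles Bd. f j * \<alpha> (bord_c Bd j))"
    by (rule sum.inter_filter[symmetric]) simp
  finally show "(\<Sum>j=1..bord_m Bd. f j * inside lh (1 / bord_c Bd j)) = (\<Sum>j\<in>outer_poles Bd. f j * \<alpha> (bord_c Bd j))" .
qed

context
  fixes \<phi> :: "complex \<Rightarrow> complex"
  assumes log: "\<And>z. norm z = 1 \<Longrightarrow> log_symbol \<phi> z = Vp z + Vm (1 / z)"
begin

lemma log_coeff_eq: "log_coeff \<phi> (int k) = v k" "0 < k \<Longrightarrow> log_coeff \<phi> (- int k) = w k"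
proof -
  have W: "wiener Vp" "wiener Vm" using Vp Vm R wiener_ball by auto
  have eq: "log_coeff \<phi> k = fc Vp k + fc Vm (- k)" for k
    using fourier_coeff_cong[OF log] W by (simp add: fc_add wiener_reflect fc_reflect)
  have neg: "fc Vp k = 0" "fc Vm k = 0" if "k < 0" for k
    using fc_ball_neg[OF Vp R that] fc_ball_neg[OF Vm R that] by auto
  show "log_coeff \<phi> (int k) = v k"
    unfolding eq v_def using neg(2)[of "- int k"] w0 by (cases "k = 0") (auto simp: w_def)
  show "0 < k \<Longrightarrow> log_coeff \<phi> (- int k) = w k"
    unfolding eq w_def using neg(1)[of "- int k"] by simp
qed

lemma szego_G_eq: "szego_G \<phi> = fc p 0" and szego_alpha_0: "szego_alpha \<phi> 0 = fc p 0"
proof -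
  show G: "szego_G \<phi> = fc p 0" using log_coeff_eq(1)[of 0] by (simp add: szego_G_def fc_p)
  have cont: "continuous_on (sphere 0 1) (\<lambda>z. Vp z + Vm (1 / z))"
  proof -
    have c: "continuous_on (ball 0 R) Vp" "continuous_on (ball 0 R) Vm"
      using Vp Vm by (auto intro: holomorphic_on_imp_continuous_on)
    show ?thesis
      by (intro continuous_intros continuous_on_subset[OF c(1)] continuous_on_compose2[OF c(2)])
        (use R in \<open>auto simp: norm_divide\<close>)
  qed
  have "log_coeff \<phi> 0 = cint 1 (\<lambda>\<tau>. 1 / (2 * of_real pi * \<i>) * ((Vp \<tau> + Vm (1 / \<tau>)) / (\<tau> - 0)))"
    unfolding fourier_coeff_def by (rule contour_integral_eq) (auto simp: log)
  also have "\<dots> = 1 / (2 * of_real pi * \<i>) * cint 1 (\<lambda>\<tau>. (Vp \<tau> + Vm (1 / \<tau>)) / (\<tau> - 0))"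
    by (intro contour_integral_lmul contour_integrable_continuous_circlepath continuous_on_divide)
      (auto intro: cont continuous_intros simp: path_image_circlepath)
  also have "cint 1 (\<lambda>\<tau>. (Vp \<tau> + Vm (1 / \<tau>)) / (\<tau> - 0)) =
    cint 1 (\<lambda>\<tau>. log_symbol \<phi> \<tau> / (\<tau> - 0))"
    by (rule contour_integral_eq) (auto simp: log)
  finally show "szego_alpha \<phi> 0 = fc p 0" using G by (simp add: szego_alpha_def szego_G_def)
qed

lemma szego_alpha_eq:
  assumes c: "c \<noteq> 0" "norm c \<noteq> 1"
  shows "szego_alpha \<phi> c = \<alpha> c"
proof -
  have c1: "norm (1 / c) \<noteq> 1" using c by (simp add: norm_divide divide_eq_1_iff)
  have W: "wiener Vp" "wiener Vm" using Vp Vm R wiener_ball by auto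
  note K = wiener_cauchy_kernel[OF c(2)]
  have W2: "wiener (\<lambda>z. Vm (1 / z) * (1 / (z - c)))" by (intro wiener_mult wiener_reflect W K)
  define f where "f = (\<lambda>z. Vp z * (z / (z - c)) + Vm (1 / z) * (1 / (z - c)) * z powi 1)"
  have zc: "z - c \<noteq> 0" if "norm z = 1" for z using that c by auto
  have f_cont: "continuous_on (sphere 0 1) f"
  proof -
    have cc: "continuous_on (ball 0 R) Vp" "continuous_on (ball 0 R) Vm"
      using Vp Vm by (auto intro: holomorphic_on_imp_continuous_on)
    show ?thesis unfolding f_def
      by (intro continuous_intros continuous_on_subset[OF cc(1)] continuous_on_compose2[OF cc(2)])
        (use R zc in \<open>auto simp: norm_divide\<close>)
  qed
  have "fc f 0 = cint 1 (\<lambda>z. 1 / (2 * of_real pi * \<i>) * (f z / z))"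
    unfolding fourier_coeff_def by (rule contour_integral_eq) auto
  also have "\<dots> = 1 / (2 * of_real pi * \<i>) * cint 1 (\<lambda>z. f z / z)"
    by (intro contour_integral_lmul contour_integrable_continuous_circlepath continuous_on_divide)
      (auto intro: f_cont continuous_intros)
  also have "cint 1 (\<lambda>z. f z / z) = cint 1 (\<lambda>\<tau>. log_symbol \<phi> \<tau> / (\<tau> - c))"
  proof (rule contour_integral_eq)
    fix z assume "z \<in> path_image (circlepath 0 1)"
    then have z: "norm z = 1" "z \<noteq> 0" by auto
    have "f z = (Vp z + Vm (1 / z)) * (z / (z - c))" by (simp add: f_def distrib_right add_divide_distrib)
    then show "f z / z = log_symbol \<phi> z / (z - c)" unfolding log[OF z(1)] using z by simp
  qed
  finally have a: "szego_alpha \<phi> c = exp (fc f 0)" by (simp add: szego_alpha_def)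
  have "fc f 0 = fc (\<lambda>z. Vp z * (z / (z - c))) 0 + fc (\<lambda>z. Vm (1 / z) * (1 / (z - c))) (- 1)"
    unfolding f_def fc_add[OF wiener_mult[OF W(1) K(2)] wiener_mult[OF W2 wiener_powi]] fc_powi_mult[OF W2]
    by simp
  also have "fc (\<lambda>z. Vp z * (z / (z - c))) 0 = inside Vp c" by (rule fc_cauchy_0[OF Vp R c(2)])
  also have "fc (\<lambda>z. Vm (1 / z) * (1 / (z - c))) (- 1) = - inside Vm (1 / c)"
    unfolding fc_reflect_cauchy[OF Vm R c] using fc_cauchy_1[OF Vm R c1] c Vm0 by simp
  finally show ?thesis unfolding a \<alpha>_def by simp
qed

lemma fc_border_F:
  assumes ok: "border_ok Bd"
  shows "fc (\<lambda>z. l 1 z * border_psi sym Bd z) 0 = fc p 0 * border_F \<phi> Bd"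
proof -
  let ?A = "{1..bord_m Bd}"
  have G0: "fc p 0 \<noteq> 0" by (simp add: fc_p)
  note c = border_okD[OF ok]
  have 1: "(\<Sum>j\<in>?A. bord_b Bd j * fc (\<lambda>z. p z * (z / (z - bord_c Bd j))) 0) = (\<Sum>j\<in>inner_poles Bd. bord_b Bd j * \<alpha> (bord_c Bd j))"
    unfolding border_sums[OF ok, symmetric] by (intro sum.cong refl) (use fc_cauchy_0[OF hol_p R c(3)] in simp)
  have "fc (\<lambda>z. l 1 z * (1 / (z - bord_c Bd j))) 0 = - (1 / bord_c Bd j) * inside lh (1 / bord_c Bd j)" if j: "j \<in> ?A" for j
  proof -
    have c1: "norm (1 / bord_c Bd j) \<noteq> 1" using c(1,3)[OF j] by (simp add: norm_divide divide_eq_1_iff)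
    show ?thesis unfolding l_eq fc_reflect_cauchy[OF hol_lh R c(1)[OF j] c(3)[OF j]] using fc_cauchy_0[OF hol_lh R c1] by simp
  qed
  then have "(\<Sum>j\<in>?A. bord_bh Bd j * fc (\<lambda>z. l 1 z * (1 / (z - bord_c Bd j))) 0)
      = - (\<Sum>j\<in>?A. bord_bh Bd j / bord_c Bd j * inside lh (1 / bord_c Bd j))"
    unfolding sum_negf[symmetric] by (intro sum.cong refl) simp
  then have 2: "(\<Sum>j\<in>?A. bord_bh Bd j * fc (\<lambda>z. l 1 z * (1 / (z - bord_c Bd j))) 0)
      = - (\<Sum>j\<in>outer_poles Bd. bord_bh Bd j / bord_c Bd j * \<alpha> (bord_c Bd j))"
    unfolding border_sums[OF ok] .
  have al: "(\<Sum>j\<in>inner_poles Bd. bord_b Bd j * (szego_alpha \<phi> (bord_c Bd j) / fc p 0))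
      = (\<Sum>j\<in>inner_poles Bd. bord_b Bd j * \<alpha> (bord_c Bd j)) / fc p 0"
    "(\<Sum>j\<in>outer_poles Bd. bord_bh Bd j / bord_c Bd j * szego_alpha \<phi> (bord_c Bd j))
      = (\<Sum>j\<in>outer_poles Bd. bord_bh Bd j / bord_c Bd j * \<alpha> (bord_c Bd j))"
    by (auto simp: sum_divide_distrib c szego_alpha_eq intro!: sum.cong)
  show ?thesis
    unfolding fc_border[OF ok] 1 2 border_F_def szego_alpha_0 al
    using log_coeff_eq(1)[of 1] log_coeff_eq(2)[of 1] G0
    by (simp add: fc_p fc_l) (simp add: field_simps)
qed

lemma fc_border_H:
  assumes ok: "border_ok Bd"
  shows "fc (\<lambda>z. l 1 z * border_psi sym Bd z) 1 = fc p 0 * border_H \<phi> Bd"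
proof -
  let ?A = "{1..bord_m Bd}"
  have G0: "fc p 0 \<noteq> 0" by (simp add: fc_p)
  note c = border_okD[OF ok]
  have "(\<Sum>j\<in>?A. bord_b Bd j * fc (\<lambda>z. p z * (z / (z - bord_c Bd j))) 1)
      = (\<Sum>j\<in>?A. bord_b Bd j / bord_c Bd j * inside p (bord_c Bd j) - bord_b Bd j / bord_c Bd j * fc p 0)"
  proof (intro sum.cong refl)
    fix j assume j: "j \<in> ?A"
    show "bord_b Bd j * fc (\<lambda>z. p z * (z / (z - bord_c Bd j))) 1
      = bord_b Bd j / bord_c Bd j * inside p (bord_c Bd j) - bord_b Bd j / bord_c Bd j * fc p 0"
      unfolding fc_cauchy_1[OF hol_p R c(3)[OF j] c(1)[OF j]] by (simp add: fc_p diff_divide_distrib right_diff_distrib)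
  qed
  then have 1: "(\<Sum>j\<in>?A. bord_b Bd j * fc (\<lambda>z. p z * (z / (z - bord_c Bd j))) 1)
      = (\<Sum>j\<in>inner_poles Bd. bord_b Bd j / bord_c Bd j * \<alpha> (bord_c Bd j)) - (\<Sum>j\<in>?A. bord_b Bd j / bord_c Bd j) * fc p 0"
    unfolding sum_subtractf border_sums[OF ok] sum_distrib_right .
  have "fc (\<lambda>z. l 1 z * (1 / (z - bord_c Bd j))) 1 = - (1 / (bord_c Bd j)^2) * inside lh (1 / bord_c Bd j)" if j: "j \<in> ?A" for j
  proof -
    have c1: "norm (1 / bord_c Bd j) \<noteq> 1" using c(1,3)[OF j] by (simp add: norm_divide divide_eq_1_iff)
    show ?thesis unfolding l_eq fc_reflect_cauchy[OF hol_lh R c(1)[OF j] c(3)[OF j]] using fc_cauchy_neg1[OF hol_lh R c1]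
      by (simp add: power2_eq_square)
  qed
  then have "(\<Sum>j\<in>?A. bord_bh Bd j * fc (\<lambda>z. l 1 z * (1 / (z - bord_c Bd j))) 1)
      = - (\<Sum>j\<in>?A. bord_bh Bd j / (bord_c Bd j)^2 * inside lh (1 / bord_c Bd j))"
    unfolding sum_negf[symmetric] by (intro sum.cong refl) simp
  then have 2: "(\<Sum>j\<in>?A. bord_bh Bd j * fc (\<lambda>z. l 1 z * (1 / (z - bord_c Bd j))) 1)
      = - (\<Sum>j\<in>outer_poles Bd. bord_bh Bd j / (bord_c Bd j)^2 * \<alpha> (bord_c Bd j))"
    unfolding border_sums[OF ok] .
  have al: "(\<Sum>j\<in>inner_poles Bd. bord_b Bd j / bord_c Bd j * szego_alpha \<phi> (bord_c Bd j))
      = (\<Sum>j\<in>inner_poles Bd. bord_b Bd j / bord_c Bd j * \<alpha> (bord_c Bd j))"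
    "(\<Sum>j\<in>outer_poles Bd. bord_bh Bd j / (bord_c Bd j)^2 * szego_alpha \<phi> (bord_c Bd j))
      = (\<Sum>j\<in>outer_poles Bd. bord_bh Bd j / (bord_c Bd j)^2 * \<alpha> (bord_c Bd j))"
    by (auto simp: c szego_alpha_eq intro!: sum.cong)
  show ?thesis
    unfolding fc_border[OF ok] 1 2 border_H_def al szego_G_eq
    using log_coeff_eq(1)[of 1] log_coeff_eq(1)[of 2] G0
    by (simp add: fc_p fc_l) (simp add: field_simps)
qed

lemma szego_E_eq: "szego_E \<phi> = exp \<kappa>"
proof -
  have "of_nat k * log_coeff \<phi> (int k) * log_coeff \<phi> (- int k) = of_nat k * v k * w k" for k :: nat
    using log_coeff_eq(1)[of k] log_coeff_eq(2)[of k] by (cases "k = 0") auto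
  then show ?thesis by (simp only: szego_E_def \<kappa>_def)
qed

lemma bordered_szego_asymp:
  assumes B1: "border_ok B1" and B2: "border_ok B2"
  shows "\<exists>C. eventually (\<lambda>n. \<exists>r. norm r \<le> C * inverse \<rho> ^ n \<and>
     bordered_toeplitz_det sym (border_psi sym B1) (border_psi sym B2) n =
       szego_G \<phi> ^ n * szego_E \<phi> * (border_J1 \<phi> B1 B2 + r)) sequentially"
proof -
  let ?f1 = "border_psi sym B1" and ?f2 = "border_psi sym B2" and ?G = "fc p 0"
  let ?D = "bordered_toeplitz_det sym ?f1 ?f2" and ?L = "limit_det ?f1 ?f2"
  obtain D1 where D1: "wiener ?f1" "decay D1 s (\<lambda>z. q z * ?f1 z)"
    using border_psi_decay[OF B1] by blast
  obtain D2 where D2: "wiener ?f2" "decay D2 s (\<lambda>z. q z * ?f2 z)"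
    using border_psi_decay[OF B2] by blast
  obtain C1 where C1: "\<And>n. 2 \<le> n \<Longrightarrow> small n \<Longrightarrow> \<exists>\<delta>. norm \<delta> \<le> C1 * s powi (- 2 * int n) \<and>
     ?D n =
       Determinant.det (toep sym n) * (?L + \<delta>) / (?G)^2"
    using bordered_asymp[OF D1 D2] unfolding sym_def[symmetric, abs_def] by blast
  obtain C2 where C2: "eventually (\<lambda>n. \<exists>\<delta>. norm \<delta> \<le> C2 * inverse \<rho> ^ n \<and>
     Determinant.det (toep sym n) = ?G ^ n * exp \<kappa> * (1 + \<delta>)) sequentially"
    using szego_asymp unfolding sym_def[symmetric, abs_def] by blast
  have G0: "?G \<noteq> 0" by (simp add: fc_p)
  have J: "?L = (?G)^2 * border_J1 \<phi> B1 B2"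
  proof -
    have J1: "border_J1 \<phi> B1 B2 = border_F \<phi> B2 * border_H \<phi> B1 - border_F \<phi> B1 * border_H \<phi> B2"
      unfolding border_J1_def by (subst det_2x2) (auto simp: mat_of_rows_list_def)
    show ?thesis
      unfolding J1 limit_det_def fc_border_F[OF B1] fc_border_F[OF B2] fc_border_H[OF B1] fc_border_H[OF B2]
      by (simp add: power2_eq_square algebra_simps)
  qed
  define J where "J = border_J1 \<phi> B1 B2"
  define a where "a = max C1 0 / norm (?G)^2"
  define C where "C = a + max C2 0 * (norm J + a)"
  have a0: "0 \<le> a" by (simp add: a_def)
  have "eventually (\<lambda>n. \<exists>r. norm r \<le> C * inverse \<rho> ^ n \<and>
     ?D n =
       szego_G \<phi> ^ n * szego_E \<phi> * (J + r)) sequentially"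
    using C2 eventually_small eventually_ge_at_top[of 2]
  proof eventually_elim
    case (elim n)
    obtain \<delta> where \<delta>: "norm \<delta> \<le> C2 * inverse \<rho> ^ n" "Determinant.det (toep sym n) = ?G ^ n * exp \<kappa> * (1 + \<delta>)"
      using elim(1) by blast
    obtain \<epsilon> where \<epsilon>: "norm \<epsilon> \<le> C1 * s powi (- 2 * int n)" "?D n =
       Determinant.det (toep sym n) * (?L + \<epsilon>) / (?G)^2"
      using C1[OF elim(3,2)] by blast
    define y where "y = inverse \<rho> ^ n"
    have y: "0 \<le> y" "y \<le> 1" using \<rho> by (auto simp: y_def inverse_le_1_iff intro!: power_le_one)
    have "s powi (- 2 * int n) = s powi (- int (2 * n))" by simp
    also have "\<dots> = inverse (s^2) ^ n" by (simp only: power_int_minus power_int_of_nat power_mult power_inverse)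
    also have "\<dots> \<le> y" unfolding y_def using \<rho> s by (intro power_mono le_imp_inverse_le) auto
    finally have sy: "s powi (- 2 * int n) \<le> y" .
    define \<eta> where "\<eta> = \<epsilon> / (?G)^2"
    have "C1 * s powi (- 2 * int n) \<le> max C1 0 * y"
      using sy s by (intro mult_mono) auto
    with \<epsilon>(1) have "norm \<epsilon> \<le> max C1 0 * y" by (rule order_trans)
    then have \<eta>: "norm \<eta> \<le> a * y"
      unfolding \<eta>_def a_def norm_divide norm_power times_divide_eq_left
      by (intro divide_right_mono) auto
    have \<eta>a: "norm \<eta> \<le> a" using \<eta> mult_left_mono[OF y(2) a0] by simp
    have \<delta>y: "norm \<delta> \<le> max C2 0 * y"
      using \<delta>(1) y(1) mult_right_mono[of C2 "max C2 0" y] by (simp add: y_def)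
    define r where "r = \<eta> + \<delta> * (J + \<eta>)"
    have "norm r \<le> norm \<eta> + norm \<delta> * (norm J + norm \<eta>)"
      unfolding r_def by (intro norm_triangle_le add_left_mono) (simp add: norm_mult mult_left_mono norm_triangle_ineq)
    also have "\<dots> \<le> a * y + (max C2 0 * y) * (norm J + a)"
      using \<eta> \<delta>y \<eta>a y by (intro add_mono mult_mono) auto
    also have "\<dots> = C * y" by (simp add: C_def algebra_simps)
    finally have "norm r \<le> C * inverse \<rho> ^ n" by (simp add: y_def)
    moreover have "?D n = szego_G \<phi> ^ n * szego_E \<phi> * (J + r)"
    proof -
      have "(?L + \<epsilon>) / (?G)^2 = J + \<eta>"
        unfolding J J_def[symmetric] \<eta>_def using G0 by (simp add: add_divide_distrib)
      then have "?D n = ?G ^ n * exp \<kappa> * (1 + \<delta>) * (J + \<eta>)"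
        unfolding \<epsilon>(2) \<delta>(2) by (simp only: times_divide_eq_right[symmetric])
      also have "\<dots> = ?G ^ n * exp \<kappa> * (J + r)" by (simp add: r_def algebra_simps)
      finally show ?thesis by (simp add: szego_G_eq szego_E_eq)
    qed
    ultimately show ?case by blast
  qed
  then show ?thesis unfolding J_def by blast
qed

end

end

section \<open>Asymptotics of the two-bordered determinant\<close>

lemma admissible_radius_exists:
  assumes \<phi>: "szego_type \<phi>" and B1: "poles_ok B1" and B2: "poles_ok B2"
  shows "\<exists>\<rho>. admissible_radius \<phi> B1 B2 \<rho>"
proof -
  obtain U \<Phi> where U: "open U" "unit_circle \<subseteq> U" "\<Phi> holomorphic_on U" "\<And>z. z \<in> unit_circle \<Longrightarrow> \<Phi> z = \<phi> z"
    and nz: "\<And>z. z \<in> unit_circle \<Longrightarrow> \<phi> z \<noteq> 0"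
    using \<phi> unfolding szego_type_def by blast
  define W where "W = {z \<in> U. \<Phi> z \<noteq> 0}"
  have "open (U \<inter> \<Phi> -` (- {0}))"
    by (intro continuous_open_preimage[OF holomorphic_on_imp_continuous_on[OF U(3)] U(1)]) auto
  moreover have "W = U \<inter> \<Phi> -` (- {0})" by (auto simp: W_def)
  ultimately have "open W" by simp
  moreover have "unit_circle \<subseteq> W" using U nz by (auto simp: W_def)
  ultimately obtain e where e: "0 < e" "(\<Union>x\<in>unit_circle. ball x e) \<subseteq> W"
    using compact_subset_open_imp_ball_epsilon_subset[of unit_circle W] by auto
  define b where "b x = (if x > 1 then x else inverse x)" for x :: real
  define S where "S = insert (1 + e) (\<Union>Bd\<in>{B1, B2}. (\<lambda>j. b (norm (bord_c Bd j))) ` {1..bord_m Bd})"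
  have fin: "finite S" "S \<noteq> {}" by (auto simp: S_def)
  have b1: "1 < b (norm (bord_c Bd j))" if "Bd \<in> {B1, B2}" "j \<in> {1..bord_m Bd}" for Bd j
  proof -
    have "bord_c Bd j \<noteq> 0" "norm (bord_c Bd j) \<noteq> 1" using that B1 B2 by (auto simp: poles_ok_def)
    then show ?thesis by (auto simp: b_def one_less_inverse_iff)
  qed
  have "1 < Min S" using fin e(1) b1 by (auto simp: Min_gr_iff) (auto simp: S_def)
  then obtain \<rho> where \<rho>: "1 < \<rho>" "\<rho> < Min S" using dense by blast
  have less: "\<rho> < x" if "x \<in> S" for x using \<rho>(2) Min_le[OF fin(1) that] by linarith
  have annW: "ann \<rho> \<subseteq> W"
  proof
    fix z assume z: "z \<in> ann \<rho>"
    have "2 - \<rho> \<le> inverse \<rho>"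
    proof -
      have "(2 - \<rho>) * \<rho> \<le> 1" using zero_le_power2[of "\<rho> - 1"] by (simp add: power2_eq_square algebra_simps)
      then show ?thesis using \<rho>(1) by (simp add: field_simps)
    qed
    moreover have "\<rho> < 1 + e" by (rule less) (simp add: S_def)
    ultimately have "\<bar>norm z - 1\<bar> < e" using z by auto
    have z0: "z \<noteq> 0" using z \<rho>(1) by auto
    define x where "x = z / of_real (norm z)"
    have "norm x = 1" using z0 by (simp add: x_def norm_divide)
    moreover have "dist x z = \<bar>norm z - 1\<bar>"
    proof -
      have "z - x = of_real (norm z - 1) * x" using z0 by (simp add: x_def field_simps)
      then have "norm (z - x) = \<bar>norm z - 1\<bar> * norm x" by (simp only: norm_mult norm_of_real)
      then show ?thesis using \<open>norm x = 1\<close> by (simp add: dist_norm norm_minus_commute)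
    qed
    ultimately have "x \<in> unit_circle" "z \<in> ball x e" using \<open>\<bar>norm z - 1\<bar> < e\<close> by simp_all
    then show "z \<in> W" using e(2) by blast
  qed
  have poles: "(cmod (bord_c Bd j) > 1 \<longrightarrow> \<rho> < cmod (bord_c Bd j)) \<and>
        (0 < cmod (bord_c Bd j) \<and> cmod (bord_c Bd j) < 1 \<longrightarrow> cmod (bord_c Bd j) < inverse \<rho>)"
    if "Bd \<in> {B1, B2}" "j \<in> {1..bord_m Bd}" for Bd j
  proof -
    have l: "\<rho> < b (norm (bord_c Bd j))" by (rule less) (use that in \<open>auto simp: S_def\<close>)
    show ?thesis
    proof (intro conjI impI)
      show "\<rho> < cmod (bord_c Bd j)" if "cmod (bord_c Bd j) > 1" using l that by (simp add: b_def)
      assume c: "0 < cmod (bord_c Bd j) \<and> cmod (bord_c Bd j) < 1"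
      then have "\<rho> < inverse (cmod (bord_c Bd j))" using l by (simp add: b_def)
      then have "inverse (inverse (cmod (bord_c Bd j))) < inverse \<rho>"
        using \<rho>(1) by (intro less_imp_inverse_less) auto
      then show "cmod (bord_c Bd j) < inverse \<rho>" by simp
    qed
  qed
  have "\<Phi> holomorphic_on ann \<rho>" by (rule holomorphic_on_subset[OF U(3)]) (use annW in \<open>auto simp: W_def\<close>)
  moreover have "\<forall>z. inverse \<rho> < cmod z \<and> cmod z < \<rho> \<longrightarrow> \<Phi> z \<noteq> 0" using annW by (auto simp: W_def)
  ultimately have "admissible_radius \<phi> B1 B2 \<rho>"
    unfolding admissible_radius_def using \<rho>(1) poles U(4) by blast
  then show ?thesis by blast
qed

lemma bordered_toeplitz_det_cong:
  assumes "\<And>z. norm z = 1 \<Longrightarrow> f z = f' z" "\<And>z. norm z = 1 \<Longrightarrow> g z = g' z" "\<And>z. norm z = 1 \<Longrightarrow> h z = h' z"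
  shows "bordered_toeplitz_det f g h n = bordered_toeplitz_det f' g' h' n"
proof -
  have e: "fc f = fc f'" "fc g = fc g'" "fc h = fc h'" by (rule fourier_coeff_cong, rule assms, assumption)+
  show ?thesis unfolding bordered_toeplitz_det_def bordered_toeplitz_matrix_def e by (rule refl)
qed

lemma bordered_toeplitz_asymp:
  assumes \<phi>: "szego_type \<phi>" and B1: "poles_ok B1" and B2: "poles_ok B2"
    and adm: "admissible_radius \<phi> B1 B2 \<rho>"
  shows "\<exists>C. eventually (\<lambda>n. \<exists>r. norm r \<le> C * inverse \<rho> ^ n \<and>
     bordered_toeplitz_det \<phi> (border_psi \<phi> B1) (border_psi \<phi> B2) n =
       szego_G \<phi> ^ n * szego_E \<phi> * (border_J1 \<phi> B1 B2 + r)) sequentially"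
proof -
  have \<rho>: "1 < \<rho>" using adm by (simp add: admissible_radius_def)
  obtain \<Phi> where \<Phi>: "\<Phi> holomorphic_on ann \<rho>" "\<And>z. norm z = 1 \<Longrightarrow> \<Phi> z = \<phi> z" "\<And>z. z \<in> ann \<rho> \<Longrightarrow> \<Phi> z \<noteq> 0"
    using adm unfolding admissible_radius_def by auto
  have wn: "winding_number (\<phi> \<circ> circlepath 0 1) 0 = 0" using \<phi> by (simp add: szego_type_def)
  obtain V where V: "V holomorphic_on ann \<rho>" "\<And>z. norm z = 1 \<Longrightarrow> V z = log_symbol \<phi> z"
    "\<And>z. norm z = 1 \<Longrightarrow> exp (V z) = \<phi> z"
    by (rule log_symbol_holomorphic_ext[OF \<rho> \<Phi>(1,3) wn \<Phi>(2)]) (rule that | assumption)+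
  have "sqrt \<rho> < \<rho>" using \<rho> by (simp add: real_less_lsqrt power2_eq_square)
  then obtain s where s: "sqrt \<rho> < s" "s < \<rho>" using dense by blast
  obtain R where Rs: "s < R" "R < \<rho>" using dense[OF s(2)] by blast
  have "1 < sqrt \<rho>" using \<rho> by simp
  then have s1: "1 < s" using s by linarith
  then have R1: "1 < R" using Rs by linarith
  have s2: "\<rho> < s^2"
  proof -
    have "(sqrt \<rho>)^2 < s^2" using s \<open>1 < sqrt \<rho>\<close> by (intro power_strict_mono) auto
    then show ?thesis using \<rho> by simp
  qed
  obtain Vp Vm where Vpm: "Vp holomorphic_on ball 0 R" "Vm holomorphic_on ball 0 R" "Vm 0 = 0"
    "\<And>z. norm z = 1 \<Longrightarrow> V z = Vp z + Vm (1 / z)"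
    using laurent_split[OF V(1) R1 Rs(2)] by metis
  obtain b1 where b1: "\<And>z. norm z \<le> s \<Longrightarrow> norm (Vp z) \<le> b1"
    using holomorphic_ball_bounded[OF Vpm(1) Rs(1)] by blast
  obtain b2 where b2: "\<And>z. norm z \<le> s \<Longrightarrow> norm (Vm z) \<le> b2"
    using holomorphic_ball_bounded[OF Vpm(2) Rs(1)] by blast
  interpret szego_factors R s \<rho> "max b1 b2" Vp Vm
    by unfold_locales (use s1 Rs \<rho> s2 Vpm b1 b2 in \<open>auto simp: le_max_iff_disj\<close>)
  have log: "log_symbol \<phi> z = Vp z + Vm (1 / z)" if "norm z = 1" for z
    using V(2)[OF that] Vpm(4)[OF that] by simp
  have sym: "\<phi> z = sym z" if "norm z = 1" for z
    using V(3)[OF that] Vpm(4)[OF that] by (simp add: sym_def p_def m_def exp_add)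
  have ok: "border_ok Bd" if Bd: "Bd \<in> {B1, B2}" for Bd
    unfolding border_ok_def
  proof
    fix j assume j: "j \<in> {1..bord_m Bd}"
    have c: "bord_c Bd j \<noteq> 0" "norm (bord_c Bd j) \<noteq> 1" using Bd j B1 B2 by (auto simp: poles_ok_def)
    have a: "(cmod (bord_c Bd j) > 1 \<longrightarrow> \<rho> < cmod (bord_c Bd j)) \<and>
        (0 < cmod (bord_c Bd j) \<and> cmod (bord_c Bd j) < 1 \<longrightarrow> cmod (bord_c Bd j) < inverse \<rho>)"
      using adm Bd j unfolding admissible_radius_def by blast
    have "inverse \<rho> < inverse R" using Rs R1 by (intro less_imp_inverse_less) auto
    then have "bord_c Bd j \<notin> ann R" using a c Rs(2) by (cases "cmod (bord_c Bd j) > 1") auto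
    with c show "bord_c Bd j \<noteq> 0 \<and> bord_c Bd j \<notin> ann R" by blast
  qed
  have psi: "border_psi \<phi> Bd z = border_psi sym Bd z" if "norm z = 1" for Bd z
    by (simp add: border_psi_def sym[OF that])
  have det: "bordered_toeplitz_det \<phi> (border_psi \<phi> B1) (border_psi \<phi> B2) n
      = bordered_toeplitz_det sym (border_psi sym B1) (border_psi sym B2) n" for n
    by (intro bordered_toeplitz_det_cong sym psi)
  show ?thesis unfolding det by (rule bordered_szego_asymp[OF log]) (auto intro: ok)
qed

theorem theorem1p7:
  fixes \<phi> :: "complex \<Rightarrow> complex" and B1 B2 :: border
  assumes "szego_type \<phi>"
    and "poles_ok B1" and "poles_ok B2"
  shows "(\<exists>\<rho>. admissible_radius \<phi> B1 B2 \<rho>) \<and>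
    (\<forall>\<rho>. admissible_radius \<phi> B1 B2 \<rho> \<longrightarrow>
      (\<exists>r :: nat \<Rightarrow> complex.
         r \<in> O(\<lambda>n. complex_of_real (\<rho> powi (- int n))) \<and>
         (\<forall>n\<ge>3. bordered_toeplitz_det \<phi> (border_psi \<phi> B1) (border_psi \<phi> B2) n =
            szego_G \<phi> ^ n * szego_E \<phi> * (border_J1 \<phi> B1 B2 + r n))))"
proof (intro conjI allI impI)
  show "\<exists>\<rho>. admissible_radius \<phi> B1 B2 \<rho>" by (rule admissible_radius_exists[OF assms])
  fix \<rho> assume adm: "admissible_radius \<phi> B1 B2 \<rho>"
  have \<rho>: "1 < \<rho>" using adm by (simp add: admissible_radius_def)
  define D where "D = bordered_toeplitz_det \<phi> (border_psi \<phi> B1) (border_psi \<phi> B2)"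
  define F where "F n = szego_G \<phi> ^ n * szego_E \<phi>" for n
  define r where "r n = D n / F n - border_J1 \<phi> B1 B2" for n
  have F: "F n \<noteq> 0" for n by (simp add: F_def szego_G_def szego_E_def)
  obtain C where "eventually (\<lambda>n. \<exists>r'. norm r' \<le> C * inverse \<rho> ^ n \<and> D n = F n * (border_J1 \<phi> B1 B2 + r')) sequentially"
    using bordered_toeplitz_asymp[OF assms adm] unfolding D_def F_def by blast
  then have "eventually (\<lambda>n. norm (r n) \<le> C * norm (complex_of_real (\<rho> powi (- int n)))) sequentially"
  proof eventually_elim
    case (elim n)
    then obtain r' where r': "norm r' \<le> C * inverse \<rho> ^ n" "D n = F n * (border_J1 \<phi> B1 B2 + r')" by blast
    have "r n = r'" using F[of n] by (simp add: r_def r'(2))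
    moreover have "norm (complex_of_real (\<rho> powi (- int n))) = inverse \<rho> ^ n"
      using \<rho> by (simp add: power_int_minus power_inverse norm_power norm_inverse)
    ultimately show ?case using r'(1) by (simp only:)
  qed
  then have "r \<in> O(\<lambda>n. complex_of_real (\<rho> powi (- int n)))" by (rule bigoI)
  moreover have "D n = F n * (border_J1 \<phi> B1 B2 + r n)" for n using F[of n] by (simp add: r_def)
  ultimately show "\<exists>r :: nat \<Rightarrow> complex.
         r \<in> O(\<lambda>n. complex_of_real (\<rho> powi (- int n))) \<and>
         (\<forall>n\<ge>3. bordered_toeplitz_det \<phi> (border_psi \<phi> B1) (border_psi \<phi> B2) n =
            szego_G \<phi> ^ n * szego_E \<phi> * (border_J1 \<phi> B1 B2 + r n))"
    unfolding D_def F_def by blast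
qed

end
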